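(* Let $C>1$ be a real constant, $N,N'$ positive integers, and $M$ an integer bounded by a polynomial in $N+N'$. The swapping chain $P_{sw}$ with distributions $\pi_0,\dots,\pi_M$ (defined in the context) is polynomially mixing, i.e. its mixing time $\tau(\varepsilon)$ is bounded by a polynomial in $N+N'$ and $\log(1/\varepsilon)$.
   Context: On $S=\{-N,\dots,N'\}$ define for $i=0,\dots,M$ the distributions $\pi_i(x)=C^{\frac iM|x|}/Z_i$ with $Z_i$ the normalizing constant (so $\pi_M(x)\propto C^{|x|}$ is the asymmetric bimodal exponential distribution). Let $Q$ be the simple random walk on $S$: $Q(a,b)=1/2$ if $|a-b|=1$, and $Q(a,a)=1/2$ if $a\in\{-N,N'\}$. Let $P_i$ be the Metropolis chain for $\pi_i$ with proposal $Q$: $P_i(a,b)=Q(a,b)\min(1,\pi_i(b)/\pi_i(a))$ for $b\neq a$. Swapping chain $P_{sw}$: state space $S^{M+1}$, stationary distribution $\pi_{sw}(x)=\prod_i\pi_i(x_i)$. Each step chooses uniformly between a level move (choose $i\in\{0,\dots,M\}$ uniformly; move from $x$ to $x'$ differing only in coordinate $i$ with probability $\frac{1}{2(M+1)}P_i(x_i,x_i')$) and a swap move (choose $i\in\{0,\dots,M-1\}$ uniformly; exchange coordinates $i$ and $i+1$ with probability $\frac{1}{2M}\min\big(1,\frac{\pi_{i+1}(x_i)\pi_i(x_{i+1})}{\pi_i(x_i)\pi_{i+1}(x_{i+1})}\big)$). Mixing time: $\tau(\varepsilon)=\min\{t:\max_x\frac12\sum_y|P^{t'}(x,y)-\pi(y)|\le\varepsilon\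 \forall t'\ge t\}$. *)

theory Defs
  imports
    Complex_Main
    "HOL-Library.FuncSet"
    "HOL-Library.Extended_Real"
    "HOL-Computational_Algebra.Polynomial"
begin

section \<open>Finite Markov chains and mixing time\<close>

text \<open>A transition matrix on a finite set \<open>\<Omega>\<close> is a function \<open>P\<close> of which only the values
  \<open>P x y\<close> with \<open>x, y \<in> \<Omega>\<close> matter.\<close>

primrec kernel_pow :: "'a set \<Rightarrow> ('a \<Rightarrow> 'a \<Rightarrow> real) \<Rightarrow> nat \<Rightarrow> 'a \<Rightarrow> 'a \<Rightarrow> real" where
  "kernel_pow \<Omega> P 0 x y = (if x = y then 1 else 0)"
| "kernel_pow \<Omega> P (Suc t) x y = (\<Sum>z\<in>\<Omega>. P x z * kernel_pow \<Omega> P t z y)"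

text \<open>A chain given by its off-diagonal transition probabilities \<open>K x y\<close>, \<open>y \<noteq> x\<close>: with the
  remaining probability (rejected moves included) it stays where it is. The values
  \<open>K x x\<close> are ignored.\<close>

definition with_holding :: "'a set \<Rightarrow> ('a \<Rightarrow> 'a \<Rightarrow> real) \<Rightarrow> 'a \<Rightarrow> 'a \<Rightarrow> real" where
  "with_holding \<Omega> K x y = (if y = x then 1 - (\<Sum>z\<in>\<Omega> - {x}. K x z) else K x y)"

text \<open>The minimum is taken in \<^typ>\<open>enat\<close>, so that it is \<open>\<infinity>\<close> if there is no such \<open>t\<close>.\<close>

definition mixing_time ::
    "'a set \<Rightarrow> ('a \<Rightarrow> 'a \<Rightarrow> real) \<Rightarrow> ('a \<Rightarrow> real) \<Rightarrow> real \<Rightarrow> enat" where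
  "mixing_time \<Omega> P \<pi> \<epsilon> =
     Inf {enat t | t. \<forall>t'\<ge>t. (MAX x\<in>\<Omega>. 1/2 * (\<Sum>y\<in>\<Omega>. \<bar>kernel_pow \<Omega> P t' x y - \<pi> y\<bar>)) \<le> \<epsilon>}"

section \<open>Bimodal exponential distributions and their Metropolis chains\<close>

definition sites :: "nat \<Rightarrow> nat \<Rightarrow> int set" where
  "sites N N' = {- int N..int N'}"

definition bimodal_weight :: "real \<Rightarrow> nat \<Rightarrow> nat \<Rightarrow> int \<Rightarrow> real" where
  "bimodal_weight C M i x = C powr (real i / real M * real_of_int \<bar>x\<bar>)"

definition bimodal :: "real \<Rightarrow> nat \<Rightarrow> nat \<Rightarrow> nat \<Rightarrow> nat \<Rightarrow> int \<Rightarrow> real" where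
  "bimodal C N N' M i x =
     bimodal_weight C M i x / (\<Sum>z\<in>sites N N'. bimodal_weight C M i z)"

definition walk :: "nat \<Rightarrow> nat \<Rightarrow> int \<Rightarrow> int \<Rightarrow> real" where
  "walk N N' a b =
     (if \<bar>a - b\<bar> = 1 \<or> (a = b \<and> (a = - int N \<or> a = int N')) then 1/2 else 0)"

definition metropolis :: "real \<Rightarrow> nat \<Rightarrow> nat \<Rightarrow> nat \<Rightarrow> nat \<Rightarrow> int \<Rightarrow> int \<Rightarrow> real" where
  "metropolis C N N' M i =
     with_holding (sites N N')
       (\<lambda>a b. walk N N' a b * min 1 (bimodal C N N' M i b / bimodal C N N' M i a))"

section \<open>The swapping chain\<close>

definition swap_states :: "nat \<Rightarrow> nat \<Rightarrow> nat \<Rightarrow> (nat \<Rightarrow> int) set" where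
  "swap_states N N' M = {..M} \<rightarrow>\<^sub>E sites N N'"

definition swap_dist :: "real \<Rightarrow> nat \<Rightarrow> nat \<Rightarrow> nat \<Rightarrow> (nat \<Rightarrow> int) \<Rightarrow> real" where
  "swap_dist C N N' M x = (\<Prod>i\<le>M. bimodal C N N' M i (x i))"

definition swap_accept :: "real \<Rightarrow> nat \<Rightarrow> nat \<Rightarrow> nat \<Rightarrow> nat \<Rightarrow> (nat \<Rightarrow> int) \<Rightarrow> real" where
  "swap_accept C N N' M i x =
     min 1 (bimodal C N N' M (i + 1) (x i) * bimodal C N N' M i (x (i + 1)) /
            (bimodal C N N' M i (x i) * bimodal C N N' M (i + 1) (x (i + 1))))"

text \<open>The condition \<open>y = x(i := y i)\<close> says that \<open>x\<close> and \<open>y\<close> differ at most in coordinate \<open>i\<close>.\<close>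

definition swapping_chain ::
    "real \<Rightarrow> nat \<Rightarrow> nat \<Rightarrow> nat \<Rightarrow> (nat \<Rightarrow> int) \<Rightarrow> (nat \<Rightarrow> int) \<Rightarrow> real" where
  "swapping_chain C N N' M =
     with_holding (swap_states N N' M)
       (\<lambda>x y.
          (\<Sum>i\<le>M. if y = x(i := y i)
                   then 1 / (2 * (real M + 1)) * metropolis C N N' M i (x i) (y i) else 0) +
          (\<Sum>i<M. if y = x(i := x (i + 1), i + 1 := x i)
                   then 1 / (2 * real M) * swap_accept C N N' M i x else 0))"

section \<open>Polynomials in two variables\<close>

definition poly2 :: "real poly poly \<Rightarrow> real \<Rightarrow> real \<Rightarrow> real" where
  "poly2 p u v = poly (poly p [:v:]) u"

end

(*
Call the shorter of the two half-lines, together with 0, the class D and the rest the class U.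
Averaging over each class reduces a function of the state to a function g of the sign vector of
the M + 1 levels. Within a class the weights increase towards the endpoint, which carries a
polynomial fraction of the mass. Hence the variance within the classes is controlled by the level
moves, and a swap of two adjacent signs is controlled by the swap moves between states whose two
coordinates are endpoints.

For the variance of g, the mass of D relative to U decreases from each level to the next. So moving
a D from level i + 1 down to level i does not decrease the weight of the sign vector, and a flip
at level i + 1 can be routed through a flip at level i and two swaps. Iterating down to level 0,
where the distribution is uniform, gives a Poincare inequality with polynomial constant. The same
estimate for f(x) + f(y) in place of f(x) - f(y), obtained by alternating the sign along the walk
at level 0, excludes eigenvalues near -1, so the powers of the kernel contract at a polynomial
rate.
*)

theory Submission
  imports Defs "HOL-Analysis.Convex"
begin

text \<open>\<open>M\<close> is bounded only from above, so adjacent levels may differ strongly (for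
  \<open>M = 1\<close> the uniform distribution sits next to the target), and so do their
  conditional laws within a class. A swap of signs therefore does not lift directly to a swap of
  states. The endpoint of each class is heavy at every level, whatever the gap, and serves as the
  common meeting point; the price is a polynomial factor \<open>n\<close> for each coordinate moved
  there.

  The site \<open>0\<close> has to join the shorter half-line. Otherwise the monotonicity of the
  relative mass breaks: for equal half-lines the mass of \<open>{1..N}\<close> relative to
  \<open>{0..N}\<close> increases with the level.

  A direct flip at a high level would have to cross \<open>0\<close>, whose weight may be
  exponentially small there; this is why all flips are routed to level \<open>0\<close>. The bound
  against eigenvalues near \<open>-1\<close> lives on level \<open>0\<close> too: every proposal to
  a neighbour is accepted there, and the alternating sign is incompatible with holding at an
  endpoint, which has probability of order \<open>1 / M\<close>.\<close>

section \<open>Spectral gap and mixing time\<close>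

text \<open>The norm of a self-adjoint operator is the supremum of its quadratic form. Polarization
  between \<open>f\<close> and \<open>g = P f\<close> gives this without eigenvectors: reversibility
  makes the form \<open>B\<close> symmetric, and \<open>B g f\<close> is the squared norm of
  \<open>g\<close>.\<close>

lemma mean_square_self_adjoint_le:
  fixes P :: "'a \<Rightarrow> 'a \<Rightarrow> real" and \<pi> f :: "'a \<Rightarrow> real"
  assumes rev: "\<And>x y. x \<in> \<Omega> \<Longrightarrow> y \<in> \<Omega> \<Longrightarrow> \<pi> x * P x y = \<pi> y * P y x"
    and stoch: "\<And>x. x \<in> \<Omega> \<Longrightarrow> (\<Sum>y\<in>\<Omega>. P x y) = 1"
    and \<rho>: "\<rho> > 0"
    and form: "\<And>h. (\<Sum>x\<in>\<Omega>. \<pi> x * h x) = 0 \<Longrightarrow>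
        \<bar>\<Sum>x\<in>\<Omega>. \<Sum>y\<in>\<Omega>. \<pi> x * P x y * (h x * h y)\<bar> \<le> \<rho> * (\<Sum>x\<in>\<Omega>. \<pi> x * (h x)\<^sup>2)"
    and mean: "(\<Sum>x\<in>\<Omega>. \<pi> x * f x) = 0"
  shows "(\<Sum>x\<in>\<Omega>. \<pi> x * (\<Sum>y\<in>\<Omega>. P x y * f y)) = 0"
    and "(\<Sum>x\<in>\<Omega>. \<pi> x * (\<Sum>y\<in>\<Omega>. P x y * f y)\<^sup>2) \<le> \<rho>\<^sup>2 * (\<Sum>x\<in>\<Omega>. \<pi> x * (f x)\<^sup>2)"
proof -
  define g where "g x = (\<Sum>y\<in>\<Omega>. P x y * f y)" for x
  define B where "B h k = (\<Sum>x\<in>\<Omega>. \<Sum>y\<in>\<Omega>. \<pi> x * P x y * (h x * k y))" for h k :: "'a \<Rightarrow> real"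
  define q where "q h = (\<Sum>x\<in>\<Omega>. \<pi> x * (h x)\<^sup>2)" for h :: "'a \<Rightarrow> real"
  have sym: "B h k = B k h" for h k
  proof -
    have "B h k = (\<Sum>y\<in>\<Omega>. \<Sum>x\<in>\<Omega>. \<pi> x * P x y * (h x * k y))"
      unfolding B_def by (rule sum.swap)
    also have "\<dots> = B k h"
      unfolding B_def by (intro sum.cong refl) (simp add: rev)
    finally show ?thesis .
  qed
  have mean_g: "(\<Sum>x\<in>\<Omega>. \<pi> x * g x) = 0"
  proof -
    have "(\<Sum>x\<in>\<Omega>. \<pi> x * g x) = B (\<lambda>_. 1) f"
      by (simp add: B_def g_def sum_distrib_left mult.assoc)
    also have "\<dots> = B f (\<lambda>_. 1)" by (rule sym)
    also have "\<dots> = (\<Sum>x\<in>\<Omega>. \<pi> x * f x * (\<Sum>y\<in>\<Omega>. P x y))"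
      unfolding B_def sum_distrib_left by (intro sum.cong refl) simp
    also have "\<dots> = 0" using mean by (simp add: stoch)
    finally show ?thesis .
  qed
  then show "(\<Sum>x\<in>\<Omega>. \<pi> x * (\<Sum>y\<in>\<Omega>. P x y * f y)) = 0"
    by (simp add: g_def)
  have Bgf: "B g f = q g"
    by (simp add: B_def q_def g_def sum_distrib_left power2_eq_square algebra_simps)
  have expand: "B (\<lambda>x. f x + s * g x) (\<lambda>x. f x + s * g x) = B f f + 2 * s * q g + s\<^sup>2 * B g g" for s
  proof -
    have "B (\<lambda>x. f x + s * g x) (\<lambda>x. f x + s * g x) = B f f + s * B g f + s * B f g + s\<^sup>2 * B g g"
      unfolding B_def sum_distrib_left sum.distrib [symmetric]
      by (intro sum.cong refl) (simp add: algebra_simps power2_eq_square)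
    then show ?thesis using sym [of f g] Bgf by simp
  qed
  have q_expand: "q (\<lambda>x. f x + s * g x) = q f + 2 * s * (\<Sum>x\<in>\<Omega>. \<pi> x * f x * g x) + s\<^sup>2 * q g" for s
    unfolding q_def sum_distrib_left sum.distrib [symmetric]
    by (intro sum.cong refl) (simp add: algebra_simps power2_eq_square)
  have bound: "\<bar>B (\<lambda>x. f x + s * g x) (\<lambda>x. f x + s * g x)\<bar> \<le> \<rho> * q (\<lambda>x. f x + s * g x)" for s
  proof -
    have "(\<Sum>x\<in>\<Omega>. \<pi> x * (f x + s * g x)) = 0"
      using mean mean_g
      by (simp add: distrib_left sum.distrib mult.left_commute flip: sum_distrib_left)
    then show ?thesis unfolding B_def q_def by (rule form)
  qed
  define c where "c = (\<Sum>x\<in>\<Omega>. \<pi> x * f x * g x)"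
  \<comment> \<open>The form bound is used from above at \<open>f + s g\<close> and from below at
    \<open>f - s g\<close>. On adding the two, \<open>B f f\<close>, \<open>B g g\<close> and the
    mixed term \<open>c\<close> cancel.\<close>
  have "4 * s * q g \<le> \<rho> * (2 * q f + 2 * s\<^sup>2 * q g)" for s
  proof -
    have "B f f + 2 * s * q g + s\<^sup>2 * B g g \<le> \<rho> * (q f + 2 * s * c + s\<^sup>2 * q g)"
      using bound [of s] unfolding expand q_expand c_def by linarith
    moreover have "- (B f f + 2 * (- s) * q g + (- s)\<^sup>2 * B g g) \<le> \<rho> * (q f + 2 * (- s) * c + (- s)\<^sup>2 * q g)"
      using bound [of "- s"] unfolding expand q_expand c_def by linarith
    ultimately show ?thesis by (simp add: algebra_simps)
  qed
  \<comment> \<open>For \<open>s = 1 / \<rho>\<close> half of the left side absorbs the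
    \<open>q g\<close> term on the right. No division by \<open>q g\<close> occurs, so
    \<open>g = 0\<close> is covered.\<close>
  from this [of "1 / \<rho>"] have "4 * (1 / \<rho>) * q g \<le> \<rho> * (2 * q f + 2 * (1 / \<rho>)\<^sup>2 * q g)" .
  then have "q g \<le> \<rho>\<^sup>2 * q f"
    using \<rho> by (simp add: field_simps power2_eq_square)
  then show "(\<Sum>x\<in>\<Omega>. \<pi> x * (\<Sum>y\<in>\<Omega>. P x y * f y)\<^sup>2) \<le> \<rho>\<^sup>2 * (\<Sum>x\<in>\<Omega>. \<pi> x * (f x)\<^sup>2)"
    by (simp add: q_def g_def)
qed

text \<open>\<open>kernel_pow\<close> splits off the first step, \<open>Suc_right\<close> the last
  one; detailed balance then reverses the path. A row of the kernel power can thus be read as a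
  column.\<close>

lemma kernel_pow_reversible:
  assumes fin: "finite \<Omega>"
    and rev: "\<And>x y. x \<in> \<Omega> \<Longrightarrow> y \<in> \<Omega> \<Longrightarrow> \<pi> x * P x y = \<pi> y * P y x"
    and "x \<in> \<Omega>" "y \<in> \<Omega>"
  shows "\<pi> x * kernel_pow \<Omega> P t x y = \<pi> y * kernel_pow \<Omega> P t y x"
proof -
  have Suc_right: "kernel_pow \<Omega> P (Suc t) x y = (\<Sum>z\<in>\<Omega>. kernel_pow \<Omega> P t x z * P z y)"
    if "x \<in> \<Omega>" "y \<in> \<Omega>" for x y t
    using that
  proof (induction t arbitrary: x)
    case 0
    then show ?case using fin by (simp add: if_distrib if_distribR sum.delta sum.delta' cong: if_cong)
  next
    case (Suc t)
    have "kernel_pow \<Omega> P (Suc (Suc t)) x y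
        = (\<Sum>u\<in>\<Omega>. P x u * (\<Sum>z\<in>\<Omega>. kernel_pow \<Omega> P t u z * P z y))"
      using Suc by (subst kernel_pow.simps(2)) (intro sum.cong refl arg_cong2 [where f = "(*)"], auto)
    also have "\<dots> = (\<Sum>z\<in>\<Omega>. \<Sum>u\<in>\<Omega>. P x u * kernel_pow \<Omega> P t u z * P z y)"
      by (subst sum.swap) (simp add: sum_distrib_left mult.assoc)
    also have "\<dots> = (\<Sum>z\<in>\<Omega>. kernel_pow \<Omega> P (Suc t) x z * P z y)"
      by (simp add: sum_distrib_right)
    finally show ?case .
  qed
  show ?thesis using assms(3,4)
  proof (induction t arbitrary: x y)
    case 0
    then show ?case by simp
  next
    case (Suc t)
    have "\<pi> x * kernel_pow \<Omega> P (Suc t) x y = (\<Sum>z\<in>\<Omega>. (\<pi> x * P x z) * kernel_pow \<Omega> P t z y)"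
      by (simp add: sum_distrib_left mult.assoc)
    also have "\<dots> = (\<Sum>z\<in>\<Omega>. P z x * (\<pi> z * kernel_pow \<Omega> P t z y))"
      using Suc.prems rev by (intro sum.cong refl) simp
    also have "\<dots> = (\<Sum>z\<in>\<Omega>. P z x * (\<pi> y * kernel_pow \<Omega> P t y z))"
      using Suc by (intro sum.cong refl) simp
    also have "\<dots> = \<pi> y * kernel_pow \<Omega> P (Suc t) y x"
      using Suc_right Suc.prems by (simp add: sum_distrib_left algebra_simps)
    finally show ?case .
  qed
qed

text \<open>The two gaps confine the quadratic form on mean-zero functions to
  \<open>[- \<rho>, \<rho>]\<close> with \<open>\<rho> = 1 - 1 / K\<close>; \<open>gap'\<close> is
  the guard against near-periodicity. The \<open>L2\<close> distance to \<open>\<pi>\<close> decays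
  like \<open>\<rho> ^ t\<close> from at most \<open>exp (L / 2)\<close>, and Cauchy-Schwarz passes
  to total variation.\<close>

lemma mixing_time_le:
  fixes P :: "'a \<Rightarrow> 'a \<Rightarrow> real" and \<pi> :: "'a \<Rightarrow> real"
  assumes fin: "finite \<Omega>" and ne: "\<Omega> \<noteq> {}"
    and pos: "\<And>x. x \<in> \<Omega> \<Longrightarrow> exp (- L) \<le> \<pi> x"
    and total: "(\<Sum>x\<in>\<Omega>. \<pi> x) = 1"
    and rev: "\<And>x y. x \<in> \<Omega> \<Longrightarrow> y \<in> \<Omega> \<Longrightarrow> \<pi> x * P x y = \<pi> y * P y x"
    and stoch: "\<And>x. x \<in> \<Omega> \<Longrightarrow> (\<Sum>y\<in>\<Omega>. P x y) = 1"
    and K: "K > 1"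
    and gap: "\<And>f. (\<Sum>x\<in>\<Omega>. \<pi> x * f x) = 0 \<Longrightarrow>
      (\<Sum>x\<in>\<Omega>. \<pi> x * (f x)\<^sup>2) \<le> K * (1/2 * (\<Sum>x\<in>\<Omega>. \<Sum>y\<in>\<Omega>. \<pi> x * P x y * (f x - f y)\<^sup>2))"
    and gap': "\<And>f.
      (\<Sum>x\<in>\<Omega>. \<pi> x * (f x)\<^sup>2) \<le> K * (1/2 * (\<Sum>x\<in>\<Omega>. \<Sum>y\<in>\<Omega>. \<pi> x * P x y * (f x + f y)\<^sup>2))"
    and L: "L \<ge> 0" and \<epsilon>: "0 < \<epsilon>"
    and t: "real t \<ge> K * (ln (1 / \<epsilon>) + L)"
  shows "mixing_time \<Omega> P \<pi> \<epsilon> \<le> enat t"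
proof -
  define \<rho> where "\<rho> = 1 - 1 / K"
  have \<rho>: "\<rho> > 0" using K by (simp add: \<rho>_def)
  have pos': "\<pi> x > 0" if "x \<in> \<Omega>" for x
    using pos [OF that] exp_gt_zero [of "- L"] by linarith
  have form: "\<bar>\<Sum>x\<in>\<Omega>. \<Sum>y\<in>\<Omega>. \<pi> x * P x y * (h x * h y)\<bar> \<le> \<rho> * (\<Sum>x\<in>\<Omega>. \<pi> x * (h x)\<^sup>2)"
    if h: "(\<Sum>x\<in>\<Omega>. \<pi> x * h x) = 0" for h
  proof -
    define q where "q = (\<Sum>x\<in>\<Omega>. \<pi> x * (h x)\<^sup>2)"
    define B where "B = (\<Sum>x\<in>\<Omega>. \<Sum>y\<in>\<Omega>. \<pi> x * P x y * (h x * h y))"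
    have q1: "(\<Sum>x\<in>\<Omega>. \<Sum>y\<in>\<Omega>. \<pi> x * P x y * (h x)\<^sup>2) = q"
    proof -
      have "(\<Sum>y\<in>\<Omega>. \<pi> x * P x y * (h x)\<^sup>2) = \<pi> x * (h x)\<^sup>2" if "x \<in> \<Omega>" for x
        using stoch [OF that] by (simp flip: sum_distrib_left sum_distrib_right)
      then show ?thesis by (simp add: q_def)
    qed
    have "(\<Sum>x\<in>\<Omega>. \<Sum>y\<in>\<Omega>. \<pi> x * P x y * (h y)\<^sup>2) = (\<Sum>y\<in>\<Omega>. \<Sum>x\<in>\<Omega>. \<pi> x * P x y * (h y)\<^sup>2)"
      by (rule sum.swap)
    also have "\<dots> = (\<Sum>y\<in>\<Omega>. \<Sum>x\<in>\<Omega>. \<pi> y * P y x * (h y)\<^sup>2)"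
      by (intro sum.cong refl) (simp add: rev)
    finally have q2: "(\<Sum>x\<in>\<Omega>. \<Sum>y\<in>\<Omega>. \<pi> x * P x y * (h y)\<^sup>2) = q" using q1 by simp
    have "(\<Sum>x\<in>\<Omega>. \<Sum>y\<in>\<Omega>. \<pi> x * P x y * (h x - h y)\<^sup>2)
        = (\<Sum>x\<in>\<Omega>. \<Sum>y\<in>\<Omega>. \<pi> x * P x y * (h x)\<^sup>2 + \<pi> x * P x y * (h y)\<^sup>2
            + (-2) * (\<pi> x * P x y * (h x * h y)))"
      by (intro sum.cong refl) (simp add: power2_eq_square algebra_simps)
    also have "\<dots> = q + q + (-2) * B"
      unfolding sum.distrib q1 q2 B_def sum_distrib_left by simp
    finally have "q \<le> K * (1/2 * (q + q + (-2) * B))" using gap [OF h] by (simp only: flip: q_def)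
    then have up: "q \<le> K * (q - B)" by (simp add: algebra_simps)
    have "(\<Sum>x\<in>\<Omega>. \<Sum>y\<in>\<Omega>. \<pi> x * P x y * (h x + h y)\<^sup>2)
        = (\<Sum>x\<in>\<Omega>. \<Sum>y\<in>\<Omega>. \<pi> x * P x y * (h x)\<^sup>2 + \<pi> x * P x y * (h y)\<^sup>2
            + 2 * (\<pi> x * P x y * (h x * h y)))"
      by (intro sum.cong refl) (simp add: power2_eq_square algebra_simps)
    also have "\<dots> = q + q + 2 * B"
      unfolding sum.distrib q1 q2 B_def sum_distrib_left by simp
    finally have "q \<le> K * (1/2 * (q + q + 2 * B))" using gap' [of h] by (simp only: flip: q_def)
    then have lo: "q \<le> K * (q + B)" by (simp add: algebra_simps)
    have "\<bar>B\<bar> \<le> \<rho> * q"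
      using up lo K by (auto simp: \<rho>_def field_simps abs_le_iff)
    then show ?thesis by (simp add: B_def q_def)
  qed
  have tv: "1/2 * (\<Sum>y\<in>\<Omega>. \<bar>kernel_pow \<Omega> P t' x y - \<pi> y\<bar>) \<le> \<epsilon>"
    if x: "x \<in> \<Omega>" and t': "t' \<ge> t" for x t'
  proof -
    \<comment> \<open>\<open>u s\<close> is the density, relative to \<open>\<pi>\<close>, of the
      law after \<open>s\<close> steps from \<open>x\<close>, minus one. It is written with the
      column of \<open>x\<close>, since then one more step is one application of \<open>P\<close>;
      reversibility identifies it with the row later.\<close>
    define u where "u s y = kernel_pow \<Omega> P s y x / \<pi> x - 1" for s y
    have u_Suc: "u (Suc s) y = (\<Sum>z\<in>\<Omega>. P y z * u s z)" if "y \<in> \<Omega>" for s y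
      using stoch [OF that]
      by (simp add: u_def right_diff_distrib sum_subtractf sum_divide_distrib)
    have u: "(\<Sum>y\<in>\<Omega>. \<pi> y * u s y) = 0 \<and> (\<Sum>y\<in>\<Omega>. \<pi> y * (u s y)\<^sup>2) \<le> (\<rho>\<^sup>2) ^ s * (1 / \<pi> x)" for s
    proof (induction s)
      case 0
      have *: "u 0 y = (if y = x then 1 / \<pi> x else 0) - 1" for y by (simp add: u_def)
      have "(\<Sum>y\<in>\<Omega>. \<pi> y * u 0 y) = (\<Sum>y\<in>\<Omega>. (if y = x then 1 else 0) - \<pi> y)"
        using pos' [OF x] by (intro sum.cong refl) (auto simp: * field_simps)
      also have "\<dots> = 0" using x fin total by (simp add: sum_subtractf)
      finally have "(\<Sum>y\<in>\<Omega>. \<pi> y * u 0 y) = 0" .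
      moreover have "(\<Sum>y\<in>\<Omega>. \<pi> y * (u 0 y)\<^sup>2) \<le> 1 / \<pi> x"
      proof -
        have "(\<Sum>y\<in>\<Omega>. \<pi> y * (u 0 y)\<^sup>2) = (\<Sum>y\<in>\<Omega>. (if y = x then 1 / \<pi> x - 2 else 0) + \<pi> y)"
          using pos' [OF x]
          by (intro sum.cong refl) (auto simp: * power2_eq_square field_simps)
        also have "\<dots> = 1 / \<pi> x - 1" using x fin total by (simp add: sum.distrib)
        finally show ?thesis by simp
      qed
      ultimately show ?case by simp
    next
      case (Suc s)
      note step = mean_square_self_adjoint_le [of \<Omega> \<pi> P \<rho> "u s"]
      have "(\<Sum>y\<in>\<Omega>. \<pi> y * u (Suc s) y) = (\<Sum>y\<in>\<Omega>. \<pi> y * (\<Sum>z\<in>\<Omega>. P y z * u s z))"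
        by (intro sum.cong refl) (simp add: u_Suc)
      also have "\<dots> = 0"
        using rev stoch \<rho> form Suc by (intro step(1)) auto
      finally have "(\<Sum>y\<in>\<Omega>. \<pi> y * u (Suc s) y) = 0" .
      moreover have "(\<Sum>y\<in>\<Omega>. \<pi> y * (u (Suc s) y)\<^sup>2) \<le> (\<rho>\<^sup>2) ^ Suc s * (1 / \<pi> x)"
      proof -
        have "(\<Sum>y\<in>\<Omega>. \<pi> y * (u (Suc s) y)\<^sup>2) = (\<Sum>y\<in>\<Omega>. \<pi> y * (\<Sum>z\<in>\<Omega>. P y z * u s z)\<^sup>2)"
          by (intro sum.cong refl) (simp add: u_Suc)
        also have "\<dots> \<le> \<rho>\<^sup>2 * (\<Sum>y\<in>\<Omega>. \<pi> y * (u s y)\<^sup>2)"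
          using rev stoch \<rho> form Suc by (intro step(2)) auto
        also have "\<dots> \<le> \<rho>\<^sup>2 * ((\<rho>\<^sup>2) ^ s * (1 / \<pi> x))"
          using Suc by (intro mult_left_mono) auto
        finally show ?thesis by simp
      qed
      ultimately show ?case by simp
    qed
    have "(\<Sum>y\<in>\<Omega>. \<bar>kernel_pow \<Omega> P t' x y - \<pi> y\<bar>) = (\<Sum>y\<in>\<Omega>. \<pi> y * \<bar>u t' y\<bar>)"
    proof (rule sum.cong [OF refl])
      fix y assume y: "y \<in> \<Omega>"
      have "kernel_pow \<Omega> P t' x y = \<pi> y * kernel_pow \<Omega> P t' y x / \<pi> x"
        using kernel_pow_reversible [where P = P and \<pi> = \<pi>, OF fin rev x y, of t'] pos' [OF x]
        by (simp add: field_simps)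
      then have "kernel_pow \<Omega> P t' x y - \<pi> y = \<pi> y * u t' y"
        by (simp add: u_def algebra_simps)
      then show "\<bar>kernel_pow \<Omega> P t' x y - \<pi> y\<bar> = \<pi> y * \<bar>u t' y\<bar>"
        using pos' [OF y] by (simp add: abs_mult)
    qed
    also have "\<dots> \<le> exp (- (real t' / K)) * exp (L / 2)"
    proof (rule power2_le_imp_le)
      have nn: "\<pi> y \<ge> 0" if "y \<in> \<Omega>" for y using pos' [OF that] by simp
      have "(\<Sum>y\<in>\<Omega>. \<pi> y * \<bar>u t' y\<bar>)\<^sup>2 = (\<Sum>y\<in>\<Omega>. sqrt (\<pi> y) * (sqrt (\<pi> y) * \<bar>u t' y\<bar>))\<^sup>2"
        using nn by (intro arg_cong [where f = "\<lambda>v. v\<^sup>2"] sum.cong) (auto simp flip: mult.assoc)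
      also have "\<dots> \<le> (\<Sum>y\<in>\<Omega>. (sqrt (\<pi> y))\<^sup>2) * (\<Sum>y\<in>\<Omega>. (sqrt (\<pi> y) * \<bar>u t' y\<bar>)\<^sup>2)"
        by (rule Cauchy_Schwarz_ineq_sum)
      also have "\<dots> = (\<Sum>y\<in>\<Omega>. \<pi> y * (u t' y)\<^sup>2)"
        using nn total by (simp add: power_mult_distrib)
      also have "\<dots> \<le> (\<rho> ^ t')\<^sup>2 * (1 / \<pi> x)"
        using u [of t'] by (simp flip: power_mult add: mult.commute)
      also have "\<dots> \<le> (exp (- (real t' / K)))\<^sup>2 * (exp (L / 2))\<^sup>2"
      proof (intro mult_mono power_mono)
        have "\<rho> ^ t' \<le> exp (- (1 / K)) ^ t'"
          using \<rho> exp_ge_add_one_self [of "- (1 / K)"] by (intro power_mono) (auto simp: \<rho>_def)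
        then show "\<rho> ^ t' \<le> exp (- (real t' / K))" by (simp flip: exp_of_nat_mult)
        have "1 / \<pi> x \<le> 1 / exp (- L)"
          using pos [OF x] by (intro divide_left_mono) (auto intro: mult_pos_pos pos' [OF x])
        also have "\<dots> = (exp (L / 2))\<^sup>2" by (simp add: exp_minus field_simps flip: exp_double)
        finally show "1 / \<pi> x \<le> (exp (L / 2))\<^sup>2" .
      qed (use \<rho> pos' [OF x] in auto)
      finally show "(\<Sum>y\<in>\<Omega>. \<pi> y * \<bar>u t' y\<bar>)\<^sup>2 \<le> (exp (- (real t' / K)) * exp (L / 2))\<^sup>2"
        by (simp add: power_mult_distrib)
    qed simp
    also have "\<dots> = exp (L / 2 - real t' / K)" by (simp flip: exp_add)
    also have "\<dots> \<le> exp (ln \<epsilon>)"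
    proof -
      have "K * (ln (1 / \<epsilon>) + L) \<le> real t'" using t t' by linarith
      then have "ln (1 / \<epsilon>) + L \<le> real t' / K" using K by (simp add: field_simps)
      then have "L / 2 - real t' / K \<le> ln \<epsilon>" using L \<epsilon> by (simp add: ln_div)
      then show ?thesis by (simp only: exp_le_cancel_iff)
    qed
    finally show ?thesis using \<epsilon> by simp
  qed
  show ?thesis unfolding mixing_time_def
    using fin ne tv by (intro Inf_lower CollectI exI [of _ t]) auto
qed

section \<open>Averages over product spaces\<close>

text \<open>The expectation of \<open>f x\<close> when the coordinates \<open>x k\<close> are drawn
  independently from the kernels \<open>\<theta> k (z k)\<close>. Source and target types differ so
  that one operator covers the passage from sign vectors to states, the reverse passage, and
  redrawing within one space.\<close>

definition avg :: "nat \<Rightarrow> 'b set \<Rightarrow> (nat \<Rightarrow> 'a \<Rightarrow> 'b \<Rightarrow> real) \<Rightarrow> ((nat \<Rightarrow> 'b) \<Rightarrow> real) \<Rightarrow> (nat \<Rightarrow> 'a) \<Rightarrow> real"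
  where "avg M S \<theta> f z = (\<Sum>x\<in>{..M} \<rightarrow>\<^sub>E S. (\<Prod>k\<le>M. \<theta> k (z k) (x k)) * f x)"

lemma avg_cong:
  assumes "\<And>x. x \<in> {..M} \<rightarrow>\<^sub>E S \<Longrightarrow> (\<And>k. k \<le> M \<Longrightarrow> \<theta> k (z k) (x k) \<noteq> 0) \<Longrightarrow> f x = h x"
  shows "avg M S \<theta> f z = avg M S \<theta> h z"
  unfolding avg_def
proof (rule sum.cong [OF refl])
  fix x assume "x \<in> {..M} \<rightarrow>\<^sub>E S"
  then show "(\<Prod>k\<le>M. \<theta> k (z k) (x k)) * f x = (\<Prod>k\<le>M. \<theta> k (z k) (x k)) * h x"
    using assms [of x] by (cases "\<exists>k\<le>M. \<theta> k (z k) (x k) = 0") auto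
qed

lemma avg_kernel_cong:
  assumes "\<And>k a. k \<le> M \<Longrightarrow> a \<in> S \<Longrightarrow> \<theta> k (z k) a = \<theta>' k (z' k) a"
  shows "avg M S \<theta> f z = avg M S \<theta>' f z'"
  unfolding avg_def using assms
  by (intro sum.cong prod.cong arg_cong2 [where f = "(*)"] refl) (auto dest: PiE_mem)

lemma avg_diff: "avg M S \<theta> (\<lambda>x. f x - h x) z = avg M S \<theta> f z - avg M S \<theta> h z"
  by (simp add: avg_def right_diff_distrib sum_subtractf)

lemma sum_prod_PiE_eq_1:
  fixes w :: "nat \<Rightarrow> 'b \<Rightarrow> real"
  assumes "finite S" "\<And>k. k \<le> M \<Longrightarrow> (\<Sum>a\<in>S. w k a) = 1"
  shows "(\<Sum>x\<in>{..M} \<rightarrow>\<^sub>E S. \<Prod>k\<le>M. w k (x k)) = 1"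
  using assms prod_sum_PiE [of "{..M}" "\<lambda>_. S" w] by simp

lemma avg_square_le:
  assumes "finite S"
    and nonneg: "\<And>k a. k \<le> M \<Longrightarrow> a \<in> S \<Longrightarrow> 0 \<le> \<theta> k (z k) a"
    and total: "\<And>k. k \<le> M \<Longrightarrow> (\<Sum>a\<in>S. \<theta> k (z k) a) = 1"
  shows "(avg M S \<theta> f z)\<^sup>2 \<le> avg M S \<theta> (\<lambda>x. (f x)\<^sup>2) z"
proof -
  let ?W = "\<lambda>x. \<Prod>k\<le>M. \<theta> k (z k) (x k)"
  have W: "?W x \<ge> 0" if "x \<in> {..M} \<rightarrow>\<^sub>E S" for x
    using that nonneg by (intro prod_nonneg) (auto dest: PiE_mem)
  have "(avg M S \<theta> f z)\<^sup>2 = (\<Sum>x\<in>{..M} \<rightarrow>\<^sub>E S. sqrt (?W x) * (sqrt (?W x) * f x))\<^sup>2"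
    unfolding avg_def using W
    by (intro arg_cong [where f = "\<lambda>v. v\<^sup>2"] sum.cong) (auto simp flip: mult.assoc)
  also have "\<dots> \<le> (\<Sum>x\<in>{..M} \<rightarrow>\<^sub>E S. (sqrt (?W x))\<^sup>2) * (\<Sum>x\<in>{..M} \<rightarrow>\<^sub>E S. (sqrt (?W x) * f x)\<^sup>2)"
    by (rule Cauchy_Schwarz_ineq_sum)
  also have "\<dots> = avg M S \<theta> (\<lambda>x. (f x)\<^sup>2) z"
    using W sum_prod_PiE_eq_1 [OF assms(1), of M "\<lambda>k. \<theta> k (z k)"] total
    by (simp add: power_mult_distrib avg_def)
  finally show ?thesis .
qed

lemma sum_PiE_exchange_coordinate:
  fixes F :: "(nat \<Rightarrow> 'b) \<Rightarrow> 'b \<Rightarrow> real"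
  assumes "j \<le> M"
  shows "(\<Sum>x\<in>{..M} \<rightarrow>\<^sub>E S. \<Sum>a\<in>S. F x a) = (\<Sum>x\<in>{..M} \<rightarrow>\<^sub>E S. \<Sum>a\<in>S. F (x(j := a)) (x j))"
  unfolding sum.cartesian_product
  by (rule sum.reindex_bij_witness
      [where i = "\<lambda>(x, a). (x(j := a), x j)" and j = "\<lambda>(x, a). (x(j := a), x j)"])
    (use assms in \<open>auto simp: PiE_iff extensional_def\<close>)

text \<open>The coordinate \<open>j\<close> drawn from \<open>\<theta> j (z j)\<close> is discarded
  and drawn anew from \<open>\<kappa> (z j)\<close>; the old draw integrates to one. The exchange of
  the old value with the new one is an involution.\<close>

lemma avg_update:
  fixes \<theta> :: "nat \<Rightarrow> 'a \<Rightarrow> 'b \<Rightarrow> real"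
  assumes j: "j \<le> M" and total: "(\<Sum>a\<in>S. \<theta> j (z j) a) = 1"
  shows "avg M S (\<theta>(j := \<kappa>)) f z = avg M S \<theta> (\<lambda>x. \<Sum>a\<in>S. \<kappa> (z j) a * f (x(j := a))) z"
proof -
  define R where "R x = (\<Prod>k\<in>{..M} - {j}. \<theta> k (z k) (x k))" for x :: "nat \<Rightarrow> 'b"
  have split: "(\<Prod>k\<le>M. \<theta> k (z k) (x k)) = \<theta> j (z j) (x j) * R x" for x
    unfolding R_def using j by (subst prod.remove [of _ j]) auto
  have split': "(\<Prod>k\<le>M. (\<theta>(j := \<kappa>)) k (z k) (x k)) = \<kappa> (z j) (x j) * R x" for x
    unfolding R_def using j by (subst prod.remove [of _ j]) (auto intro!: prod.cong)
  have R: "R (x(j := a)) = R x" for x a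
    unfolding R_def by (intro prod.cong) auto
  have "avg M S \<theta> (\<lambda>x. \<Sum>a\<in>S. \<kappa> (z j) a * f (x(j := a))) z
      = (\<Sum>x\<in>{..M} \<rightarrow>\<^sub>E S. \<Sum>a\<in>S. \<theta> j (z j) (x j) * R x * (\<kappa> (z j) a * f (x(j := a))))"
    by (simp add: avg_def split sum_distrib_left)
  also have "\<dots> = (\<Sum>x\<in>{..M} \<rightarrow>\<^sub>E S. \<Sum>a\<in>S. \<theta> j (z j) a * (R x * (\<kappa> (z j) (x j) * f x)))"
    by (subst sum_PiE_exchange_coordinate [OF j]) (simp add: R mult.assoc)
  also have "\<dots> = avg M S (\<theta>(j := \<kappa>)) f z"
  proof -
    have "(\<Sum>a\<in>S. \<theta> j (z j) a * (R x * (\<kappa> (z j) (x j) * f x))) = \<kappa> (z j) (x j) * R x * f x" for x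
      using total by (simp flip: sum_distrib_right)
    then show ?thesis unfolding avg_def split' by (rule sum.cong [OF refl])
  qed
  finally show ?thesis by simp
qed

text \<open>Fubini: a product measure followed by a product kernel is again a product measure,
  pushed forward level by level.\<close>

lemma sum_avg:
  fixes \<theta> :: "nat \<Rightarrow> 'a \<Rightarrow> 'b \<Rightarrow> real" and \<mu> :: "nat \<Rightarrow> 'a \<Rightarrow> real"
  assumes "finite Z"
  shows "(\<Sum>z\<in>{..M} \<rightarrow>\<^sub>E Z. (\<Prod>k\<le>M. \<mu> k (z k)) * avg M S \<theta> f z)
      = (\<Sum>x\<in>{..M} \<rightarrow>\<^sub>E S. (\<Prod>k\<le>M. \<Sum>a\<in>Z. \<mu> k a * \<theta> k a (x k)) * f x)"
proof -
  have "(\<Sum>z\<in>{..M} \<rightarrow>\<^sub>E Z. (\<Prod>k\<le>M. \<mu> k (z k)) * avg M S \<theta> f z)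
      = (\<Sum>x\<in>{..M} \<rightarrow>\<^sub>E S. \<Sum>z\<in>{..M} \<rightarrow>\<^sub>E Z. (\<Prod>k\<le>M. \<mu> k (z k) * \<theta> k (z k) (x k)) * f x)"
    unfolding avg_def sum_distrib_left
    by (subst sum.swap) (simp add: prod.distrib mult.assoc)
  also have "\<dots> = (\<Sum>x\<in>{..M} \<rightarrow>\<^sub>E S. (\<Prod>k\<le>M. \<Sum>a\<in>Z. \<mu> k a * \<theta> k a (x k)) * f x)"
    using assms by (simp add: prod_sum_PiE flip: sum_distrib_right)
  finally show ?thesis .
qed

lemma avg_deterministic:
  assumes "finite S" "\<And>k. k \<le> M \<Longrightarrow> \<phi> (z k) \<in> S"
  shows "avg M S (\<lambda>k a b. of_bool (b = \<phi> a)) f z = f (restrict (\<phi> \<circ> z) {..M})"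
proof -
  let ?y = "restrict (\<phi> \<circ> z) {..M}"
  have "(\<Prod>k\<le>M. of_bool (x k = \<phi> (z k))) * f x = (if x = ?y then f ?y else 0)"
    if "x \<in> {..M} \<rightarrow>\<^sub>E S" for x
  proof -
    have "x = ?y \<longleftrightarrow> (\<forall>k\<le>M. x k = \<phi> (z k))"
      using that by (auto simp: PiE_iff extensional_def restrict_def fun_eq_iff)
    then show ?thesis by (auto simp: prod_zero_iff)
  qed
  moreover have "?y \<in> {..M} \<rightarrow>\<^sub>E S" using assms(2) by auto
  ultimately show ?thesis
    using assms(1) by (simp add: avg_def finite_PiE)
qed

text \<open>The coordinates are averaged one after the other, and the norms of the increments are added.\<close>

lemma efron_stein:
  fixes \<kappa> :: "nat \<Rightarrow> 'a \<Rightarrow> 'a \<Rightarrow> real"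
  assumes fin: "finite S"
    and nonneg: "\<And>k a b. k \<le> M \<Longrightarrow> a \<in> S \<Longrightarrow> b \<in> S \<Longrightarrow> 0 \<le> \<kappa> k a b"
    and stoch: "\<And>k a. k \<le> M \<Longrightarrow> a \<in> S \<Longrightarrow> (\<Sum>b\<in>S. \<kappa> k a b) = 1"
    and \<mu>: "\<And>k a. k \<le> M \<Longrightarrow> a \<in> S \<Longrightarrow> 0 \<le> \<mu> k a"
    and stat: "\<And>k b. k \<le> M \<Longrightarrow> b \<in> S \<Longrightarrow> (\<Sum>a\<in>S. \<mu> k a * \<kappa> k a b) = \<mu> k b"
  shows "(\<Sum>x\<in>{..M} \<rightarrow>\<^sub>E S. (\<Prod>k\<le>M. \<mu> k (x k)) * (f x - avg M S \<kappa> f x)\<^sup>2)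
      \<le> real (M + 1) * (\<Sum>i\<le>M. \<Sum>x\<in>{..M} \<rightarrow>\<^sub>E S. (\<Prod>k\<le>M. \<mu> k (x k))
            * (f x - (\<Sum>a\<in>S. \<kappa> i (x i) a * f (x(i := a))))\<^sup>2)"
proof -
  let ?\<Omega> = "{..M} \<rightarrow>\<^sub>E S" and ?\<mu> = "\<lambda>x. \<Prod>k\<le>M. \<mu> k (x k)"
  \<comment> \<open>\<open>\<theta> m\<close> averages the coordinates below \<open>m\<close> and
    freezes the others, so it leads from the identity at \<open>m = 0\<close> to
    \<open>\<kappa>\<close> at \<open>m = M + 1\<close>; \<open>h i\<close> is what averaging
    coordinate \<open>i\<close> alone takes away from \<open>f\<close>.\<close>
  define \<theta> where "\<theta> m = (\<lambda>k a b. if k < m then \<kappa> k a b else of_bool (b = a))" for m :: nat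
  define h where "h i x = f x - (\<Sum>a\<in>S. \<kappa> i (x i) a * f (x(i := a)))" for i x
  have \<theta>_nonneg: "0 \<le> \<theta> m k a b" if "k \<le> M" "a \<in> S" "b \<in> S" for m k a b
    using nonneg that by (simp add: \<theta>_def)
  have \<theta>_stoch: "(\<Sum>b\<in>S. \<theta> m k a b) = 1" if "k \<le> M" "a \<in> S" for m k a
    using stoch that fin by (cases "k < m") (simp_all add: \<theta>_def)
  have \<theta>_stat: "(\<Sum>a\<in>S. \<mu> k a * \<theta> m k a b) = \<mu> k b" if "k \<le> M" "b \<in> S" for m k b
    using stat that fin by (cases "k < m") (simp_all add: \<theta>_def)
  have \<mu>_nonneg: "0 \<le> ?\<mu> x" if "x \<in> ?\<Omega>" for x
    using that \<mu> by (intro prod_nonneg) (auto dest: PiE_mem)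
  have step: "avg M S (\<theta> m) f x - avg M S (\<theta> (Suc m)) f x = avg M S (\<theta> m) (h m) x"
    if m: "m \<le> M" and x: "x \<in> ?\<Omega>" for m x
  proof -
    have "\<theta> (Suc m) = (\<theta> m)(m := \<kappa> m)"
      by (auto simp: \<theta>_def fun_eq_iff less_Suc_eq)
    moreover have "(\<Sum>a\<in>S. \<theta> m m (x m) a) = 1" using m x by (intro \<theta>_stoch) auto
    ultimately have "avg M S (\<theta> (Suc m)) f x = avg M S (\<theta> m) (\<lambda>y. \<Sum>a\<in>S. \<kappa> m (x m) a * f (y(m := a))) x"
      using m by (simp only: avg_update)
    \<comment> \<open>Under \<open>\<theta> m\<close> coordinate \<open>m\<close> is still frozen,
      so \<open>\<kappa> m\<close> may start from \<open>y m\<close> in place of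
      \<open>x m\<close>.\<close>
    also have "\<dots> = avg M S (\<theta> m) (\<lambda>y. \<Sum>a\<in>S. \<kappa> m (y m) a * f (y(m := a))) x"
    proof (rule avg_cong)
      fix y assume "\<And>k. k \<le> M \<Longrightarrow> \<theta> m k (x k) (y k) \<noteq> 0"
      from this [OF m] have "y m = x m" by (auto simp: \<theta>_def)
      then show "(\<Sum>a\<in>S. \<kappa> m (x m) a * f (y(m := a))) = (\<Sum>a\<in>S. \<kappa> m (y m) a * f (y(m := a)))"
        by simp
    qed
    finally show ?thesis unfolding h_def by (simp add: avg_diff)
  qed
  have telescope: "f x - avg M S \<kappa> f x = (\<Sum>m\<le>M. avg M S (\<theta> m) (h m) x)" if x: "x \<in> ?\<Omega>" for x
  proof -
    have "avg M S (\<theta> 0) f x = avg M S (\<lambda>k a b. of_bool (b = id a)) f x"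
      by (simp add: \<theta>_def)
    also have "\<dots> = f (restrict (id \<circ> x) {..M})"
      using x by (intro avg_deterministic [OF fin]) auto
    also have "restrict (id \<circ> x) {..M} = x"
      using x by (simp add: PiE_restrict)
    finally have "avg M S (\<theta> 0) f x = f x" .
    moreover have "avg M S (\<theta> (Suc M)) f x = avg M S \<kappa> f x"
      by (intro avg_kernel_cong) (simp add: \<theta>_def)
    moreover have "(\<Sum>m\<le>M. avg M S (\<theta> m) (h m) x)
        = (\<Sum>m<Suc M. avg M S (\<theta> m) f x - avg M S (\<theta> (Suc m)) f x)"
      using step x by (intro sum.cong) (auto simp: lessThan_Suc_atMost)
    ultimately show ?thesis
      using sum_lessThan_telescope' [of "\<lambda>m. avg M S (\<theta> m) f x" "Suc M"] by simp
  qed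
  have invariant: "(\<Sum>x\<in>?\<Omega>. ?\<mu> x * avg M S (\<theta> m) F x) = (\<Sum>x\<in>?\<Omega>. ?\<mu> x * F x)" for m F
    unfolding sum_avg [OF fin]
    by (intro sum.cong prod.cong arg_cong2 [where f = "(*)"] refl \<theta>_stat) (auto dest: PiE_mem)
  have "(\<Sum>x\<in>?\<Omega>. ?\<mu> x * (f x - avg M S \<kappa> f x)\<^sup>2)
      \<le> (\<Sum>x\<in>?\<Omega>. ?\<mu> x * (real (M + 1) * (\<Sum>m\<le>M. avg M S (\<theta> m) (\<lambda>x. (h m x)\<^sup>2) x)))"
  proof (intro sum_mono mult_left_mono \<mu>_nonneg)
    fix x assume x: "x \<in> ?\<Omega>"
    \<comment> \<open>Cauchy-Schwarz over the \<open>M + 1\<close> increments; this is the source of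
      the factor \<open>M + 1\<close>.\<close>
    have "(f x - avg M S \<kappa> f x)\<^sup>2 \<le> (\<Sum>m\<le>M. (avg M S (\<theta> m) (h m) x)\<^sup>2) * real (card {..M})"
      unfolding telescope [OF x] by (rule sum_squared_le_sum_of_squares)
    also have "\<dots> \<le> (\<Sum>m\<le>M. avg M S (\<theta> m) (\<lambda>x. (h m x)\<^sup>2) x) * real (card {..M})"
      using fin \<theta>_nonneg \<theta>_stoch x
      by (intro mult_right_mono sum_mono avg_square_le) (auto dest: PiE_mem)
    finally show "(f x - avg M S \<kappa> f x)\<^sup>2 \<le> real (M + 1) * (\<Sum>m\<le>M. avg M S (\<theta> m) (\<lambda>x. (h m x)\<^sup>2) x)"
      by (simp add: mult.commute)
  qed
  also have "\<dots> = real (M + 1) * (\<Sum>m\<le>M. \<Sum>x\<in>?\<Omega>. ?\<mu> x * avg M S (\<theta> m) (\<lambda>x. (h m x)\<^sup>2) x)"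
    by (subst sum.swap) (simp add: sum_distrib_left mult_ac)
  also have "\<dots> = real (M + 1) * (\<Sum>m\<le>M. \<Sum>x\<in>?\<Omega>. ?\<mu> x * (h m x)\<^sup>2)"
    unfolding invariant ..
  finally show ?thesis by (simp add: h_def)
qed

section \<open>Products of levels with two classes\<close>

definition swap_at :: "nat \<Rightarrow> (nat \<Rightarrow> 'a) \<Rightarrow> nat \<Rightarrow> 'a"
  where "swap_at j x = x(j := x (Suc j), Suc j := x j)"

lemma swap_at_swap_at [simp]: "swap_at j (swap_at j x) = x"
  by (auto simp: swap_at_def fun_eq_iff)

lemma swap_at_apply [simp]:
  "swap_at j x j = x (Suc j)" "swap_at j x (Suc j) = x j"
  by (auto simp: swap_at_def)

lemma swap_at_in_PiE:
  assumes "j < M" "x \<in> {..M} \<rightarrow>\<^sub>E S"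
  shows "swap_at j x \<in> {..M} \<rightarrow>\<^sub>E S"
  using assms by (auto simp: swap_at_def PiE_iff extensional_def)

lemma sum_PiE_swap_at:
  assumes "j < M"
  shows "(\<Sum>x\<in>{..M} \<rightarrow>\<^sub>E S. F (swap_at j x)) = (\<Sum>x\<in>{..M} \<rightarrow>\<^sub>E S. F x)"
  by (rule sum.reindex_bij_witness [where i = "swap_at j" and j = "swap_at j"])
    (simp_all add: swap_at_in_PiE [OF assms])

lemma prod_split_adjacent:
  fixes F :: "nat \<Rightarrow> real"
  assumes "j < M"
  shows "(\<Prod>k\<le>M. F k) = F j * F (Suc j) * (\<Prod>k\<in>{..M} - {j, Suc j}. F k)"
proof -
  have "{..M} = insert j (insert (Suc j) ({..M} - {j, Suc j}))" using assms by auto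
  then have "(\<Prod>k\<le>M. F k) = prod F (insert j (insert (Suc j) ({..M} - {j, Suc j})))" by simp
  also have "\<dots> = F j * F (Suc j) * (\<Prod>k\<in>{..M} - {j, Suc j}. F k)"
    by (subst prod.insert; simp)+
  finally show ?thesis .
qed

lemma prod_swap_at:
  fixes F :: "nat \<Rightarrow> 'a \<Rightarrow> real"
  assumes "j < M"
  shows "(\<Prod>k\<le>M. F k (swap_at j x k))
    = F j (x (Suc j)) * F (Suc j) (x j) * (\<Prod>k\<in>{..M} - {j, Suc j}. F k (x k))"
  unfolding prod_split_adjacent [OF assms, of "\<lambda>k. F k (swap_at j x k)"] swap_at_apply
  by (intro arg_cong2 [where f = "(*)"] prod.cong) (auto simp: swap_at_def)

lemma prod_swap_at_both:
  fixes \<theta> :: "nat \<Rightarrow> 'a \<Rightarrow> 'b \<Rightarrow> real"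
  assumes "j < M" "\<theta> j = \<theta> (Suc j)"
  shows "(\<Prod>k\<le>M. \<theta> k (swap_at j z k) (swap_at j x k)) = (\<Prod>k\<le>M. \<theta> k (z k) (x k))"
proof -
  have "(\<Prod>k\<in>{..M} - {j, Suc j}. \<theta> k (swap_at j z k) (swap_at j x k))
      = (\<Prod>k\<in>{..M} - {j, Suc j}. \<theta> k (z k) (x k))"
    by (intro prod.cong) (auto simp: swap_at_def)
  then show ?thesis
    unfolding prod_split_adjacent [OF assms(1)] swap_at_apply assms(2) by simp
qed

text \<open>The two coordinates draw from the same kernel, so it does not matter whether the
  starting points or the results are swapped. The conditional laws \<open>\<nu>\<close> of two
  levels differ; point masses at the corners are the kernels to which this is applied.\<close>

lemma avg_swap_at:
  assumes "j < M" "\<theta> j = \<theta> (Suc j)"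
  shows "avg M S \<theta> f (swap_at j z) = avg M S \<theta> (\<lambda>x. f (swap_at j x)) z"
proof -
  have "avg M S \<theta> f (swap_at j z)
      = (\<Sum>x\<in>{..M} \<rightarrow>\<^sub>E S. (\<Prod>k\<le>M. \<theta> k (swap_at j z k) (swap_at j x k)) * f (swap_at j x))"
    unfolding avg_def
    by (rule sum_PiE_swap_at [OF assms(1), symmetric,
          where F = "\<lambda>x. (\<Prod>k\<le>M. \<theta> k (swap_at j z k) (x k)) * f x"])
  then show ?thesis by (simp add: prod_swap_at_both [OF assms] avg_def)
qed

text \<open>The product measure is invariant under redrawing coordinate \<open>i\<close> from
  \<open>w i\<close>. Read from right to left, it exposes a sum over one level inside the sum over
  states, to which an inequality for that level applies.\<close>

lemma sum_prod_resample:
  fixes w :: "nat \<Rightarrow> 'b \<Rightarrow> real"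
  assumes "i \<le> M" "(\<Sum>a\<in>S. w i a) = 1"
  shows "(\<Sum>x\<in>{..M} \<rightarrow>\<^sub>E S. (\<Prod>k\<le>M. w k (x k)) * (\<Sum>a\<in>S. w i a * F (x(i := a))))
    = (\<Sum>x\<in>{..M} \<rightarrow>\<^sub>E S. (\<Prod>k\<le>M. w k (x k)) * F x)"
  using avg_update [where j = i and M = M and S = S and \<theta> = "\<lambda>k (_ :: unit). w k" and z = "\<lambda>_. ()"
      and \<kappa> = "\<lambda>_. w i" and f = F] assms
  by (simp add: avg_def fun_upd_idem)

text \<open>Expanding the square of \<open>a - m (b + c)\<close> bounds the mixed term; a large
  \<open>m\<close> puts most of the loss on \<open>b\<close> and \<open>c\<close>.\<close>

lemma square_add_le:
  fixes a b c m :: real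
  assumes "m > 0"
  shows "(a + b + c)\<^sup>2 \<le> (1 + 1 / m) * a\<^sup>2 + 2 * (1 + m) * (b\<^sup>2 + c\<^sup>2)"
proof -
  have "0 \<le> (a - m * (b + c))\<^sup>2 / m" using assms by simp
  also have "\<dots> = a\<^sup>2 / m - 2 * a * (b + c) + m * (b + c)\<^sup>2"
    using assms by (simp add: power2_eq_square field_simps)
  finally have "2 * a * (b + c) \<le> a\<^sup>2 / m + m * (b + c)\<^sup>2" by simp
  moreover have "(b + c)\<^sup>2 \<le> 2 * (b\<^sup>2 + c\<^sup>2)"
    using zero_le_power2 [of "b - c"] by (simp add: power2_eq_square algebra_simps)
  moreover have "(1 + m) * (b + c)\<^sup>2 \<le> (1 + m) * (2 * (b\<^sup>2 + c\<^sup>2))"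
    using assms calculation(2) by (intro mult_left_mono) auto
  ultimately show ?thesis by (simp add: power2_eq_square algebra_simps)
qed

lemma inj_on_reset: "inj_on (\<lambda>z. z(k := False)) {z \<in> A. z k}"
  by (rule inj_on_inverseI [where g = "\<lambda>z. z(k := True)"]) (auto simp: fun_upd_idem)

definition class_mass :: "'a set \<Rightarrow> ('a \<Rightarrow> bool) \<Rightarrow> (nat \<Rightarrow> 'a \<Rightarrow> real) \<Rightarrow> nat \<Rightarrow> bool \<Rightarrow> real"
  where "class_mass S d w k b = (\<Sum>a\<in>{a \<in> S. d a = b}. w k a)"

text \<open>\<open>D k\<close> is a Dirichlet form for the distribution \<open>w k\<close> of level \<open>k\<close>, and \<open>e b\<close> is a point of class \<open>b\<close>
  that carries a fraction of at least \<open>1 / n\<close> of its mass.\<close>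

locale two_class_levels =
  fixes S :: "'a set" and d :: "'a \<Rightarrow> bool" and e :: "bool \<Rightarrow> 'a" and w :: "nat \<Rightarrow> 'a \<Rightarrow> real"
    and M :: nat and n R :: real and D :: "nat \<Rightarrow> ('a \<Rightarrow> real) \<Rightarrow> real" and b0 :: 'a
    and p :: "nat \<Rightarrow> bool \<Rightarrow> real"
  defines p_def: "p \<equiv> class_mass S d w"
  assumes fin: "finite S"
    and w_pos: "\<And>k a. k \<le> M \<Longrightarrow> a \<in> S \<Longrightarrow> 0 < w k a"
    and w_total: "\<And>k. k \<le> M \<Longrightarrow> (\<Sum>a\<in>S. w k a) = 1"
    and e_in: "\<And>b. e b \<in> S" and d_e [simp]: "\<And>b. d (e b) = b"
    and corner_mass: "\<And>k b. k \<le> M \<Longrightarrow> p k b \<le> n * w k (e b)"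
    and ratio: "\<And>k. k < M \<Longrightarrow> p (Suc k) True * p k False \<le> p k True * p (Suc k) False"
    and True_le: "\<And>k. k \<le> M \<Longrightarrow> p k True \<le> 2 * p k False"
    and D_nonneg: "\<And>k F. k \<le> M \<Longrightarrow> 0 \<le> D k F"
    and to_corner: "\<And>k F. k \<le> M \<Longrightarrow> (\<Sum>a\<in>S. w k a * (F a - F (e (d a)))\<^sup>2) \<le> R * D k F"
    and b0: "b0 \<in> S"
    and base: "\<And>F. (\<Sum>a\<in>S. w 0 a * (F a - F b0)\<^sup>2) \<le> R * D 0 F"
    and M_pos: "M > 0" and R: "R \<ge> 1"
begin

definition \<pi> :: "(nat \<Rightarrow> 'a) \<Rightarrow> real" where "\<pi> x = (\<Prod>k\<le>M. w k (x k))"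
definition pz :: "(nat \<Rightarrow> bool) \<Rightarrow> real" where "pz z = (\<Prod>k\<le>M. p k (z k))"
text \<open>\<open>\<nu> k s\<close> is the distribution of level \<open>k\<close> conditioned on
  the class \<open>s\<close>; \<open>\<delta> s\<close> is the point mass at the corner of that
  class.\<close>

definition \<nu> :: "nat \<Rightarrow> bool \<Rightarrow> 'a \<Rightarrow> real" where "\<nu> k s a = of_bool (d a = s) * w k a / p k s"
definition \<delta> :: "bool \<Rightarrow> 'a \<Rightarrow> real" where "\<delta> s a = of_bool (a = e s)"

abbreviation \<Omega> where "\<Omega> \<equiv> {..M} \<rightarrow>\<^sub>E S"
abbreviation Z where "Z \<equiv> {..M} \<rightarrow>\<^sub>E (UNIV :: bool set)"

text \<open>The inner value does not depend on \<open>x i\<close>, which is overwritten, so the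
  weight \<open>\<pi> x\<close> merely averages over the other coordinates.\<close>

definition level_form :: "nat \<Rightarrow> ((nat \<Rightarrow> 'a) \<Rightarrow> real) \<Rightarrow> real"
  where "level_form i f = (\<Sum>x\<in>\<Omega>. \<pi> x * D i (\<lambda>a. f (x(i := a))))"

text \<open>The minimum is \<open>\<pi> x\<close> times the acceptance probability of the swap; the
  probability of selecting level \<open>j\<close> is left out.\<close>

definition swap_form :: "nat \<Rightarrow> ((nat \<Rightarrow> 'a) \<Rightarrow> real) \<Rightarrow> real"
  where "swap_form j f = (\<Sum>x\<in>\<Omega>. min (\<pi> x) (\<pi> (swap_at j x)) * (f x - f (swap_at j x))\<^sup>2)"

definition sign_swap_form :: "nat \<Rightarrow> ((nat \<Rightarrow> bool) \<Rightarrow> real) \<Rightarrow> real"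
  where "sign_swap_form j g = (\<Sum>z\<in>Z. min (pz z) (pz (swap_at j z)) * (g z - g (swap_at j z))\<^sup>2)"

text \<open>Each flip is counted once and weighted by its \<open>True\<close> end. By
  \<open>pz_le_flip\<close> this weight is at most twice that of the other end, so it is comparable
  to the minimum of the two.\<close>

definition flip_form :: "nat \<Rightarrow> ((nat \<Rightarrow> bool) \<Rightarrow> real) \<Rightarrow> real"
  where "flip_form k g = (\<Sum>z\<in>{z \<in> Z. z k}. pz z * (g z - g (z(k := False)))\<^sup>2)"

section \<open>Class masses, conditional laws and corner kernels\<close>

lemma finite_\<Omega> [simp]: "finite \<Omega>" and finite_Z [simp]: "finite Z"
  using fin by (auto intro: finite_PiE)

lemma p_pos: "k \<le> M \<Longrightarrow> 0 < p k s"
  unfolding p_def class_mass_def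
  using fin w_pos e_in by (intro sum_pos) (auto intro!: exI [of _ "e s"])

lemma corner_le_p: "k \<le> M \<Longrightarrow> w k (e s) \<le> p k s"
  unfolding p_def class_mass_def
  using fin e_in by (intro member_le_sum) (auto intro: less_imp_le w_pos)

lemma n_ge_1: "n \<ge> 1"
proof -
  have "1 * w 0 (e True) \<le> n * w 0 (e True)"
    using corner_mass [of 0 True] corner_le_p [of 0 True] by simp
  then show ?thesis using w_pos [of 0 "e True"] e_in by (simp add: mult_le_cancel_right)
qed

lemma sum_by_class: "(\<Sum>a\<in>S. F a) = (\<Sum>a\<in>{a \<in> S. d a = True}. F a) + (\<Sum>a\<in>{a \<in> S. d a = False}. F a)"
  for F :: "'a \<Rightarrow> real"
  by (subst sum.union_disjoint [symmetric]) (use fin in \<open>auto intro: arg_cong2 [where f = sum]\<close>)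

lemma p_total: "k \<le> M \<Longrightarrow> p k True + p k False = 1"
  using sum_by_class [of "w k"] w_total [of k] by (simp add: p_def class_mass_def)

lemma p_le_1: "k \<le> M \<Longrightarrow> p k s \<le> 1"
  using p_total [of k] p_pos [of k True] p_pos [of k False] by (cases s) auto

lemma \<pi>_pos: "x \<in> \<Omega> \<Longrightarrow> 0 < \<pi> x"
  unfolding \<pi>_def by (intro prod_pos) (auto intro: w_pos dest: PiE_mem)

lemma pz_pos: "0 < pz z"
  unfolding pz_def by (intro prod_pos) (auto intro: p_pos)

lemma pz_nonneg [simp]: "0 \<le> pz z"
  using pz_pos [of z] by simp

lemma \<nu>_nonneg: "k \<le> M \<Longrightarrow> a \<in> S \<Longrightarrow> 0 \<le> \<nu> k s a"
  using w_pos [of k a] p_pos [of k s] by (simp add: \<nu>_def)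

lemma \<nu>_total: "(\<Sum>a\<in>S. \<nu> k s a) = 1" if k: "k \<le> M"
proof -
  have "(\<Sum>a\<in>S. of_bool (d a = s) * w k a) = p k s"
    unfolding p_def class_mass_def using fin
    by (intro sum.mono_neutral_cong_right) auto
  then show ?thesis
    using p_pos [OF k, of s] by (simp add: \<nu>_def flip: sum_divide_distrib)
qed

lemma \<delta>_total: "(\<Sum>a\<in>S. \<delta> s a) = 1"
  using fin e_in by (simp add: \<delta>_def)

lemma p_\<nu>: "k \<le> M \<Longrightarrow> (\<Sum>s\<in>UNIV. p k s * \<nu> k s a) = w k a"
  using p_pos [of k True] p_pos [of k False] by (auto simp: UNIV_bool \<nu>_def)

text \<open>Only the sign \<open>d a\<close> contributes, and only if \<open>a\<close> is a corner;
  there the mass of the whole class has been collected, which \<open>corner_mass\<close>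
  bounds.\<close>

lemma p_\<delta>: "(\<Sum>s\<in>UNIV. p k s * \<delta> s a) \<le> n * w k a"
  if k: "k \<le> M" and a: "a \<in> S"
proof -
  have "p k s * \<delta> s a = (if s = d a then p k s * of_bool (a = e s) else 0)" for s
    by (cases "a = e s") (auto simp: \<delta>_def)
  then have "(\<Sum>s\<in>UNIV. p k s * \<delta> s a) = (\<Sum>s\<in>UNIV. if s = d a then p k s * of_bool (a = e s) else 0)"
    by simp
  also have "\<dots> = p k (d a) * of_bool (a = e (d a))" by simp
  also have "\<dots> \<le> n * w k a"
    using corner_mass [OF k, of "d a"] n_ge_1 w_pos [OF k a] by auto
  finally show ?thesis .
qed

text \<open>Given the signs, the levels in \<open>J\<close> sit at their corners and the others
  follow their conditional laws. \<open>J = {}\<close> is the conditional expectation given the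
  signs; the case \<open>{j, Suc j}\<close> prepares a swap.\<close>

definition corner_kernel :: "nat set \<Rightarrow> nat \<Rightarrow> bool \<Rightarrow> 'a \<Rightarrow> real"
  where "corner_kernel J = (\<lambda>k. if k \<in> J then \<delta> else \<nu> k)"

lemma corner_kernel_nonneg: "k \<le> M \<Longrightarrow> a \<in> S \<Longrightarrow> 0 \<le> corner_kernel J k s a"
  by (auto simp: corner_kernel_def \<nu>_nonneg \<delta>_def)

lemma corner_kernel_total: "k \<le> M \<Longrightarrow> (\<Sum>a\<in>S. corner_kernel J k s a) = 1"
  by (simp add: corner_kernel_def \<nu>_total \<delta>_total)

text \<open>The left side is the law of the state when the signs are drawn from \<open>pz\<close>
  and the levels from \<open>corner_kernel J\<close>. Its density relative to \<open>\<pi>\<close>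
  loses a factor \<open>n\<close> for each level at a corner and none elsewhere.\<close>

lemma prod_corner_kernel_le:
  assumes J: "J \<subseteq> {..M}" and x: "x \<in> \<Omega>"
  shows "(\<Prod>k\<le>M. \<Sum>s\<in>UNIV. p k s * corner_kernel J k s (x k)) \<le> n ^ card J * \<pi> x"
proof -
  have "(\<Prod>k\<le>M. \<Sum>s\<in>UNIV. p k s * corner_kernel J k s (x k))
      \<le> (\<Prod>k\<le>M. (if k \<in> J then n else 1) * w k (x k))"
    using x p_\<nu> p_\<delta>
    by (intro prod_mono conjI sum_nonneg mult_nonneg_nonneg corner_kernel_nonneg)
      (auto simp: corner_kernel_def intro: less_imp_le p_pos dest!: PiE_mem)
  also have "\<dots> = n ^ card J * \<pi> x"
    using J by (simp add: prod.distrib \<pi>_def prod.If_cases Int_absorb1)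
  finally show ?thesis .
qed

lemma sum_square_avg_le:
  assumes J: "J \<subseteq> {..M}"
  shows "(\<Sum>z\<in>Z. pz z * (avg M S (corner_kernel J) F z)\<^sup>2) \<le> n ^ card J * (\<Sum>x\<in>\<Omega>. \<pi> x * (F x)\<^sup>2)"
proof -
  have "(\<Sum>z\<in>Z. pz z * (avg M S (corner_kernel J) F z)\<^sup>2)
      \<le> (\<Sum>z\<in>Z. pz z * avg M S (corner_kernel J) (\<lambda>x. (F x)\<^sup>2) z)"
    using pz_pos fin
    by (intro sum_mono mult_left_mono avg_square_le corner_kernel_nonneg corner_kernel_total)
      (auto intro: less_imp_le)
  also have "\<dots> = (\<Sum>x\<in>\<Omega>. (\<Prod>k\<le>M. \<Sum>s\<in>UNIV. p k s * corner_kernel J k s (x k)) * (F x)\<^sup>2)"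
    unfolding pz_def by (rule sum_avg) simp
  also have "\<dots> \<le> (\<Sum>x\<in>\<Omega>. n ^ card J * \<pi> x * (F x)\<^sup>2)"
    by (intro sum_mono mult_right_mono prod_corner_kernel_le [OF J]) auto
  finally show ?thesis by (simp add: sum_distrib_left mult.assoc)
qed

text \<open>Under \<open>corner_kernel J\<close> with \<open>j\<close> outside \<open>J\<close>, the
  coordinate \<open>x j\<close> lies in the class \<open>z j\<close>, so its target corner can be
  read off from the state itself. The difference becomes the average of a displacement of
  \<open>f\<close> in one coordinate.\<close>

lemma avg_corner_kernel_insert:
  assumes "j \<le> M" "j \<notin> J"
  shows "avg M S (corner_kernel J) f z - avg M S (corner_kernel (insert j J)) f z
    = avg M S (corner_kernel J) (\<lambda>x. f x - f (x(j := e (d (x j))))) z"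
proof -
  have "corner_kernel (insert j J) = (corner_kernel J)(j := \<delta>)"
    by (auto simp: corner_kernel_def fun_eq_iff)
  then have "avg M S (corner_kernel (insert j J)) f z
      = avg M S (corner_kernel J) (\<lambda>x. \<Sum>a\<in>S. \<delta> (z j) a * f (x(j := a))) z"
    using assms(1) corner_kernel_total by (simp add: avg_update)
  also have "\<dots> = avg M S (corner_kernel J) (\<lambda>x. f (x(j := e (d (x j))))) z"
  proof (rule avg_cong)
    fix x assume "\<And>k. k \<le> M \<Longrightarrow> corner_kernel J k (z k) (x k) \<noteq> 0"
    from this [OF assms(1)] have "d (x j) = z j"
      using assms(2) by (auto simp: corner_kernel_def \<nu>_def)
    then show "(\<Sum>a\<in>S. \<delta> (z j) a * f (x(j := a))) = f (x(j := e (d (x j))))"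
      using fin e_in by (simp add: \<delta>_def)
  qed
  finally show ?thesis by (simp add: avg_diff)
qed

lemma level_form_nonneg: "i \<le> M \<Longrightarrow> 0 \<le> level_form i f"
  unfolding level_form_def
  by (intro sum_nonneg mult_nonneg_nonneg D_nonneg) (auto intro: less_imp_le \<pi>_pos)

lemma swap_form_nonneg: "0 \<le> swap_form j f" if "j < M"
proof -
  have "0 \<le> min (\<pi> x) (\<pi> (swap_at j x))" if "x \<in> \<Omega>" for x
    using \<pi>_pos [OF that] \<pi>_pos [OF swap_at_in_PiE [OF \<open>j < M\<close> that]] by simp
  then show ?thesis
    unfolding swap_form_def by (intro sum_nonneg mult_nonneg_nonneg) auto
qed

lemma sign_swap_form_nonneg: "0 \<le> sign_swap_form j g"
  unfolding sign_swap_form_def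
  by (intro sum_nonneg mult_nonneg_nonneg) (auto intro: less_imp_le pz_pos)

section \<open>Variance within the classes\<close>

lemma corner_displacement_le:
  assumes "i \<le> M"
  shows "(\<Sum>x\<in>\<Omega>. \<pi> x * (f x - f (x(i := e (d (x i)))))\<^sup>2) \<le> R * level_form i f"
proof -
  have "(\<Sum>x\<in>\<Omega>. \<pi> x * (f x - f (x(i := e (d (x i)))))\<^sup>2)
      = (\<Sum>x\<in>\<Omega>. \<pi> x * (\<Sum>a\<in>S. w i a * (f (x(i := a)) - f (x(i := e (d a))))\<^sup>2))"
    using sum_prod_resample [where i = i and M = M and S = S and w = w and F = "\<lambda>x. (f x - f (x(i := e (d (x i)))))\<^sup>2"] w_total assms
    by (simp add: \<pi>_def)
  also have "\<dots> \<le> (\<Sum>x\<in>\<Omega>. \<pi> x * (R * D i (\<lambda>a. f (x(i := a)))))"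
    by (intro sum_mono mult_left_mono to_corner assms) (auto intro: less_imp_le \<pi>_pos)
  finally show ?thesis by (simp add: level_form_def sum_distrib_left mult_ac)
qed

lemma base_displacement_le:
  "(\<Sum>x\<in>\<Omega>. \<pi> x * (f x - f (x(0 := b0)))\<^sup>2) \<le> R * level_form 0 f"
proof -
  have "(\<Sum>x\<in>\<Omega>. \<pi> x * (f x - f (x(0 := b0)))\<^sup>2)
      = (\<Sum>x\<in>\<Omega>. \<pi> x * (\<Sum>a\<in>S. w 0 a * (f (x(0 := a)) - f (x(0 := b0)))\<^sup>2))"
    using sum_prod_resample [where i = 0 and M = M and S = S and w = w and F = "\<lambda>x. (f x - f (x(0 := b0)))\<^sup>2"] w_total
    by (simp add: \<pi>_def)
  also have "\<dots> \<le> (\<Sum>x\<in>\<Omega>. \<pi> x * (R * D 0 (\<lambda>a. f (x(0 := a)))))"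
    by (intro sum_mono mult_left_mono base) (auto intro: less_imp_le \<pi>_pos)
  finally show ?thesis by (simp add: level_form_def sum_distrib_left mult_ac)
qed

text \<open>The conditional mean is the best approximation among functions of the class. The
  application takes for \<open>c\<close> the values at the corners, which turns a variance into a
  displacement to the corner.\<close>

lemma sum_square_conditional_le:
  assumes k: "k \<le> M"
  shows "(\<Sum>a\<in>S. w k a * (F a - (\<Sum>b\<in>S. \<nu> k (d a) b * F b))\<^sup>2) \<le> (\<Sum>a\<in>S. w k a * (F a - c (d a))\<^sup>2)"
proof -
  define m where "m s = (\<Sum>b\<in>S. \<nu> k s b * F b)" for s
  have "(\<Sum>a\<in>{a \<in> S. d a = s}. w k a * (F a - m (d a))\<^sup>2)
      \<le> (\<Sum>a\<in>{a \<in> S. d a = s}. w k a * (F a - c (d a))\<^sup>2)" for s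
  proof -
    let ?A = "{a \<in> S. d a = s}"
    have pm: "p k s * m s = (\<Sum>a\<in>?A. w k a * F a)"
    proof -
      have "p k s * m s = (\<Sum>a\<in>S. of_bool (d a = s) * w k a * F a)"
        using p_pos [OF k, of s] by (simp add: m_def \<nu>_def sum_distrib_left)
      also have "\<dots> = (\<Sum>a\<in>?A. w k a * F a)"
        using fin by (intro sum.mono_neutral_cong_right) auto
      finally show ?thesis .
    qed
    have "(\<Sum>a\<in>?A. w k a * (F a - c (d a))\<^sup>2) - (\<Sum>a\<in>?A. w k a * (F a - m (d a))\<^sup>2)
        = (\<Sum>a\<in>?A. 2 * (m s - c s) * (w k a * F a) - (m s - c s) * (m s + c s) * w k a)"
      unfolding sum_subtractf [symmetric]
      by (intro sum.cong) (auto simp: power2_eq_square algebra_simps)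
    also have "\<dots> = 2 * (m s - c s) * (p k s * m s) - (m s - c s) * (m s + c s) * p k s"
      unfolding sum_subtractf sum_distrib_left [symmetric] pm
      by (simp add: p_def class_mass_def)
    also have "\<dots> = p k s * (m s - c s)\<^sup>2"
      by (simp add: power2_eq_square algebra_simps)
    also have "\<dots> \<ge> 0" using p_pos [OF k, of s] by simp
    finally show ?thesis by simp
  qed
  then show ?thesis
    unfolding m_def by (subst (1 2) sum_by_class) (intro add_mono)
qed

text \<open>Redrawing each level within its class is a stationary kernel, so
  \<open>efron_stein\<close> reduces the conditional variance to single levels, where
  \<open>to_corner\<close> applies.\<close>

lemma sum_square_diff_conditional_le:
  "(\<Sum>x\<in>\<Omega>. \<pi> x * (f x - avg M S \<nu> f (restrict (d \<circ> x) {..M}))\<^sup>2)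
    \<le> real (M + 1) * (R * (\<Sum>i\<le>M. level_form i f))"
proof -
  have "(\<Sum>x\<in>\<Omega>. \<pi> x * (f x - avg M S \<nu> f (restrict (d \<circ> x) {..M}))\<^sup>2)
      = (\<Sum>x\<in>\<Omega>. \<pi> x * (f x - avg M S (\<lambda>k a. \<nu> k (d a)) f x)\<^sup>2)"
    by (intro sum.cong refl arg_cong2 [where f = "(*)"] arg_cong2 [where f = "(-)"]
        arg_cong [where f = "\<lambda>v. v\<^sup>2"] avg_kernel_cong) simp
  also have "\<dots> \<le> real (M + 1) * (\<Sum>i\<le>M. \<Sum>x\<in>\<Omega>. \<pi> x
      * (f x - (\<Sum>a\<in>S. \<nu> i (d (x i)) a * f (x(i := a))))\<^sup>2)"
    unfolding \<pi>_def
  proof (rule efron_stein [OF fin])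
    fix k b assume k: "k \<le> M" and b: "b \<in> S"
    have "(\<Sum>a\<in>S. w k a * \<nu> k (d a) b) = (\<Sum>a\<in>{a \<in> S. d a = d b}. w k a * (w k b / p k (d b)))"
      using fin by (intro sum.mono_neutral_cong_right) (auto simp: \<nu>_def)
    also have "\<dots> = p k (d b) * (w k b / p k (d b))"
      unfolding sum_distrib_right [symmetric] by (simp add: p_def class_mass_def)
    also have "\<dots> = w k b" using p_pos [OF k, of "d b"] by simp
    finally show "(\<Sum>a\<in>S. w k a * \<nu> k (d a) b) = w k b" .
  qed (auto simp: \<nu>_nonneg \<nu>_total intro: less_imp_le w_pos)
  also have "\<dots> \<le> real (M + 1) * (\<Sum>i\<le>M. R * level_form i f)"
  proof (intro mult_left_mono sum_mono)
    fix i assume "i \<in> {..M}"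
    then have i: "i \<le> M" by simp
    have "(\<Sum>x\<in>\<Omega>. \<pi> x * (f x - (\<Sum>a\<in>S. \<nu> i (d (x i)) a * f (x(i := a))))\<^sup>2)
        = (\<Sum>x\<in>\<Omega>. \<pi> x * (\<Sum>b\<in>S. w i b
            * (f (x(i := b)) - (\<Sum>a\<in>S. \<nu> i (d b) a * f (x(i := a))))\<^sup>2))"
      using sum_prod_resample [where i = i and M = M and S = S and w = w and
          F = "\<lambda>x. (f x - (\<Sum>a\<in>S. \<nu> i (d (x i)) a * f (x(i := a))))\<^sup>2"] w_total i
      by (simp add: \<pi>_def)
    also have "\<dots> \<le> (\<Sum>x\<in>\<Omega>. \<pi> x * (\<Sum>b\<in>S. w i b * (f (x(i := b)) - f (x(i := e (d b))))\<^sup>2))"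
      using i by (intro sum_mono mult_left_mono
          sum_square_conditional_le [where F = "\<lambda>b. f (_(i := b))" and c = "\<lambda>s. f (_(i := e s))"])
        (auto intro: less_imp_le \<pi>_pos)
    also have "\<dots> \<le> (\<Sum>x\<in>\<Omega>. \<pi> x * (R * D i (\<lambda>a. f (x(i := a)))))"
      using i by (intro sum_mono mult_left_mono to_corner) (auto intro: less_imp_le \<pi>_pos)
    also have "\<dots> = R * level_form i f"
      by (simp add: level_form_def sum_distrib_left mult_ac)
    finally show "(\<Sum>x\<in>\<Omega>. \<pi> x * (f x - (\<Sum>a\<in>S. \<nu> i (d (x i)) a * f (x(i := a))))\<^sup>2)
      \<le> R * level_form i f" .
  qed simp
  finally show ?thesis by (simp add: sum_distrib_left)
qed

section \<open>Flips and swaps of the sign vector\<close>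

lemma pz_split: "k \<le> M \<Longrightarrow> pz z = p k (z k) * (\<Prod>i\<in>{..M} - {k}. p i (z i))"
  unfolding pz_def by (rule prod.remove) auto

lemma pz_upd:
  assumes "k \<le> M"
  shows "pz (z(k := s)) * p k (z k) = pz z * p k s"
proof -
  have "(\<Prod>i\<in>{..M} - {k}. p i ((z(k := s)) i)) = (\<Prod>i\<in>{..M} - {k}. p i (z i))"
    by (intro prod.cong) auto
  then show ?thesis
    using pz_split [OF assms, of "z(k := s)"] pz_split [OF assms, of z] by simp
qed

lemma pz_le_flip:
  assumes "k \<le> M" "z k"
  shows "pz z \<le> 2 * pz (z(k := False))"
proof -
  have "pz z * p k False = pz (z(k := False)) * p k True"
    using pz_upd [OF assms(1), of z False] assms(2) by simp
  also have "\<dots> \<le> pz (z(k := False)) * (2 * p k False)"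
    using pz_pos True_le [OF assms(1)] by (intro mult_left_mono) (auto intro: less_imp_le)
  finally have "pz z * p k False \<le> (2 * pz (z(k := False))) * p k False" by simp
  then show ?thesis using p_pos [OF assms(1), of False] by simp
qed

text \<open>Level \<open>0\<close> is the only level with a displacement bound across both classes:
  all its sites can be moved to \<open>b0\<close>. The constant is \<open>2 + 4\<close>, the second
  summand being doubled by moving the weight from the \<open>True\<close> end to the
  \<open>False\<close> end.\<close>

lemma flip_form_0_le: "flip_form 0 (avg M S \<nu> f) \<le> 6 * R * level_form 0 f"
proof -
  define F where "F x = f x - f (x(0 := b0))" for x
  let ?g = "avg M S \<nu> f" and ?h = "avg M S \<nu> F"
  define h0 where "h0 z = avg M S \<nu> (\<lambda>x. f (x(0 := b0))) z" for z
  \<comment> \<open>Setting coordinate \<open>0\<close> to \<open>b0\<close> forgets the sign at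
    level \<open>0\<close>, so \<open>h0\<close> is unchanged by the flip and only the displacement
    part \<open>?h\<close> remains.\<close>
  have "h0 z = avg M S (\<nu>(0 := \<lambda>_ a. of_bool (a = b0))) f z" for z
    unfolding h0_def using fin b0 by (subst avg_update) (auto simp: \<nu>_total)
  then have h0: "h0 (z(0 := s)) = h0 z" for z s
    by (auto intro!: avg_kernel_cong)
  have g: "?g z = ?h z + h0 z" for z by (simp add: F_def [abs_def] h0_def avg_diff)
  have "flip_form 0 ?g \<le> (\<Sum>z\<in>{z \<in> Z. z 0}. 2 * (pz z * (?h z)\<^sup>2)
      + 4 * (pz (z(0 := False)) * (?h (z(0 := False)))\<^sup>2))"
    unfolding flip_form_def
  proof (intro sum_mono)
    fix z assume "z \<in> {z \<in> Z. z 0}"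
    let ?y = "z(0 := False)"
    have "(a - b)\<^sup>2 \<le> 2 * a\<^sup>2 + 2 * b\<^sup>2" for a b :: real
      using zero_le_power2 [of "a + b"] by (simp add: power2_eq_square algebra_simps)
    moreover have "?g z - ?g ?y = ?h z - ?h ?y" using g h0 by simp
    ultimately have "(?g z - ?g ?y)\<^sup>2 \<le> 2 * (?h z)\<^sup>2 + 2 * (?h ?y)\<^sup>2" by simp
    then have "pz z * (?g z - ?g ?y)\<^sup>2 \<le> pz z * (2 * (?h z)\<^sup>2 + 2 * (?h ?y)\<^sup>2)"
      using pz_pos by (intro mult_left_mono) (auto intro: less_imp_le)
    also have "\<dots> = 2 * (pz z * (?h z)\<^sup>2) + 2 * (pz z * (?h ?y)\<^sup>2)"
      by (simp add: algebra_simps)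
    also have "pz z * (?h ?y)\<^sup>2 \<le> (2 * pz ?y) * (?h ?y)\<^sup>2"
      using \<open>z \<in> {z \<in> Z. z 0}\<close> by (intro mult_right_mono pz_le_flip) auto
    finally show "pz z * (?g z - ?g ?y)\<^sup>2 \<le> 2 * (pz z * (?h z)\<^sup>2) + 4 * (pz ?y * (?h ?y)\<^sup>2)"
      by simp
  qed
  also have "\<dots> = 2 * (\<Sum>z\<in>{z \<in> Z. z 0}. pz z * (?h z)\<^sup>2)
      + 4 * (\<Sum>z\<in>{z \<in> Z. z 0}. pz (z(0 := False)) * (?h (z(0 := False)))\<^sup>2)"
    by (simp add: sum.distrib sum_distrib_left)
  also have "(\<Sum>z\<in>{z \<in> Z. z 0}. pz z * (?h z)\<^sup>2) \<le> (\<Sum>z\<in>Z. pz z * (?h z)\<^sup>2)"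
    using pz_pos by (intro sum_mono2) (auto intro: less_imp_le)
  also have "(\<Sum>z\<in>{z \<in> Z. z 0}. pz (z(0 := False)) * (?h (z(0 := False)))\<^sup>2)
      = (\<Sum>z\<in>(\<lambda>z. z(0 := False)) ` {z \<in> Z. z 0}. pz z * (?h z)\<^sup>2)"
    by (simp add: sum.reindex [OF inj_on_reset])
  also have "\<dots> \<le> (\<Sum>z\<in>Z. pz z * (?h z)\<^sup>2)"
    using pz_pos by (intro sum_mono2) (auto intro: less_imp_le simp: PiE_iff extensional_def)
  also have "(\<Sum>z\<in>Z. pz z * (?h z)\<^sup>2) \<le> (\<Sum>x\<in>\<Omega>. \<pi> x * (F x)\<^sup>2)"
    using sum_square_avg_le [of "{}" F] by (simp add: corner_kernel_def)
  also have "\<dots> \<le> R * level_form 0 f"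
    unfolding F_def by (rule base_displacement_le)
  finally show ?thesis by simp
qed

text \<open>The swap of signs is lifted in three pieces: both coordinates go to their corners, the
  corners are swapped, and the coordinates are released on the other side. The outer pieces are
  \<open>u\<close> at the two ends and give \<open>12 = 6 * 2\<close>; the middle piece costs
  \<open>n\<close> for each of the two corners.\<close>

lemma sign_swap_form_le:
  assumes j: "j < M"
  shows "sign_swap_form j (avg M S \<nu> f)
    \<le> 12 * n * R * (level_form j f + level_form (Suc j) f) + 3 * n\<^sup>2 * swap_form j f"
proof -
  let ?A = "\<lambda>J. avg M S (corner_kernel J)"
  let ?J = "{j, Suc j}"
  define g where "g = ?A {} f"
  define g2 where "g2 = ?A ?J f"
  define u where "u z = g z - g2 z" for z
  define F where "F i x = f x - f (x(i := e (d (x i))))" for i x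
  define H where "H x = f x - f (swap_at j x)" for x
  define c where "c z = min (pz z) (pz (swap_at j z))" for z
  have c_nonneg: "0 \<le> c z" for z using pz_pos by (auto simp: c_def intro: less_imp_le)
  have g: "avg M S \<nu> f = g" by (simp add: g_def corner_kernel_def)
  have F_le: "(\<Sum>x\<in>\<Omega>. \<pi> x * (F i x)\<^sup>2) \<le> R * level_form i f" if "i \<le> M" for i
    unfolding F_def using that by (rule corner_displacement_le)
  have u: "u z = ?A {} (F (Suc j)) z + ?A {Suc j} (F j) z" for z
    using avg_corner_kernel_insert [of "Suc j" "{}" f z] avg_corner_kernel_insert [of j "{Suc j}" f z] j
    by (simp add: u_def g_def g2_def F_def [abs_def])
  have u_le: "(\<Sum>z\<in>Z. pz z * (u z)\<^sup>2) \<le> 2 * n * R * (level_form j f + level_form (Suc j) f)"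
  proof -
    have "(\<Sum>z\<in>Z. pz z * (u z)\<^sup>2)
        \<le> (\<Sum>z\<in>Z. 2 * (pz z * (?A {} (F (Suc j)) z)\<^sup>2) + 2 * (pz z * (?A {Suc j} (F j) z)\<^sup>2))"
    proof (intro sum_mono)
      fix z
      let ?a = "?A {} (F (Suc j)) z" and ?b = "?A {Suc j} (F j) z"
      have "(u z)\<^sup>2 \<le> 2 * ?a\<^sup>2 + 2 * ?b\<^sup>2"
        unfolding u using zero_le_power2 [of "?a - ?b"] by (simp add: power2_eq_square algebra_simps)
      then have "pz z * (u z)\<^sup>2 \<le> pz z * (2 * ?a\<^sup>2 + 2 * ?b\<^sup>2)"
        using pz_pos by (intro mult_left_mono) (auto intro: less_imp_le)
      then show "pz z * (u z)\<^sup>2 \<le> 2 * (pz z * ?a\<^sup>2) + 2 * (pz z * ?b\<^sup>2)"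
        by (simp add: algebra_simps)
    qed
    also have "\<dots> = 2 * (\<Sum>z\<in>Z. pz z * (?A {} (F (Suc j)) z)\<^sup>2) + 2 * (\<Sum>z\<in>Z. pz z * (?A {Suc j} (F j) z)\<^sup>2)"
      by (simp add: sum.distrib sum_distrib_left)
    also have "\<dots> \<le> 2 * (n ^ card ({} :: nat set) * (\<Sum>x\<in>\<Omega>. \<pi> x * (F (Suc j) x)\<^sup>2))
        + 2 * (n ^ card {Suc j} * (\<Sum>x\<in>\<Omega>. \<pi> x * (F j x)\<^sup>2))"
      using j by (intro add_mono mult_left_mono sum_square_avg_le) auto
    also have "\<dots> \<le> 2 * (R * level_form (Suc j) f) + 2 * (n * (R * level_form j f))"
      using j n_ge_1 F_le [of j] F_le [of "Suc j"] by (intro add_mono mult_left_mono) auto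
    also have "R * level_form (Suc j) f \<le> n * (R * level_form (Suc j) f)"
      using n_ge_1 R level_form_nonneg [of "Suc j" f] j mult_right_mono [of 1 n "R * level_form (Suc j) f"]
      by simp
    finally show ?thesis by (simp add: algebra_simps)
  qed
  have swap_z: "(\<Sum>z\<in>Z. F (swap_at j z)) = (\<Sum>z\<in>Z. F z)" for F :: "(nat \<Rightarrow> bool) \<Rightarrow> real"
    using j by (rule sum_PiE_swap_at)
  have ck: "corner_kernel ?J j = corner_kernel ?J (Suc j)" by (simp add: corner_kernel_def)
  have g2: "g2 z - g2 (swap_at j z) = ?A ?J H z" for z
    unfolding g2_def H_def [abs_def] using avg_swap_at [of j M "corner_kernel ?J" S f z] j ck by (simp add: avg_diff)
  have mid: "(\<Sum>z\<in>Z. c z * (g2 z - g2 (swap_at j z))\<^sup>2) \<le> n\<^sup>2 * swap_form j f"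
  proof -
    let ?W = "\<lambda>z x. \<Prod>k\<le>M. corner_kernel ?J k (z k) (x k)"
    define Q where "Q x = (\<Sum>z\<in>Z. pz z * ?W z x)" for x
    have W: "0 \<le> ?W z x" if "x \<in> \<Omega>" for z x
      using that by (intro prod_nonneg corner_kernel_nonneg) auto
    have Q: "Q x \<le> n\<^sup>2 * \<pi> x" if "x \<in> \<Omega>" for x
    proof -
      have "Q x = (\<Prod>k\<le>M. \<Sum>s\<in>UNIV. p k s * corner_kernel ?J k s (x k))"
        by (simp add: Q_def pz_def prod_sum_PiE prod.distrib)
      also have "\<dots> \<le> n ^ card ?J * \<pi> x"
        using that j by (intro prod_corner_kernel_le) auto
      finally show ?thesis by (simp add: power2_eq_square)
    qed
    \<comment> \<open>The edge weight \<open>c\<close> is lifted from signs to states: bounding the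
      minimum by either of its arguments gives \<open>Q\<close> at \<open>x\<close> and at
      \<open>swap_at j x\<close>, hence by the density bound \<open>Q\<close> the minimum of the two
      weights of the states.\<close>
    have cW: "(\<Sum>z\<in>Z. c z * ?W z x) \<le> n\<^sup>2 * min (\<pi> x) (\<pi> (swap_at j x))" if x: "x \<in> \<Omega>" for x
    proof -
      have "(\<Sum>z\<in>Z. c z * ?W z x) \<le> Q x"
        unfolding Q_def using W [OF x] by (intro sum_mono mult_right_mono) (auto simp: c_def)
      moreover have "(\<Sum>z\<in>Z. c z * ?W z x) \<le> (\<Sum>z\<in>Z. pz (swap_at j z) * ?W z x)"
        using W [OF x] by (intro sum_mono mult_right_mono) (auto simp: c_def)
      moreover have "\<dots> = Q (swap_at j x)"
      proof -
        have "Q (swap_at j x) = (\<Sum>z\<in>Z. pz (swap_at j z) * ?W (swap_at j z) (swap_at j x))"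
          unfolding Q_def by (rule swap_z [symmetric])
        then show ?thesis using j ck by (simp only: prod_swap_at_both)
      qed
      ultimately show ?thesis
        using Q [OF x] Q [OF swap_at_in_PiE [OF j x]] by (auto simp: min_def)
    qed
    have "(\<Sum>z\<in>Z. c z * (g2 z - g2 (swap_at j z))\<^sup>2) \<le> (\<Sum>z\<in>Z. c z * ?A ?J (\<lambda>x. (H x)\<^sup>2) z)"
      unfolding g2 using fin c_nonneg
      by (intro sum_mono mult_left_mono avg_square_le corner_kernel_nonneg corner_kernel_total) auto
    also have "\<dots> = (\<Sum>x\<in>\<Omega>. (\<Sum>z\<in>Z. c z * ?W z x) * (H x)\<^sup>2)"
      unfolding avg_def sum_distrib_left sum_distrib_right by (subst sum.swap) (simp add: mult.assoc)
    also have "\<dots> \<le> (\<Sum>x\<in>\<Omega>. n\<^sup>2 * min (\<pi> x) (\<pi> (swap_at j x)) * (H x)\<^sup>2)"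
      by (intro sum_mono mult_right_mono cW) auto
    also have "\<dots> = n\<^sup>2 * swap_form j f"
      by (simp add: swap_form_def H_def sum_distrib_left mult.assoc)
    finally show ?thesis .
  qed
  have "sign_swap_form j g \<le> (\<Sum>z\<in>Z. 3 * (pz z * (u z)\<^sup>2)
      + 3 * (pz (swap_at j z) * (u (swap_at j z))\<^sup>2) + 3 * (c z * (g2 z - g2 (swap_at j z))\<^sup>2))"
    unfolding sign_swap_form_def c_def [symmetric]
  proof (intro sum_mono)
    fix z
    let ?a = "u z" and ?b = "u (swap_at j z)" and ?m = "g2 z - g2 (swap_at j z)"
    have "(a - b + m)\<^sup>2 \<le> 3 * a\<^sup>2 + 3 * b\<^sup>2 + 3 * m\<^sup>2" for a b m :: real
      using zero_le_power2 [of "a + b"] zero_le_power2 [of "a - m"] zero_le_power2 [of "b + m"]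
      by (simp add: power2_eq_square algebra_simps)
    from this [of ?a ?b ?m] have "(g z - g (swap_at j z))\<^sup>2 \<le> 3 * ?a\<^sup>2 + 3 * ?b\<^sup>2 + 3 * ?m\<^sup>2"
      by (simp add: u_def)
    then have "c z * (g z - g (swap_at j z))\<^sup>2 \<le> c z * (3 * ?a\<^sup>2 + 3 * ?b\<^sup>2 + 3 * ?m\<^sup>2)"
      by (intro mult_left_mono c_nonneg)
    also have "\<dots> = 3 * (c z * ?a\<^sup>2) + 3 * (c z * ?b\<^sup>2) + 3 * (c z * ?m\<^sup>2)"
      by (simp add: algebra_simps)
    also have "c z * ?a\<^sup>2 \<le> pz z * ?a\<^sup>2" by (intro mult_right_mono) (auto simp: c_def)
    also have "c z * ?b\<^sup>2 \<le> pz (swap_at j z) * ?b\<^sup>2" by (intro mult_right_mono) (auto simp: c_def)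
    finally show "c z * (g z - g (swap_at j z))\<^sup>2 \<le> 3 * (pz z * ?a\<^sup>2)
      + 3 * (pz (swap_at j z) * ?b\<^sup>2) + 3 * (c z * ?m\<^sup>2)" by simp
  qed
  also have "\<dots> = 3 * (\<Sum>z\<in>Z. pz z * (u z)\<^sup>2) + 3 * (\<Sum>z\<in>Z. pz (swap_at j z) * (u (swap_at j z))\<^sup>2)
      + 3 * (\<Sum>z\<in>Z. c z * (g2 z - g2 (swap_at j z))\<^sup>2)"
    by (simp add: sum.distrib sum_distrib_left)
  also have "(\<Sum>z\<in>Z. pz (swap_at j z) * (u (swap_at j z))\<^sup>2) = (\<Sum>z\<in>Z. pz z * (u z)\<^sup>2)"
    by (rule swap_z)
  finally show ?thesis using u_le mid unfolding g by simp
qed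

text \<open>If \<open>z i\<close> holds too, the two weights agree; otherwise \<open>ratio\<close>
  says exactly that \<open>True\<close> costs less at the lower level.\<close>

lemma pz_le_swap:
  assumes i: "i < M" and "z (Suc i)"
  shows "pz z \<le> pz (swap_at i z)"
proof -
  let ?r = "\<Prod>k\<in>{..M} - {i, Suc i}. p k (z k)"
  have "pz z = p i (z i) * p (Suc i) True * ?r"
    unfolding pz_def prod_split_adjacent [OF i] using assms(2) by simp
  moreover have "pz (swap_at i z) = p i True * p (Suc i) (z i) * ?r"
    unfolding pz_def prod_swap_at [OF i] using assms(2) by simp
  moreover have "0 \<le> ?r"
    by (intro prod_nonneg) (auto intro: less_imp_le p_pos)
  moreover have "p i (z i) * p (Suc i) True \<le> p i True * p (Suc i) (z i)"
    using ratio [OF i] by (cases "z i") (auto simp: mult.commute)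
  ultimately show ?thesis by (simp add: mult_right_mono)
qed

text \<open>A flip at level \<open>i + 1\<close> is a swap, a flip at level \<open>i\<close> and a swap. Weighting the flip by
  \<open>1 + 1 / M\<close> and the swaps by \<open>1 + M\<close> keeps the loss over all \<open>M\<close> levels bounded.\<close>

lemma flip_form_Suc_le:
  assumes i: "i < M"
  shows "flip_form (Suc i) g \<le> (1 + 1 / real M) * flip_form i g + 6 * (1 + real M) * sign_swap_form i g"
proof -
  let ?Z = "{z \<in> Z. z (Suc i)}"
  let ?y = "\<lambda>z :: nat \<Rightarrow> bool. z(Suc i := False)"
  define A where "A z = pz z * (g z - g (z(i := False)))\<^sup>2" for z
  define B where "B z = min (pz z) (pz (swap_at i z)) * (g z - g (swap_at i z))\<^sup>2" for z
  have B_nonneg: "0 \<le> B z" for z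
    using pz_pos [of z] pz_pos [of "swap_at i z"] by (simp add: B_def)
  have "flip_form (Suc i) g \<le> (\<Sum>z\<in>?Z. (1 + 1 / real M) * A (swap_at i z)
      + 2 * (1 + real M) * B z + 4 * (1 + real M) * B (?y z))"
    unfolding flip_form_def
  proof (intro sum_mono)
    fix z assume "z \<in> ?Z"
    then have z: "z (Suc i)" by simp
    let ?s = "swap_at i z"
    have sy: "swap_at i (?y z) = ?s(i := False)"
      by (auto simp: swap_at_def fun_eq_iff)
    \<comment> \<open>\<open>b\<close> is the swap at the start, \<open>a\<close> the flip at level
      \<open>i\<close> between the swapped states, and \<open>c\<close> the swap back after the
      flip.\<close>
    define a b c where "a = g ?s - g (?s(i := False))" and "b = g z - g ?s"
      and "c = g (?s(i := False)) - g (?y z)"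
    have le: "pz z \<le> pz ?s" using i z by (rule pz_le_swap)
    have "pz z * (g z - g (?y z))\<^sup>2 = pz z * (a + b + c)\<^sup>2" by (simp add: a_def b_def c_def)
    also have "\<dots> \<le> pz z * ((1 + 1 / real M) * a\<^sup>2 + 2 * (1 + real M) * (b\<^sup>2 + c\<^sup>2))"
      using pz_pos M_pos by (intro mult_left_mono square_add_le) (auto intro: less_imp_le)
    also have "\<dots> = (1 + 1 / real M) * (pz z * a\<^sup>2) + 2 * (1 + real M) * (pz z * b\<^sup>2)
        + 2 * (1 + real M) * (pz z * c\<^sup>2)"
      by (simp add: algebra_simps)
    also have "\<dots> \<le> (1 + 1 / real M) * A ?s + 2 * (1 + real M) * B z + 2 * (1 + real M) * (2 * B (?y z))"
    proof (intro add_mono mult_left_mono)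
      show "pz z * a\<^sup>2 \<le> A ?s"
        unfolding A_def a_def using le by (intro mult_right_mono) auto
      show "pz z * b\<^sup>2 \<le> B z"
        unfolding B_def b_def using le by (intro mult_right_mono) auto
      \<comment> \<open>Both ends of the swap back arise from \<open>z\<close> and \<open>?s\<close>
        by a flip to \<open>False\<close>, which keeps at least half of the weight. This factor
        makes the second swap cost \<open>4 (1 + M)\<close> against \<open>2 (1 + M)\<close> for the
        first one.\<close>
      have "pz z \<le> 2 * pz (?y z)"
        using i z by (intro pz_le_flip) auto
      moreover have "pz ?s \<le> 2 * pz (?s(i := False))"
        using i z by (intro pz_le_flip) auto
      ultimately have "pz z \<le> 2 * min (pz (?y z)) (pz (swap_at i (?y z)))"
        using le sy by (auto simp: min_def)
      then have "pz z * c\<^sup>2 \<le> 2 * min (pz (?y z)) (pz (swap_at i (?y z))) * c\<^sup>2"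
        by (intro mult_right_mono) auto
      then show "pz z * c\<^sup>2 \<le> 2 * B (?y z)"
        by (simp add: B_def c_def sy power2_commute)
    qed auto
    finally show "pz z * (g z - g (?y z))\<^sup>2
        \<le> (1 + 1 / real M) * A ?s + 2 * (1 + real M) * B z + 4 * (1 + real M) * B (?y z)"
      by (simp add: algebra_simps)
  qed
  also have "\<dots> = (1 + 1 / real M) * (\<Sum>z\<in>?Z. A (swap_at i z))
      + 2 * (1 + real M) * (\<Sum>z\<in>?Z. B z) + 4 * (1 + real M) * (\<Sum>z\<in>?Z. B (?y z))"
    by (simp add: sum.distrib sum_distrib_left)
  also have "(\<Sum>z\<in>?Z. A (swap_at i z)) = flip_form i g"
    unfolding flip_form_def A_def [symmetric]
    by (rule sum.reindex_bij_witness [where i = "swap_at i" and j = "swap_at i"])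
      (use swap_at_in_PiE [OF i, where S = "UNIV :: bool set"] in auto)
  also have "(1 + 1 / real M) * flip_form i g + 2 * (1 + real M) * (\<Sum>z\<in>?Z. B z)
        + 4 * (1 + real M) * (\<Sum>z\<in>?Z. B (?y z))
      \<le> (1 + 1 / real M) * flip_form i g + 2 * (1 + real M) * sign_swap_form i g
        + 4 * (1 + real M) * sign_swap_form i g"
  proof (intro add_mono mult_left_mono order_refl)
    show "(\<Sum>z\<in>?Z. B z) \<le> sign_swap_form i g"
      unfolding sign_swap_form_def B_def [symmetric]
      using B_nonneg by (intro sum_mono2) auto
    have "(\<Sum>z\<in>?Z. B (?y z)) = (\<Sum>z\<in>?y ` ?Z. B z)"
      by (simp add: sum.reindex [OF inj_on_reset])
    also have "\<dots> \<le> sign_swap_form i g"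
      unfolding sign_swap_form_def B_def [symmetric]
      using B_nonneg i by (intro sum_mono2) (auto simp: PiE_iff extensional_def)
    finally show "(\<Sum>z\<in>?Z. B (?y z)) \<le> sign_swap_form i g" .
  qed auto
  finally show ?thesis by (simp add: algebra_simps)
qed

text \<open>Iterating the one-level bound multiplies by \<open>(1 + 1 / M) ^ i\<close>, which is at
  most \<open>exp 1\<close> for \<open>i\<close> up to \<open>M\<close>; this is the
  \<open>3\<close>.\<close>

lemma flip_form_le:
  assumes "i \<le> M"
  shows "flip_form i g \<le> 3 * (flip_form 0 g + 6 * (1 + real M) * (\<Sum>j<M. sign_swap_form j g))"
proof -
  have nn: "0 \<le> flip_form 0 g"
    unfolding flip_form_def by (intro sum_nonneg mult_nonneg_nonneg) (auto intro: less_imp_le pz_pos)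
  have "flip_form i g \<le> (1 + 1 / real M) ^ i * (flip_form 0 g + 6 * (1 + real M) * (\<Sum>j<i. sign_swap_form j g))"
    using assms
  proof (induction i)
    case 0
    then show ?case by simp
  next
    case (Suc i)
    let ?a = "1 + 1 / real M" and ?B = "6 * (1 + real M) * sign_swap_form i g"
    have "flip_form (Suc i) g \<le> ?a * flip_form i g + ?B"
      using Suc.prems by (intro flip_form_Suc_le) auto
    also have "\<dots> \<le> ?a * (?a ^ i * (flip_form 0 g + 6 * (1 + real M) * (\<Sum>j<i. sign_swap_form j g))) + ?a ^ Suc i * ?B"
    proof (intro add_mono mult_left_mono)
      show "flip_form i g \<le> ?a ^ i * (flip_form 0 g + 6 * (1 + real M) * (\<Sum>j<i. sign_swap_form j g))"
        using Suc by simp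
      have "1 \<le> ?a ^ Suc i" by (rule one_le_power) simp
      moreover have "0 \<le> ?B" using sign_swap_form_nonneg by simp
      ultimately show "?B \<le> ?a ^ Suc i * ?B" using mult_right_mono [of 1 "?a ^ Suc i" ?B] by simp
    qed auto
    also have "\<dots> = ?a ^ Suc i * (flip_form 0 g + 6 * (1 + real M) * (\<Sum>j<Suc i. sign_swap_form j g))"
      by (simp add: algebra_simps)
    finally show ?case .
  qed
  also have "\<dots> \<le> 3 * (flip_form 0 g + 6 * (1 + real M) * (\<Sum>j<M. sign_swap_form j g))"
  proof (intro mult_mono add_mono order_refl sum_mono2)
    have "(1 + 1 / real M) ^ i \<le> (1 + 1 / real M) ^ M"
      using assms by (intro power_increasing) auto
    also have "\<dots> \<le> exp (1 / real M) ^ M"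
      by (intro power_mono exp_ge_add_one_self) auto
    also have "\<dots> = exp 1" using M_pos by (simp flip: exp_of_nat_mult)
    finally show "(1 + 1 / real M) ^ i \<le> 3" using exp_le by linarith
  qed (use assms nn sign_swap_form_nonneg in \<open>auto intro!: add_nonneg_nonneg mult_nonneg_nonneg sum_nonneg\<close>)
  finally show ?thesis .
qed

text \<open>Efron-Stein with kernels that forget their starting sign: the full average is a constant
  and serves as \<open>c\<close>. The variance of a single sign is compared with its flip, both ends
  being charged to the \<open>True\<close> end; hence the factor \<open>2\<close>.\<close>

lemma sign_poincare:
  obtains c where "(\<Sum>z\<in>Z. pz z * (g z - c)\<^sup>2) \<le> real (M + 1) * (\<Sum>i\<le>M. 2 * flip_form i g)"
proof
  define c where "c = avg M UNIV (\<lambda>k (_ :: bool). p k) g (\<lambda>_. True)"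
  have c: "avg M UNIV (\<lambda>k _. p k) g z = c" for z :: "nat \<Rightarrow> bool"
    unfolding c_def by (rule avg_kernel_cong) simp
  have tot: "(\<Sum>b\<in>UNIV. p k b) = 1" if "k \<le> M" for k
    using p_total [OF that] by (simp add: UNIV_bool add.commute)
  have "(\<Sum>z\<in>Z. pz z * (g z - avg M UNIV (\<lambda>k _. p k) g z)\<^sup>2)
      \<le> real (M + 1) * (\<Sum>i\<le>M. \<Sum>z\<in>Z. pz z * (g z - (\<Sum>b\<in>UNIV. p i b * g (z(i := b))))\<^sup>2)"
    unfolding pz_def
    by (rule efron_stein) (auto simp: tot intro: less_imp_le p_pos simp flip: sum_distrib_right)
  also have "\<dots> \<le> real (M + 1) * (\<Sum>i\<le>M. 2 * flip_form i g)"
  proof (intro mult_left_mono sum_mono)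
    fix i assume "i \<in> {..M}"
    then have i: "i \<le> M" by simp
    let ?T = "\<lambda>z. pz z * (g z - (\<Sum>b\<in>UNIV. p i b * g (z(i := b))))\<^sup>2"
    have p2: "(p i s)\<^sup>2 \<le> 1" and p2': "(p i s)\<^sup>2 \<le> p i s" for s
      using p_le_1 [OF i, of s] p_pos [OF i, of s] by (auto simp: power2_eq_square mult_le_one)
    have pT: "p i True = 1 - p i False" and pF: "p i False = 1 - p i True"
      using p_total [OF i] by simp_all
    have T: "?T z \<le> pz z * (g z - g (z(i := False)))\<^sup>2" if "z i" for z
    proof -
      have "z(i := True) = z" using that by (simp add: fun_upd_idem)
      then have "g z - (\<Sum>b\<in>UNIV. p i b * g (z(i := b))) = p i False * (g z - g (z(i := False)))"
        by (simp add: UNIV_bool pT algebra_simps)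
      then have "?T z = (p i False)\<^sup>2 * (pz z * (g z - g (z(i := False)))\<^sup>2)"
        by (simp add: power_mult_distrib)
      also have "\<dots> \<le> 1 * (pz z * (g z - g (z(i := False)))\<^sup>2)"
        using p2 pz_pos by (intro mult_right_mono) (auto intro: less_imp_le)
      finally show ?thesis by simp
    qed
    \<comment> \<open>At the \<open>False\<close> end one factor \<open>p i True\<close> is spent on
      detailed balance, which trades the weight of \<open>?y\<close> for that of
      \<open>z\<close>.\<close>
    have F: "?T (z(i := False)) \<le> pz z * (g z - g (z(i := False)))\<^sup>2" if "z i" for z
    proof -
      let ?y = "z(i := False)"
      have "z(i := True) = z" using that by (simp add: fun_upd_idem)
      then have "g ?y - (\<Sum>b\<in>UNIV. p i b * g (?y(i := b))) = - (p i True * (g z - g ?y))"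
        by (simp add: UNIV_bool pF algebra_simps)
      then have "?T ?y = (p i True)\<^sup>2 * pz ?y * (g z - g ?y)\<^sup>2"
        by (simp add: power_mult_distrib)
      also have "\<dots> \<le> (p i True * pz ?y) * (g z - g ?y)\<^sup>2"
        using p2' by (intro mult_right_mono) auto
      also have "\<dots> \<le> pz z * (g z - g ?y)\<^sup>2"
      proof (rule mult_right_mono)
        have "p i True * pz ?y = pz z * p i False"
          using pz_upd [OF i, of z False] that by (simp add: mult.commute)
        also have "\<dots> \<le> pz z" using p_le_1 [OF i, of False] pz_pos [of z] by simp
        finally show "p i True * pz ?y \<le> pz z" .
      qed simp
      finally show ?thesis .
    qed
    have "(\<Sum>z\<in>Z. ?T z) = (\<Sum>z\<in>{z \<in> Z. z i}. ?T z) + (\<Sum>z\<in>{z \<in> Z. \<not> z i}. ?T z)"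
      by (subst sum.union_disjoint [symmetric]) (auto intro: arg_cong2 [where f = sum] simp: Collect_disj_eq)
    also have "(\<Sum>z\<in>{z \<in> Z. \<not> z i}. ?T z) = (\<Sum>z\<in>{z \<in> Z. z i}. ?T (z(i := False)))"
      by (rule sum.reindex_bij_witness [where i = "\<lambda>z. z(i := False)" and j = "\<lambda>z. z(i := True)"])
        (use i in \<open>auto simp: PiE_iff extensional_def fun_upd_idem\<close>)
    also have "(\<Sum>z\<in>{z \<in> Z. z i}. ?T z) + \<dots> \<le> flip_form i g + flip_form i g"
      unfolding flip_form_def using T F by (intro add_mono sum_mono) auto
    also have "\<dots> = 2 * flip_form i g" by simp
    finally show "(\<Sum>z\<in>Z. ?T z) \<le> 2 * flip_form i g" .
  qed auto
  finally show "(\<Sum>z\<in>Z. pz z * (g z - c)\<^sup>2) \<le> real (M + 1) * (\<Sum>i\<le>M. 2 * flip_form i g)"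
    by (simp add: c)
qed

section \<open>From sign vectors back to states\<close>

lemma sum_class_image: "(\<Sum>x\<in>\<Omega>. \<pi> x * H (restrict (d \<circ> x) {..M})) = (\<Sum>z\<in>Z. pz z * H z)"
proof -
  \<comment> \<open>The sign map is read as a deterministic kernel from states to sign vectors, so
    \<open>sum_avg\<close> computes its image measure.\<close>
  have "(\<Sum>x\<in>\<Omega>. \<pi> x * H (restrict (d \<circ> x) {..M}))
      = (\<Sum>x\<in>\<Omega>. \<pi> x * avg M UNIV (\<lambda>k a b. of_bool (b = d a)) H x)"
    by (simp add: avg_deterministic)
  also have "\<dots> = (\<Sum>z\<in>Z. (\<Prod>k\<le>M. \<Sum>a\<in>S. w k a * of_bool (z k = d a)) * H z)"
    unfolding \<pi>_def by (rule sum_avg [OF fin])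
  also have "\<dots> = (\<Sum>z\<in>Z. pz z * H z)"
  proof -
    have "(\<Sum>a\<in>S. w k a * of_bool (s = d a)) = p k s" for k s
      unfolding p_def class_mass_def
      using fin by (intro sum.mono_neutral_cong_right) auto
    then show ?thesis by (simp add: pz_def)
  qed
  finally show ?thesis .
qed

text \<open>\<open>f - c\<close> splits into the part within the classes, \<open>f - G\<close>, and
  the part \<open>G - c\<close> that depends on the signs. Of the three factors
  \<open>M + 1\<close>, one is the price of the swaps in \<open>flip_form_le\<close>; the other two
  come from Efron-Stein on the signs and from the number of flip forms.\<close>

theorem poincare:
  obtains c where "(\<Sum>x\<in>\<Omega>. \<pi> x * (f x - c)\<^sup>2)
    \<le> 2000 * real (M + 1) ^ 3 * n\<^sup>2 * R * ((\<Sum>i\<le>M. level_form i f) + (\<Sum>j<M. swap_form j f))"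
proof -
  define g where "g = avg M S \<nu> f"
  define G where "G x = g (restrict (d \<circ> x) {..M})" for x
  define m where "m = real (M + 1)"
  define SL where "SL = (\<Sum>i\<le>M. level_form i f)"
  define SW where "SW = (\<Sum>j<M. swap_form j f)"
  have m: "m \<ge> 1" and n: "n \<ge> 1" by (simp_all add: m_def n_ge_1)
  have SL: "0 \<le> SL" and SW: "0 \<le> SW"
    by (auto simp: SL_def SW_def intro!: sum_nonneg level_form_nonneg swap_form_nonneg)
  obtain c where c: "(\<Sum>z\<in>Z. pz z * (g z - c)\<^sup>2) \<le> real (M + 1) * (\<Sum>i\<le>M. 2 * flip_form i g)"
    by (rule sign_poincare)
  have B: "(\<Sum>j<M. sign_swap_form j g) \<le> 24 * n * R * SL + 3 * n\<^sup>2 * SW"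
  proof -
    have "(\<Sum>j<M. sign_swap_form j g)
        \<le> (\<Sum>j<M. 12 * n * R * (level_form j f + level_form (Suc j) f) + 3 * n\<^sup>2 * swap_form j f)"
      unfolding g_def by (intro sum_mono sign_swap_form_le) auto
    also have "\<dots> = 12 * n * R * ((\<Sum>j<M. level_form j f) + (\<Sum>j<M. level_form (Suc j) f)) + 3 * n\<^sup>2 * SW"
      by (simp add: SW_def sum.distrib flip: sum_distrib_left)
    also have "\<dots> \<le> 12 * n * R * (SL + SL) + 3 * n\<^sup>2 * SW"
    proof (intro add_mono mult_left_mono order_refl)
      show "(\<Sum>j<M. level_form j f) \<le> SL"
        unfolding SL_def by (intro sum_mono2) (auto intro: level_form_nonneg)
      have "SL = level_form 0 f + (\<Sum>j<M. level_form (Suc j) f)"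
        unfolding SL_def by (simp add: sum.atMost_shift)
      then show "(\<Sum>j<M. level_form (Suc j) f) \<le> SL"
        using level_form_nonneg [of 0 f] by simp
    qed (use n R in auto)
    finally show ?thesis by simp
  qed
  have F0: "flip_form 0 g \<le> 6 * R * SL"
  proof -
    have "level_form 0 f \<le> SL"
      unfolding SL_def by (intro member_le_sum) (auto intro: level_form_nonneg)
    then have "6 * R * level_form 0 f \<le> 6 * R * SL" using R by (intro mult_left_mono) auto
    then show ?thesis using flip_form_0_le [of f] by (simp add: g_def)
  qed
  \<comment> \<open>A common unit for all bounds: the initial flip contributes \<open>6 T\<close>,
    the swaps \<open>6 * 24 T = 144 T\<close>, and the factor \<open>3\<close> of
    \<open>flip_form_le\<close> yields \<open>450 T\<close>.\<close>
  define T where "T = m * (n\<^sup>2 * (R * (SL + SW)))"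
  have nR: "n * (R * SL) \<le> n\<^sup>2 * (R * SL)"
    using n R SL by (intro mult_right_mono) (auto simp: power2_eq_square)
  have RSW: "n\<^sup>2 * SW \<le> n\<^sup>2 * (R * SW)"
    using R SW mult_right_mono [of 1 R SW] by (intro mult_left_mono) auto
  have RSL: "R * SL \<le> n\<^sup>2 * (R * (SL + SW))"
  proof -
    have "R * SL \<le> n\<^sup>2 * (R * SL)"
      using n R SL mult_right_mono [of 1 "n\<^sup>2" "R * SL"] by simp
    also have "\<dots> \<le> n\<^sup>2 * (R * (SL + SW))"
      using R SW by (intro mult_left_mono) auto
    finally show ?thesis .
  qed
  have base_T: "n\<^sup>2 * (R * (SL + SW)) \<le> T"
    unfolding T_def using m R SL SW mult_right_mono [of 1 m "n\<^sup>2 * (R * (SL + SW))"] by simp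
  have F: "flip_form i g \<le> 450 * T" if "i \<le> M" for i
  proof -
    have "6 * m * (\<Sum>j<M. sign_swap_form j g) \<le> 6 * m * (24 * n * R * SL + 3 * n\<^sup>2 * SW)"
      using B m by (intro mult_left_mono) auto
    also have "\<dots> \<le> 6 * m * (24 * (n\<^sup>2 * (R * (SL + SW))))"
    proof (intro mult_left_mono)
      have "0 \<le> n\<^sup>2 * SW" using SW by (intro mult_nonneg_nonneg) auto
      then have "24 * n * R * SL + 3 * n\<^sup>2 * SW \<le> 24 * (n\<^sup>2 * (R * SL)) + 24 * (n\<^sup>2 * (R * SW))"
        using nR RSW \<open>0 \<le> n\<^sup>2 * SW\<close> unfolding mult.assoc by linarith
      then show "24 * n * R * SL + 3 * n\<^sup>2 * SW \<le> 24 * (n\<^sup>2 * (R * (SL + SW)))"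
        by (simp add: algebra_simps)
    qed (use m in auto)
    also have "\<dots> = 144 * T" by (simp add: T_def)
    finally have "6 * (1 + real M) * (\<Sum>j<M. sign_swap_form j g) \<le> 144 * T"
      by (simp add: m_def add.commute)
    moreover have "6 * R * SL \<le> 6 * T"
    proof -
      show ?thesis using RSL base_T by simp
    qed
    ultimately show ?thesis using flip_form_le [OF that, of g] F0 by simp
  qed
  have Vg: "(\<Sum>z\<in>Z. pz z * (g z - c)\<^sup>2) \<le> 900 * m\<^sup>2 * T"
  proof -
    have "(\<Sum>i\<le>M. 2 * flip_form i g) \<le> (\<Sum>i\<le>M. 900 * T)"
      using F by (intro sum_mono) fastforce
    also have "\<dots> = m * (900 * T)" by (simp add: m_def)
    finally have "m * (\<Sum>i\<le>M. 2 * flip_form i g) \<le> m * (m * (900 * T))"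
      using m by (intro mult_left_mono) auto
    then have "m * (\<Sum>i\<le>M. 2 * flip_form i g) \<le> 900 * m\<^sup>2 * T"
      by (simp add: power2_eq_square mult_ac)
    then show ?thesis using c unfolding m_def by linarith
  qed
  have fG: "(\<Sum>x\<in>\<Omega>. \<pi> x * (f x - G x)\<^sup>2) \<le> T"
  proof -
    have "(\<Sum>x\<in>\<Omega>. \<pi> x * (f x - G x)\<^sup>2) \<le> m * (R * SL)"
      unfolding G_def g_def m_def SL_def by (rule sum_square_diff_conditional_le)
    also have "\<dots> \<le> m * (n\<^sup>2 * (R * (SL + SW)))"
      using m RSL by (intro mult_left_mono) auto
    finally show ?thesis by (simp add: T_def)
  qed
  have GG: "(\<Sum>x\<in>\<Omega>. \<pi> x * (G x - c)\<^sup>2) = (\<Sum>z\<in>Z. pz z * (g z - c)\<^sup>2)"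
    unfolding G_def by (rule sum_class_image [where H = "\<lambda>z. (g z - c)\<^sup>2"])
  have "(\<Sum>x\<in>\<Omega>. \<pi> x * (f x - c)\<^sup>2)
      \<le> (\<Sum>x\<in>\<Omega>. 2 * (\<pi> x * (f x - G x)\<^sup>2) + 2 * (\<pi> x * (G x - c)\<^sup>2))"
  proof (intro sum_mono)
    fix x assume x: "x \<in> \<Omega>"
    have "(f x - c)\<^sup>2 \<le> 2 * (f x - G x)\<^sup>2 + 2 * (G x - c)\<^sup>2"
      using zero_le_power2 [of "(f x - G x) - (G x - c)"] by (simp add: power2_eq_square algebra_simps)
    then have "\<pi> x * (f x - c)\<^sup>2 \<le> \<pi> x * (2 * (f x - G x)\<^sup>2 + 2 * (G x - c)\<^sup>2)"
      using \<pi>_pos [OF x] by (intro mult_left_mono) auto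
    then show "\<pi> x * (f x - c)\<^sup>2 \<le> 2 * (\<pi> x * (f x - G x)\<^sup>2) + 2 * (\<pi> x * (G x - c)\<^sup>2)"
      by (simp only: distrib_left mult.left_commute)
  qed
  also have "\<dots> = 2 * (\<Sum>x\<in>\<Omega>. \<pi> x * (f x - G x)\<^sup>2) + 2 * (\<Sum>x\<in>\<Omega>. \<pi> x * (G x - c)\<^sup>2)"
    by (simp add: sum.distrib sum_distrib_left)
  also have "\<dots> \<le> 2 * T + 1800 * m\<^sup>2 * T"
    using fG GG Vg by simp
  also have "\<dots> \<le> 2000 * m\<^sup>2 * T"
  proof -
    have "0 \<le> T" unfolding T_def using m R SL SW by simp
    moreover have "1 \<le> m\<^sup>2" using m by simp
    ultimately have "T \<le> m\<^sup>2 * T" using mult_right_mono [of 1 "m\<^sup>2" T] by simp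
    then show ?thesis using \<open>0 \<le> T\<close> by linarith
  qed
  also have "\<dots> = 2000 * real (M + 1) ^ 3 * n\<^sup>2 * R * (SL + SW)"
    by (simp add: T_def m_def power2_eq_square power3_eq_cube)
  finally show thesis using that by (simp add: SL_def SW_def)
qed

end

section \<open>The bimodal exponential distributions\<close>

text \<open>After the product of the two sums up to \<open>m\<close> cancels, two effects remain,
  and both have the right sign. The missing exponent \<open>0\<close> on the longer side counts with
  the sum up to \<open>m\<close>, which grows with the base; and for \<open>i \<le> m < j\<close>
  the larger base favours the larger exponent \<open>j\<close>.\<close>

lemma sum_power_ratio_le:
  fixes r s :: real
  assumes r: "1 \<le> r" "r \<le> s" and m: "m \<le> m'"
  shows "(\<Sum>i\<le>m. s ^ i) * (\<Sum>i\<in>{1..m'}. r ^ i) \<le> (\<Sum>i\<le>m. r ^ i) * (\<Sum>i\<in>{1..m'}. s ^ i)"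
proof -
  have split: "(\<Sum>i\<in>{1..m'}. u ^ i) = (\<Sum>i\<le>m. u ^ i) - 1 + (\<Sum>i\<in>{m<..m'}. u ^ i)" for u :: real
  proof -
    have a: "{..m'} = {..m} \<union> {m<..m'}" and b: "{..m'} = insert 0 {1..m'}" using m by auto
    have "(\<Sum>i\<le>m'. u ^ i) = (\<Sum>i\<le>m. u ^ i) + (\<Sum>i\<in>{m<..m'}. u ^ i)"
      unfolding a by (rule sum.union_disjoint) auto
    moreover have "(\<Sum>i\<le>m'. u ^ i) = 1 + (\<Sum>i\<in>{1..m'}. u ^ i)"
      unfolding b by simp
    ultimately show ?thesis by simp
  qed
  have "(\<Sum>i\<le>m. r ^ i) \<le> (\<Sum>i\<le>m. s ^ i)"
    using r by (intro sum_mono power_mono) auto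
  moreover have "(\<Sum>i\<le>m. s ^ i) * (\<Sum>j\<in>{m<..m'}. r ^ j) \<le> (\<Sum>i\<le>m. r ^ i) * (\<Sum>j\<in>{m<..m'}. s ^ j)"
    unfolding sum_product
  proof (intro sum_mono)
    fix i j assume "i \<in> {..m}" "j \<in> {m<..m'}"
    then obtain l where j: "j = i + l" by (metis atMost_iff greaterThanAtMost_iff le_add_diff_inverse less_imp_le order_trans)
    have "(s ^ i * r ^ i) * r ^ l \<le> (s ^ i * r ^ i) * s ^ l"
      using r by (intro mult_left_mono power_mono) auto
    then show "s ^ i * r ^ j \<le> r ^ i * s ^ j" by (simp add: j power_add mult_ac)
  qed
  ultimately show ?thesis unfolding split by (simp add: algebra_simps)
qed

lemma square_telescope_le:
  fixes F :: "int \<Rightarrow> real"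
  assumes "a \<le> b"
  shows "(F a - F b)\<^sup>2 \<le> real_of_int (b - a) * (\<Sum>i\<in>{a..<b}. (F i - F (i + 1))\<^sup>2)"
proof -
  have "F a - F b = (\<Sum>i\<in>{a..<b}. F i - F (i + 1))"
    using assms
  proof (induction b rule: int_ge_induct)
    case (step b)
    have "{a..<b + 1} = insert b {a..<b}" using step.hyps by auto
    then show ?case using step.IH by simp
  qed simp
  then show ?thesis
    using sum_squared_le_sum_of_squares [of "\<lambda>i. F i - F (i + 1)" "{a..<b}"] assms
    by (simp add: mult.commute)
qed

text \<open>Each edge counts once, without the proposal probability \<open>1/2\<close>, which is
  restored in \<open>edge_form_le\<close>.\<close>

definition edge_form :: "nat \<Rightarrow> nat \<Rightarrow> (int \<Rightarrow> real) \<Rightarrow> (int \<Rightarrow> real) \<Rightarrow> real"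
  where "edge_form N N' w F = (\<Sum>i\<in>{- int N..<int N'}. min (w i) (w (i + 1)) * (F i - F (i + 1))\<^sup>2)"

lemma edge_form_nonneg:
  assumes "\<And>a. a \<in> sites N N' \<Longrightarrow> 0 \<le> w a"
  shows "0 \<le> edge_form N N' w F"
  unfolding edge_form_def using assms
  by (intro sum_nonneg mult_nonneg_nonneg) (auto simp: sites_def)

text \<open>The path visits only sites of weight at least \<open>c\<close>, so each of its edges can
  be charged with \<open>c\<close>; Cauchy-Schwarz costs the length of the path.\<close>

lemma path_le_edge_form:
  assumes ab: "- int N \<le> a" "a \<le> b" "b \<le> int N'" and c: "0 \<le> c"
    and le: "\<And>i. a \<le> i \<Longrightarrow> i < b \<Longrightarrow> c \<le> w i \<and> c \<le> w (i + 1)"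
    and w: "\<And>a. a \<in> sites N N' \<Longrightarrow> 0 \<le> w a"
  shows "c * (F a - F b)\<^sup>2 \<le> real (N + N') * edge_form N N' w F"
proof -
  have "c * (F a - F b)\<^sup>2 \<le> c * (real_of_int (b - a) * (\<Sum>i\<in>{a..<b}. (F i - F (i + 1))\<^sup>2))"
    using c square_telescope_le [OF ab(2), of F] by (intro mult_left_mono) auto
  also have "\<dots> = real_of_int (b - a) * (\<Sum>i\<in>{a..<b}. c * (F i - F (i + 1))\<^sup>2)"
    by (simp add: sum_distrib_left mult_ac)
  also have "\<dots> \<le> real (N + N') * edge_form N N' w F"
  proof (rule mult_mono)
    have "(\<Sum>i\<in>{a..<b}. c * (F i - F (i + 1))\<^sup>2)
        \<le> (\<Sum>i\<in>{a..<b}. min (w i) (w (i + 1)) * (F i - F (i + 1))\<^sup>2)"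
      using le by (intro sum_mono mult_right_mono) auto
    also have "\<dots> \<le> edge_form N N' w F"
      unfolding edge_form_def using ab w
      by (intro sum_mono2) (auto simp: sites_def)
    finally show "(\<Sum>i\<in>{a..<b}. c * (F i - F (i + 1))\<^sup>2) \<le> edge_form N N' w F" .
  qed (use ab c in \<open>auto intro!: sum_nonneg\<close>)
  finally show ?thesis .
qed

text \<open>The class \<open>True\<close> is the shorter of the two half-lines, together with \<open>0\<close>. With this choice
  its mass relative to the other class decreases from each level to the next.\<close>

definition half :: "nat \<Rightarrow> nat \<Rightarrow> int \<Rightarrow> bool"
  where "half N N' x = (if N' \<le> N then 0 \<le> x else x \<le> 0)"

definition corner :: "nat \<Rightarrow> nat \<Rightarrow> bool \<Rightarrow> int"
  where "corner N N' b = (if (N' \<le> N) = b then int N' else - int N)"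

locale bimodal_swap =
  fixes C :: real and N N' M :: nat
  assumes C: "C > 1" and N_pos: "N > 0" and N'_pos: "N' > 0" and M_pos': "M > 0"
begin

abbreviation S where "S \<equiv> sites N N'"
abbreviation w where "w \<equiv> bimodal C N N' M"
abbreviation wt where "wt \<equiv> bimodal_weight C M"
abbreviation len where "len \<equiv> real (N + N')"

text \<open>With this base the weight of \<open>x\<close> is a power with exponent
  \<open>\<bar>x\<bar>\<close>, so the class masses become geometric sums.\<close>

definition base :: "nat \<Rightarrow> real" where "base k = C powr (real k / real M)"

lemma finite_S [simp]: "finite S" and card_S: "card S = N + N' + 1"
  by (auto simp: sites_def)

lemma wt_eq: "wt k x = base k ^ nat \<bar>x\<bar>"
  using C by (simp add: bimodal_weight_def base_def powr_powr flip: powr_realpow)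

lemma base_ge_1: "1 \<le> base k"
  using C by (simp add: base_def ge_one_powr_ge_zero)

lemma base_mono: "base k \<le> base (Suc k)"
  using C by (auto simp: base_def intro!: powr_mono divide_right_mono)

lemma wt_ge_1: "1 \<le> wt k x"
  unfolding wt_eq by (intro one_le_power base_ge_1)

lemma wt_mono: "\<bar>x\<bar> \<le> \<bar>y\<bar> \<Longrightarrow> wt k x \<le> wt k y"
  unfolding wt_eq by (intro power_increasing base_ge_1) auto

definition tot :: "nat \<Rightarrow> real" where "tot k = (\<Sum>z\<in>S. wt k z)"

lemma tot_pos: "0 < tot k"
  unfolding tot_def using wt_ge_1
  by (intro sum_pos) (auto simp: sites_def intro: less_le_trans [OF zero_less_one])

lemma w_eq: "w k x = wt k x / tot k"
  by (simp add: bimodal_def tot_def)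

lemma w_pos': "0 < w k x"
  using wt_ge_1 [of k x] tot_pos [of k] by (simp add: w_eq)

lemma w_nonneg: "0 \<le> w k x"
  using w_pos' [of k x] by simp

lemma w_mono: "\<bar>x\<bar> \<le> \<bar>y\<bar> \<Longrightarrow> w k x \<le> w k y"
  using wt_mono tot_pos [of k] by (simp add: w_eq divide_right_mono less_imp_le)

lemma w_total': "(\<Sum>a\<in>S. w k a) = 1"
  using tot_pos [of k] by (simp add: w_eq tot_def flip: sum_divide_distrib)

lemma w_0: "w 0 x = 1 / (len + 1)"
  using C by (simp add: w_eq tot_def wt_eq base_def card_S add.commute)

lemma class_mass_True: "class_mass S (half N N') w k True = (\<Sum>i\<le>min N N'. base k ^ i) / tot k"
proof -
  have "(\<Sum>a\<in>{a \<in> S. half N N' a = True}. wt k a) = (\<Sum>i\<le>min N N'. base k ^ i)"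
    by (rule sum.reindex_bij_witness
        [where i = "\<lambda>i. if N' \<le> N then int i else - int i" and j = "\<lambda>a. nat \<bar>a\<bar>"])
      (auto simp: half_def sites_def wt_eq split: if_splits)
  then show ?thesis by (simp add: class_mass_def w_eq flip: sum_divide_distrib)
qed

lemma class_mass_False: "class_mass S (half N N') w k False = (\<Sum>i\<in>{1..max N N'}. base k ^ i) / tot k"
proof -
  have "(\<Sum>a\<in>{a \<in> S. half N N' a = False}. wt k a) = (\<Sum>i\<in>{1..max N N'}. base k ^ i)"
  proof (cases "N' \<le> N")
    case True
    then show ?thesis
      by (intro sum.reindex_bij_witness [where i = "\<lambda>i. - int i" and j = "\<lambda>a. nat \<bar>a\<bar>"])
        (auto simp: half_def sites_def wt_eq max_absorb1)
  next
    case False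
    then show ?thesis
      by (intro sum.reindex_bij_witness [where i = int and j = "\<lambda>a. nat \<bar>a\<bar>"])
        (auto simp: half_def sites_def wt_eq max_absorb2)
  qed
  then show ?thesis by (simp add: class_mass_def w_eq flip: sum_divide_distrib)
qed

lemma half_corner: "half N N' (corner N N' b) = b"
  using N_pos N'_pos by (auto simp: half_def corner_def)

lemma corner_in: "corner N N' b \<in> S"
  by (auto simp: corner_def sites_def)

text \<open>A site and its corner lie on the same side of \<open>0\<close>, so the weights do not
  decrease along the path between them. At \<open>0\<close> either endpoint can be the corner, which
  is why the two cases overlap.\<close>

lemma corner_cases:
  obtains "corner N N' (half N N' a) = int N'" "0 \<le> a" | "corner N N' (half N N' a) = - int N" "a \<le> 0"
  by (cases "N' \<le> N"; cases "0 \<le> a"; cases "a \<le> 0") (auto simp: corner_def half_def)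

lemma w_le_corner:
  assumes "a \<in> S"
  shows "w k a \<le> w k (corner N N' (half N N' a))"
  by (cases rule: corner_cases [of a]) (use assms in \<open>auto simp: sites_def intro!: w_mono\<close>)

text \<open>The corner has the largest weight of its class, and a class misses the opposite corner,
  so it has at most \<open>N + N'\<close> of the \<open>N + N' + 1\<close> sites.\<close>

lemma class_mass_le:
  "class_mass S (half N N') w k b \<le> len * w k (corner N N' b)"
proof -
  have "class_mass S (half N N') w k b \<le> (\<Sum>a\<in>{a \<in> S. half N N' a = b}. w k (corner N N' b))"
    unfolding class_mass_def using w_le_corner [of _ k] by (intro sum_mono) auto
  also have "\<dots> = real (card {a \<in> S. half N N' a = b}) * w k (corner N N' b)" by simp
  also have "\<dots> \<le> len * w k (corner N N' b)"
  proof (intro mult_right_mono)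
    have "card {a \<in> S. half N N' a = b} \<le> card (S - {corner N N' (\<not> b)})"
      using half_corner [of "\<not> b"] by (intro card_mono) auto
    also have "\<dots> = N + N'" using corner_in by (simp add: card_S)
    finally show "real (card {a \<in> S. half N N' a = b}) \<le> len" by linarith
  qed (use w_pos' [of k "corner N N' b"] in simp)
  finally show ?thesis .
qed

text \<open>\<open>R\<close> is the bound \<open>len\<close> on the length of a path times the
  number \<open>len + 1\<close> of sites. The base point \<open>N'\<close> is chosen with a view to
  \<open>square_sum_le\<close>, where the walk holds at this end.\<close>

sublocale two_class_levels S "half N N'" "corner N N'" w M len "len * (len + 1)"
  "\<lambda>k. edge_form N N' (w k)" "int N'" "class_mass S (half N N') w"
proof unfold_locales
  fix k b
  show "class_mass S (half N N') w k b \<le> len * w k (corner N N' b)"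
    by (rule class_mass_le)
next
  fix k
  have "(\<Sum>i\<le>min N N'. base (Suc k) ^ i) * (\<Sum>i\<in>{1..max N N'}. base k ^ i)
      \<le> (\<Sum>i\<le>min N N'. base k ^ i) * (\<Sum>i\<in>{1..max N N'}. base (Suc k) ^ i)"
    by (intro sum_power_ratio_le base_ge_1 base_mono) auto
  then show "class_mass S (half N N') w (Suc k) True * class_mass S (half N N') w k False
      \<le> class_mass S (half N N') w k True * class_mass S (half N N') w (Suc k) False"
    unfolding class_mass_True class_mass_False
    using tot_pos [of k] tot_pos [of "Suc k"] by (simp add: field_simps)
next
  fix k
  let ?b = "base k"
  \<comment> \<open>The extra site \<open>0\<close> of the class \<open>True\<close> has weight one,
    which is at most the weight \<open>?b ^ 1\<close> of a site in the other class.\<close>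
  have "(\<Sum>i\<le>min N N'. ?b ^ i) = 1 + (\<Sum>i\<in>{1..min N N'}. ?b ^ i)"
  proof -
    have "{..min N N'} = insert 0 {1..min N N'}" by auto
    then show ?thesis by simp
  qed
  also have "\<dots> \<le> (\<Sum>i\<in>{1..max N N'}. ?b ^ i) + (\<Sum>i\<in>{1..max N N'}. ?b ^ i)"
  proof (rule add_mono)
    have "1 \<le> ?b ^ 1" using base_ge_1 by simp
    also have "\<dots> \<le> (\<Sum>i\<in>{1..max N N'}. ?b ^ i)"
      using N_pos base_ge_1 [of k] by (intro member_le_sum) auto
    finally show "1 \<le> (\<Sum>i\<in>{1..max N N'}. ?b ^ i)" .
    show "(\<Sum>i\<in>{1..min N N'}. ?b ^ i) \<le> (\<Sum>i\<in>{1..max N N'}. ?b ^ i)"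
      using base_ge_1 [of k] by (intro sum_mono2) auto
  qed
  finally show "class_mass S (half N N') w k True \<le> 2 * class_mass S (half N N') w k False"
    unfolding class_mass_True class_mass_False
    using tot_pos [of k] by (simp add: field_simps)
next
  fix k F
  show "0 \<le> edge_form N N' (w k) F"
    by (intro edge_form_nonneg w_nonneg)
  have "(\<Sum>a\<in>S. w k a * (F a - F (corner N N' (half N N' a)))\<^sup>2) \<le> (\<Sum>a\<in>S. len * edge_form N N' (w k) F)"
  proof (intro sum_mono)
    fix a assume a: "a \<in> S"
    show "w k a * (F a - F (corner N N' (half N N' a)))\<^sup>2 \<le> len * edge_form N N' (w k) F"
    proof (cases rule: corner_cases [of a])
      case 1
      have "w k a * (F a - F (int N'))\<^sup>2 \<le> len * edge_form N N' (w k) F"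
        using a 1 by (intro path_le_edge_form conjI w_mono w_nonneg) (auto simp: sites_def)
      then show ?thesis using 1 by simp
    next
      case 2
      have "w k a * (F (- int N) - F a)\<^sup>2 \<le> len * edge_form N N' (w k) F"
        using a 2 by (intro path_le_edge_form conjI w_mono w_nonneg) (auto simp: sites_def)
      then show ?thesis using 2 by (simp add: power2_commute)
    qed
  qed
  also have "\<dots> = len * (len + 1) * edge_form N N' (w k) F"
    by (simp add: card_S algebra_simps)
  finally show "(\<Sum>a\<in>S. w k a * (F a - F (corner N N' (half N N' a)))\<^sup>2)
    \<le> len * (len + 1) * edge_form N N' (w k) F" .
next
  fix F
  \<comment> \<open>Level \<open>0\<close> is uniform, so a path from any site to \<open>N'\<close>
    may cross \<open>0\<close> without meeting a smaller weight.\<close>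
  have "(\<Sum>a\<in>S. w 0 a * (F a - F (int N'))\<^sup>2) \<le> (\<Sum>a\<in>S. len * edge_form N N' (w 0) F)"
    by (intro sum_mono path_le_edge_form w_nonneg) (auto simp: sites_def w_0)
  also have "\<dots> = len * (len + 1) * edge_form N N' (w 0) F"
    by (simp add: card_S algebra_simps)
  finally show "(\<Sum>a\<in>S. w 0 a * (F a - F (int N'))\<^sup>2) \<le> len * (len + 1) * edge_form N N' (w 0) F" .
next
  have "1 * 1 \<le> len * (len + 1)" using N_pos by (intro mult_mono) auto
  then show "1 \<le> len * (len + 1)" by (simp only: mult_1)
next
  show "finite S" by (rule finite_S)
  show "0 < M" by (rule M_pos')
  show "int N' \<in> S" by (simp add: sites_def)
next
  fix k a
  show "0 < w k a" by (rule w_pos')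
  show "(\<Sum>a\<in>S. w k a) = 1" by (rule w_total')
next
  fix b
  show "corner N N' b \<in> S" by (rule corner_in)
  show "half N N' (corner N N' b) = b" by (rule half_corner)
qed

end

section \<open>The swapping chain\<close>

lemma mult_min_ratio: "0 < a \<Longrightarrow> a * min 1 (b / a) = min a b" for a b :: real
  by (auto simp: min_def field_simps)

context bimodal_swap
begin

abbreviation P where "P \<equiv> swapping_chain C N N' M"
abbreviation met where "met \<equiv> metropolis C N N' M"
abbreviation acc where "acc \<equiv> swap_accept C N N' M"

lemma swap_states_eq: "swap_states N N' M = \<Omega>" and swap_dist_eq: "swap_dist C N N' M = \<pi>"
  by (simp_all add: swap_states_def swap_dist_def \<pi>_def fun_eq_iff)

lemma met_off: "a \<noteq> b \<Longrightarrow> met i a b = walk N N' a b * min 1 (w i b / w i a)"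
  by (simp add: metropolis_def with_holding_def)

lemma met_nonneg: "a \<noteq> b \<Longrightarrow> 0 \<le> met i a b"
  using w_nonneg by (simp add: met_off walk_def)

lemma met_le_walk: "a \<noteq> b \<Longrightarrow> met i a b \<le> walk N N' a b"
  by (simp add: met_off walk_def)

lemma w_met: "a \<noteq> b \<Longrightarrow> w i a * met i a b = walk N N' a b * min (w i a) (w i b)"
  using mult_min_ratio [OF w_pos', of i a "w i b"] by (simp add: met_off mult.left_commute)

lemma \<pi>_split: "i \<le> M \<Longrightarrow> \<pi> x = w i (x i) * (\<Prod>k\<in>{..M} - {i}. w k (x k))"
  unfolding \<pi>_def by (rule prod.remove) auto

lemma \<pi>_acc:
  assumes j: "j < M"
  shows "\<pi> x * acc j x = min (\<pi> x) (\<pi> (swap_at j x))"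
proof -
  let ?r = "\<Prod>k\<in>{..M} - {j, Suc j}. w k (x k)"
  let ?a = "w j (x j) * w (Suc j) (x (Suc j))" and ?b = "w j (x (Suc j)) * w (Suc j) (x j)"
  have r: "0 \<le> ?r" by (intro prod_nonneg) (auto intro: w_nonneg)
  have "\<pi> x * acc j x = ?a * min 1 (?b / ?a) * ?r"
    unfolding \<pi>_def prod_split_adjacent [OF j] by (simp add: swap_accept_def mult_ac)
  also have "\<dots> = min ?a ?b * ?r"
    using w_pos' by (subst mult_min_ratio) auto
  also have "\<dots> = min (?a * ?r) (?b * ?r)"
    using r by (simp add: min_mult_distrib_right)
  also have "\<dots> = min (\<pi> x) (\<pi> (swap_at j x))"
    unfolding \<pi>_def prod_swap_at [OF j] prod_split_adjacent [OF j] ..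
  finally show ?thesis .
qed

lemma acc_nonneg: "0 \<le> acc j x" and acc_le_1: "acc j x \<le> 1"
  using w_nonneg by (auto simp: swap_accept_def)

definition move :: "(nat \<Rightarrow> int) \<Rightarrow> (nat \<Rightarrow> int) \<Rightarrow> real"
  where "move x y = (\<Sum>i\<le>M. if y = x(i := y i) then 1 / (2 * (real M + 1)) * met i (x i) (y i) else 0)
    + (\<Sum>j<M. if y = swap_at j x then 1 / (2 * real M) * acc j x else 0)"

lemma P_eq: "P = with_holding \<Omega> move"
  unfolding swapping_chain_def swap_states_eq move_def [abs_def] swap_at_def by simp

lemma P_off: "x \<noteq> y \<Longrightarrow> P x y = move x y"
  by (simp add: P_eq with_holding_def)

lemma P_stochastic: "x \<in> \<Omega> \<Longrightarrow> (\<Sum>y\<in>\<Omega>. P x y) = 1"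
  by (simp add: P_eq with_holding_def sum.remove [of \<Omega> x])

lemma P_reversible:
  assumes x: "x \<in> \<Omega>" and y: "y \<in> \<Omega>"
  shows "\<pi> x * P x y = \<pi> y * P y x"
proof (cases "x = y")
  case False
  have "\<pi> x * (if y = x(i := y i) then 1 / (2 * (real M + 1)) * met i (x i) (y i) else 0)
      = \<pi> y * (if x = y(i := x i) then 1 / (2 * (real M + 1)) * met i (y i) (x i) else 0)"
    if i: "i \<le> M" for i
  proof (cases "y = x(i := y i)")
    case True
    then have *: "x = y(i := x i)" by (metis fun_upd_triv fun_upd_upd)
    have ne: "x i \<noteq> y i" using True False by (metis fun_upd_triv)
    have "(\<Prod>k\<in>{..M} - {i}. w k (y k)) = (\<Prod>k\<in>{..M} - {i}. w k (x k))"
      by (subst True, intro prod.cong) auto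
    then have "\<pi> x * met i (x i) (y i) = \<pi> y * met i (y i) (x i)"
      using w_met [OF ne, of i] w_met [OF ne [symmetric], of i] ne
      by (simp add: \<pi>_split [OF i] mult_ac walk_def abs_minus_commute min.commute)
    then show ?thesis using True * by simp
  next
    case False
    then have "x \<noteq> y(i := x i)" by (metis fun_upd_triv fun_upd_upd)
    then show ?thesis using False by simp
  qed
  moreover have "\<pi> x * (if y = swap_at j x then 1 / (2 * real M) * acc j x else 0)
      = \<pi> y * (if x = swap_at j y then 1 / (2 * real M) * acc j y else 0)"
    if j: "j < M" for j
  proof (cases "y = swap_at j x")
    case True
    then show ?thesis
      using \<pi>_acc [OF j, of x] \<pi>_acc [OF j, of y] by (simp add: min.commute)
  next
    case False
    then have "x \<noteq> swap_at j y" by (metis swap_at_swap_at)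
    then show ?thesis using False by simp
  qed
  ultimately show ?thesis
    using False unfolding P_off [OF False] P_off [OF False [symmetric]] move_def distrib_left sum_distrib_left
    by (intro arg_cong2 [where f = "(+)"] sum.cong) auto
qed simp

text \<open>\<open>H x = 0\<close> removes the diagonal, so \<open>P\<close> can be replaced by
  \<open>move\<close>. Terms that leave \<open>x\<close> in place, such as a swap of equal
  coordinates, vanish as well.\<close>

lemma sum_P:
  assumes x: "x \<in> \<Omega>" and H: "H x = 0"
  shows "(\<Sum>y\<in>\<Omega>. P x y * H y)
    = (\<Sum>i\<le>M. 1 / (2 * (real M + 1)) * (\<Sum>a\<in>S. met i (x i) a * H (x(i := a))))
      + (\<Sum>j<M. 1 / (2 * real M) * (acc j x * H (swap_at j x)))"
proof -
  let ?c = "1 / (2 * (real M + 1))" and ?c' = "1 / (2 * real M)"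
  have "(\<Sum>y\<in>\<Omega>. P x y * H y) = (\<Sum>y\<in>\<Omega>. move x y * H y)"
  proof (rule sum.cong [OF refl])
    fix y
    show "P x y * H y = move x y * H y" using H by (cases "x = y") (simp_all add: P_off)
  qed
  also have "\<dots> = (\<Sum>i\<le>M. \<Sum>y\<in>\<Omega>. if y = x(i := y i) then ?c * (met i (x i) (y i) * H y) else 0)
      + (\<Sum>j<M. \<Sum>y\<in>\<Omega>. if y = swap_at j x then ?c' * (acc j x * H y) else 0)"
  proof -
    have "(\<Sum>y\<in>\<Omega>. move x y * H y)
        = (\<Sum>y\<in>\<Omega>. (\<Sum>i\<le>M. if y = x(i := y i) then ?c * (met i (x i) (y i) * H y) else 0)
          + (\<Sum>j<M. if y = swap_at j x then ?c' * (acc j x * H y) else 0))"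
      unfolding move_def distrib_right sum_distrib_right
      by (intro sum.cong arg_cong2 [where f = "(+)"]) auto
    also have "\<dots> = (\<Sum>y\<in>\<Omega>. \<Sum>i\<le>M. if y = x(i := y i) then ?c * (met i (x i) (y i) * H y) else 0)
        + (\<Sum>y\<in>\<Omega>. \<Sum>j<M. if y = swap_at j x then ?c' * (acc j x * H y) else 0)"
      by (rule sum.distrib)
    finally show ?thesis by (simp only: sum.swap [of _ _ \<Omega>])
  qed
  also have "(\<Sum>i\<le>M. \<Sum>y\<in>\<Omega>. if y = x(i := y i) then ?c * (met i (x i) (y i) * H y) else 0)
      = (\<Sum>i\<le>M. ?c * (\<Sum>a\<in>S. met i (x i) a * H (x(i := a))))"
  proof (rule sum.cong [OF refl])
    fix i assume i: "i \<in> {..M}"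
    have "(\<Sum>y\<in>\<Omega>. if y = x(i := y i) then ?c * (met i (x i) (y i) * H y) else 0)
        = (\<Sum>y\<in>{y \<in> \<Omega>. y = x(i := y i)}. ?c * (met i (x i) (y i) * H y))"
      by (rule sum.inter_filter [symmetric]) simp
    also have "\<dots> = (\<Sum>a\<in>S. ?c * (met i (x i) a * H (x(i := a))))"
    proof (rule sum.reindex_bij_witness [where i = "\<lambda>a. x(i := a)" and j = "\<lambda>y. y i"])
      fix y assume y: "y \<in> {y \<in> \<Omega>. y = x(i := y i)}"
      then show "x(i := y i) = y" and "y i \<in> S" using i by auto
      show "?c * (met i (x i) (y i) * H (x(i := y i))) = ?c * (met i (x i) (y i) * H y)"
        using y by simp
    next
      fix a assume "a \<in> S"
      then show "x(i := a) \<in> {y \<in> \<Omega>. y = x(i := y i)}"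
        using i x by (auto simp: PiE_iff extensional_def)
    qed auto
    finally show "(\<Sum>y\<in>\<Omega>. if y = x(i := y i) then ?c * (met i (x i) (y i) * H y) else 0)
        = ?c * (\<Sum>a\<in>S. met i (x i) a * H (x(i := a)))"
      by (simp only: sum_distrib_left)
  qed
  also have "(\<Sum>j<M. \<Sum>y\<in>\<Omega>. if y = swap_at j x then ?c' * (acc j x * H y) else 0)
      = (\<Sum>j<M. ?c' * (acc j x * H (swap_at j x)))"
  proof (rule sum.cong [OF refl])
    fix j assume "j \<in> {..<M}"
    then have "swap_at j x \<in> \<Omega>" using x by (intro swap_at_in_PiE) auto
    then show "(\<Sum>y\<in>\<Omega>. if y = swap_at j x then ?c' * (acc j x * H y) else 0)
        = ?c' * (acc j x * H (swap_at j x))"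
      by (simp only: sum.delta finite_\<Omega> if_True)
  qed
  finally show ?thesis .
qed

text \<open>Only the moves from \<open>b\<close> to \<open>b + 1\<close> are kept. The proposal
  gives them the \<open>1/2\<close>, and \<open>w_met\<close> turns the acceptance probability into
  the minimum of the weights.\<close>

lemma edge_form_le:
  "1/2 * edge_form N N' (w i) F \<le> (\<Sum>b\<in>S. w i b * (\<Sum>a\<in>S. met i b a * (F b - F a)\<^sup>2))"
proof -
  have nn: "0 \<le> met i b a * (F b - F a)\<^sup>2" for a b
    using met_nonneg [of b a i] by (cases "a = b") auto
  have "1/2 * edge_form N N' (w i) F
      \<le> (\<Sum>b\<in>{- int N..<int N'}. w i b * (\<Sum>a\<in>S. met i b a * (F b - F a)\<^sup>2))"
    unfolding edge_form_def sum_distrib_left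
  proof (intro sum_mono)
    fix b assume b: "b \<in> {- int N..<int N'}"
    have "1/2 * (min (w i b) (w i (b + 1)) * (F b - F (b + 1))\<^sup>2)
        = w i b * (met i b (b + 1) * (F b - F (b + 1))\<^sup>2)"
      using w_met [of b "b + 1" i] by (simp add: walk_def flip: mult.assoc)
    also have "\<dots> \<le> w i b * (\<Sum>a\<in>S. met i b a * (F b - F a)\<^sup>2)"
      using b nn w_nonneg
      by (intro mult_left_mono member_le_sum [where f = "\<lambda>a. met i b a * (F b - F a)\<^sup>2"])
        (auto simp: sites_def)
    finally show "1/2 * (min (w i b) (w i (b + 1)) * (F b - F (b + 1))\<^sup>2)
        \<le> (\<Sum>a\<in>S. w i b * (met i b a * (F b - F a)\<^sup>2))"
      by (simp only: sum_distrib_left)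
  qed
  also have "\<dots> \<le> (\<Sum>b\<in>S. w i b * (\<Sum>a\<in>S. met i b a * (F b - F a)\<^sup>2))"
    by (intro sum_mono2 mult_nonneg_nonneg sum_nonneg nn w_nonneg) (auto simp: sites_def)
  finally show ?thesis .
qed

text \<open>The constant is the \<open>1/2\<close> of the Dirichlet form, times the selection
  probability \<open>1 / (2 (M + 1))\<close>, times the \<open>1/2\<close> of
  \<open>edge_form_le\<close>. Swaps have the larger selection probability and no such loss; they
  are reduced to the same constant.\<close>

lemma forms_le_dirichlet:
  "1 / (8 * (real M + 1)) * ((\<Sum>i\<le>M. level_form i f) + (\<Sum>j<M. swap_form j f))
    \<le> 1/2 * (\<Sum>x\<in>\<Omega>. \<Sum>y\<in>\<Omega>. \<pi> x * P x y * (f x - f y)\<^sup>2)"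
proof -
  define c c' where "c = 1 / (2 * (real M + 1))" and "c' = 1 / (2 * real M)"
  have swap: "(\<Sum>x\<in>\<Omega>. \<pi> x * (acc j x * (f x - f (swap_at j x))\<^sup>2)) = swap_form j f" if "j < M" for j
    unfolding swap_form_def using \<pi>_acc [OF that] by (simp flip: mult.assoc)
  have level: "1/2 * level_form i f \<le> (\<Sum>x\<in>\<Omega>. \<pi> x * (\<Sum>a\<in>S. met i (x i) a * (f x - f (x(i := a)))\<^sup>2))"
    if i: "i \<le> M" for i
  proof -
    have "1/2 * level_form i f = (\<Sum>x\<in>\<Omega>. \<pi> x * (1/2 * edge_form N N' (w i) (\<lambda>a. f (x(i := a)))))"
      by (simp add: level_form_def sum_distrib_left)
    also have "\<dots> \<le> (\<Sum>x\<in>\<Omega>. \<pi> x * (\<Sum>b\<in>S. w i b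
        * (\<Sum>a\<in>S. met i b a * (f (x(i := b)) - f (x(i := a)))\<^sup>2)))"
      by (intro sum_mono mult_left_mono edge_form_le) (auto intro: less_imp_le \<pi>_pos)
    also have "\<dots> = (\<Sum>x\<in>\<Omega>. \<pi> x * (\<Sum>a\<in>S. met i (x i) a * (f x - f (x(i := a)))\<^sup>2))"
      using sum_prod_resample [where i = i and M = M and S = S and w = w and
          F = "\<lambda>x. \<Sum>a\<in>S. met i (x i) a * (f x - f (x(i := a)))\<^sup>2"] w_total' i
      by (simp add: \<pi>_def)
    finally show ?thesis .
  qed
  have "(\<Sum>x\<in>\<Omega>. \<Sum>y\<in>\<Omega>. \<pi> x * P x y * (f x - f y)\<^sup>2)
      = (\<Sum>x\<in>\<Omega>. \<pi> x * ((\<Sum>i\<le>M. c * (\<Sum>a\<in>S. met i (x i) a * (f x - f (x(i := a)))\<^sup>2))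
        + (\<Sum>j<M. c' * (acc j x * (f x - f (swap_at j x))\<^sup>2))))"
  proof (rule sum.cong [OF refl])
    fix x assume "x \<in> \<Omega>"
    then show "(\<Sum>y\<in>\<Omega>. \<pi> x * P x y * (f x - f y)\<^sup>2)
      = \<pi> x * ((\<Sum>i\<le>M. c * (\<Sum>a\<in>S. met i (x i) a * (f x - f (x(i := a)))\<^sup>2))
        + (\<Sum>j<M. c' * (acc j x * (f x - f (swap_at j x))\<^sup>2)))"
      using sum_P [of x "\<lambda>y. (f x - f y)\<^sup>2"] by (simp only: mult.assoc flip: sum_distrib_left) (simp add: c_def c'_def)
  qed
  also have "\<dots> = (\<Sum>i\<le>M. c * (\<Sum>x\<in>\<Omega>. \<pi> x * (\<Sum>a\<in>S. met i (x i) a * (f x - f (x(i := a)))\<^sup>2)))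
      + (\<Sum>j<M. c' * (\<Sum>x\<in>\<Omega>. \<pi> x * (acc j x * (f x - f (swap_at j x))\<^sup>2)))"
    unfolding distrib_left sum.distrib
  proof (rule arg_cong2 [where f = "(+)"])
    have exchange: "(\<Sum>x\<in>\<Omega>. \<pi> x * (\<Sum>i\<in>I. c * G i x)) = (\<Sum>i\<in>I. c * (\<Sum>x\<in>\<Omega>. \<pi> x * G i x))"
      for I :: "nat set" and c :: real and G :: "nat \<Rightarrow> (nat \<Rightarrow> int) \<Rightarrow> real"
      unfolding sum_distrib_left by (subst sum.swap) (simp add: mult_ac)
    show "(\<Sum>x\<in>\<Omega>. \<pi> x * (\<Sum>i\<le>M. c * (\<Sum>a\<in>S. met i (x i) a * (f x - f (x(i := a)))\<^sup>2)))
        = (\<Sum>i\<le>M. c * (\<Sum>x\<in>\<Omega>. \<pi> x * (\<Sum>a\<in>S. met i (x i) a * (f x - f (x(i := a)))\<^sup>2)))"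
      and "(\<Sum>x\<in>\<Omega>. \<pi> x * (\<Sum>j<M. c' * (acc j x * (f x - f (swap_at j x))\<^sup>2)))
        = (\<Sum>j<M. c' * (\<Sum>x\<in>\<Omega>. \<pi> x * (acc j x * (f x - f (swap_at j x))\<^sup>2)))"
      by (rule exchange)+
  qed
  also have "\<dots> \<ge> (\<Sum>i\<le>M. c * (1/2 * level_form i f)) + (\<Sum>j<M. c * (1/2 * swap_form j f))"
  proof (intro add_mono sum_mono)
    fix i assume "i \<in> {..M}"
    then show "c * (1/2 * level_form i f)
        \<le> c * (\<Sum>x\<in>\<Omega>. \<pi> x * (\<Sum>a\<in>S. met i (x i) a * (f x - f (x(i := a)))\<^sup>2))"
      by (intro mult_left_mono level) (auto simp: c_def)
  next
    fix j assume "j \<in> {..<M}"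
    then have j: "j < M" by simp
    show "c * (1/2 * swap_form j f) \<le> c' * (\<Sum>x\<in>\<Omega>. \<pi> x * (acc j x * (f x - f (swap_at j x))\<^sup>2))"
      unfolding swap [OF j] using swap_form_nonneg [OF j, of f] M_pos'
      by (intro mult_mono) (auto simp: c_def c'_def intro!: divide_left_mono)
  qed
  finally have "(\<Sum>i\<le>M. c * (1/2 * level_form i f)) + (\<Sum>j<M. c * (1/2 * swap_form j f))
      \<le> (\<Sum>x\<in>\<Omega>. \<Sum>y\<in>\<Omega>. \<pi> x * P x y * (f x - f y)\<^sup>2)" .
  moreover have "(\<Sum>i\<le>M. c * (1/2 * level_form i f)) + (\<Sum>j<M. c * (1/2 * swap_form j f))
      = 2 * (1 / (8 * (real M + 1)) * ((\<Sum>i\<le>M. level_form i f) + (\<Sum>j<M. swap_form j f)))"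
  proof -
    have "4 * k * (1/2 * u) + 4 * k * (1/2 * v) = 2 * (k * (u + v))" for k u v :: real
      by (simp add: algebra_simps)
    moreover have "c = 4 * (1 / (8 * (real M + 1)))" by (simp add: c_def field_simps)
    ultimately show ?thesis unfolding sum_distrib_left [symmetric] by metis
  qed
  ultimately show ?thesis by linarith
qed

section \<open>Holding at level \<open>0\<close> and eigenvalues near \<open>-1\<close>\<close>

lemma P_diag_ge:
  assumes x: "x \<in> \<Omega>"
  shows "(if x 0 = int N' then 1 / (4 * (real M + 1)) else 0) \<le> P x x"
proof -
  let ?c = "1 / (2 * (real M + 1))" and ?c' = "1 / (2 * real M)"
  \<comment> \<open>\<open>q i\<close> is the probability that the chain of level \<open>i\<close>
    leaves \<open>x i\<close>. At \<open>N'\<close> only one neighbour exists, so it is at most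
    \<open>1/2\<close>.\<close>
  define q where "q i = (\<Sum>a\<in>S. met i (x i) a * of_bool (x(i := a) \<noteq> x))" for i
  have q: "q i \<le> (if x i = int N' then 1/2 else 1)" if "i \<le> M" for i
  proof -
    have xi: "x i \<in> S" using x that by auto
    have "q i \<le> (\<Sum>a\<in>S. if a \<in> {x i - 1, x i + 1} then 1/2 else 0)"
      unfolding q_def
    proof (rule sum_mono)
      fix a
      show "met i (x i) a * of_bool (x(i := a) \<noteq> x) \<le> (if a \<in> {x i - 1, x i + 1} then 1/2 else 0)"
        using met_le_walk [of "x i" a i] by (cases "a = x i") (auto simp: walk_def split: if_splits)
    qed
    also have "\<dots> = 1/2 * real (card (S \<inter> {x i - 1, x i + 1}))"
      by (subst sum.inter_restrict [symmetric]) simp_all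
    also have "\<dots> \<le> (if x i = int N' then 1/2 else 1)"
    proof (cases "x i = int N'")
      case True
      then have "S \<inter> {x i - 1, x i + 1} \<subseteq> {x i - 1}" by (auto simp: sites_def)
      then have "card (S \<inter> {x i - 1, x i + 1}) \<le> 1"
        using card_mono [of "{x i - 1}"] by simp
      then show ?thesis using True by simp
    next
      case False
      have "card (S \<inter> {x i - 1, x i + 1}) \<le> card {x i - 1, x i + 1}" by (rule card_mono) auto
      also have "\<dots> \<le> 2" by (simp add: card_insert_if)
      finally show ?thesis using False by simp
    qed
    finally show ?thesis .
  qed
  have "(\<Sum>y\<in>\<Omega>. P x y * of_bool (y \<noteq> x)) = (\<Sum>y\<in>\<Omega> - {x}. P x y)"
    by (intro sum.mono_neutral_cong_right) auto
  also have "\<dots> = 1 - P x x"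
    using P_stochastic [OF x] x by (simp add: sum.remove [of \<Omega> x])
  finally have "1 - P x x = (\<Sum>i\<le>M. ?c * q i) + (\<Sum>j<M. ?c' * (acc j x * of_bool (swap_at j x \<noteq> x)))"
    using sum_P [OF x, of "\<lambda>y. of_bool (y \<noteq> x)"] by (simp add: q_def)
  also have "(\<Sum>j<M. ?c' * (acc j x * of_bool (swap_at j x \<noteq> x))) \<le> (\<Sum>j<M. ?c')"
    using acc_le_1 acc_nonneg by (intro sum_mono mult_left_le) auto
  also have "(\<Sum>j<M. ?c') = 1/2" using M_pos' by simp
  also have "(\<Sum>i\<le>M. ?c * q i) = ?c * (q 0 + (\<Sum>i<M. q (Suc i)))"
    unfolding sum_distrib_left [symmetric] sum.atMost_shift ..
  also have "\<dots> \<le> ?c * ((if x 0 = int N' then 1/2 else 1) + (\<Sum>i<M. 1))"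
  proof (intro mult_left_mono add_mono sum_mono)
    fix i assume "i \<in> {..<M}"
    then have "q (Suc i) \<le> (if x (Suc i) = int N' then 1/2 else 1)" by (intro q) auto
    then show "q (Suc i) \<le> 1" by (simp split: if_splits)
  qed (use q [of 0] in auto)
  finally have le: "1 - P x x \<le> ?c * ((if x 0 = int N' then 1/2 else 1) + real M) + 1/2"
    by simp
  \<comment> \<open>With \<open>t\<close> as the bound on \<open>q 0\<close>, the holding
    probability is at least \<open>?c (1 - t)\<close>.\<close>
  have "?c * (t + real M) = 1/2 - ?c * (1 - t)" for t
    by (simp add: field_simps)
  from le [unfolded this] show ?thesis by (cases "x 0 = int N'") simp_all
qed

text \<open>If \<open>f x + f y\<close> is small along the moves of level \<open>0\<close>, then
  \<open>h\<close>, which is \<open>f\<close> with alternating sign, varies little along that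
  coordinate and is controlled by its value at the end \<open>N'\<close>. There the chain holds, and
  the diagonal term is four times the square of \<open>f\<close>.\<close>

lemma square_sum_le:
  "(\<Sum>x\<in>\<Omega>. \<pi> x * (f x)\<^sup>2) \<le> 16 * (real M + 1) * (len * (len + 1))
    * (1/2 * (\<Sum>x\<in>\<Omega>. \<Sum>y\<in>\<Omega>. \<pi> x * P x y * (f x + f y)\<^sup>2))"
proof -
  let ?m = "real M + 1"
  let ?up = "\<lambda>x :: nat \<Rightarrow> int. x(0 := x 0 + 1)" and ?end = "\<lambda>x :: nat \<Rightarrow> int. x(0 := int N')"
  \<comment> \<open>The shift by \<open>N\<close> makes the exponent nonnegative on
    \<open>S\<close>, so \<open>nat\<close> preserves its parity.\<close>
  define h where "h x = (-1) ^ nat (x 0 + int N) * f x" for x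
  define E where "E = (\<Sum>x\<in>\<Omega>. \<pi> x * (of_bool (x 0 = int N') * (f x)\<^sup>2))"
  define T where "T = (\<Sum>x\<in>\<Omega>. \<Sum>y\<in>\<Omega>. \<pi> x * P x y * (f x + f y)\<^sup>2)"
  have h2: "(h x)\<^sup>2 = (f x)\<^sup>2" for x by (simp add: h_def power_mult_distrib flip: power_mult)
  have h_up: "(h x - h (?up x))\<^sup>2 = (f x + f (?up x))\<^sup>2" if "- int N \<le> x 0" for x
  proof -
    have "nat (x 0 + 1 + int N) = Suc (nat (x 0 + int N))" using that by simp
    then have "h x - h (?up x) = (-1) ^ nat (x 0 + int N) * (f x + f (?up x))"
      by (simp add: h_def algebra_simps)
    then show ?thesis by (simp add: power_mult_distrib flip: power_mult)
  qed
  have L: "level_form 0 h = (\<Sum>x\<in>\<Omega>. \<pi> x * (of_bool (x 0 < int N') * (f x + f (?up x))\<^sup>2))"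
  proof -
    have "edge_form N N' (w 0) (\<lambda>a. h (x(0 := a)))
        = (\<Sum>a\<in>S. w 0 a * (of_bool (a < int N') * (f (x(0 := a)) + f (x(0 := a + 1)))\<^sup>2))" for x
    proof -
      have "(\<Sum>a\<in>S. w 0 a * (of_bool (a < int N') * (f (x(0 := a)) + f (x(0 := a + 1)))\<^sup>2))
          = (\<Sum>a\<in>{- int N..<int N'}. min (w 0 a) (w 0 (a + 1)) * (h (x(0 := a)) - h (x(0 := a + 1)))\<^sup>2)"
        using h_up [of "x(0 := _)"]
        by (intro sum.mono_neutral_cong_right) (auto simp: sites_def w_0)
      then show ?thesis by (simp add: edge_form_def)
    qed
    then have "level_form 0 h = (\<Sum>x\<in>\<Omega>. \<pi> x * (\<Sum>a\<in>S. w 0 a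
        * (of_bool (a < int N') * (f (x(0 := a)) + f (x(0 := a + 1)))\<^sup>2)))"
      by (simp add: level_form_def)
    also have "\<dots> = (\<Sum>x\<in>\<Omega>. \<pi> x * (of_bool (x 0 < int N') * (f x + f (?up x))\<^sup>2))"
      using sum_prod_resample [where i = 0 and M = M and S = S and w = w and
          F = "\<lambda>x. of_bool (x 0 < int N') * (f x + f (?up x))\<^sup>2"] w_total'
      by (simp add: \<pi>_def)
    finally show ?thesis .
  qed
  \<comment> \<open>Coordinate \<open>0\<close> is uniform, so redrawing it gives \<open>N'\<close>
    with probability \<open>1 / (len + 1)\<close>.\<close>
  have E: "(\<Sum>x\<in>\<Omega>. \<pi> x * (f (?end x))\<^sup>2) = (len + 1) * E"
  proof -
    have "(\<Sum>a\<in>S. w 0 a * (of_bool (a = int N') * (f (x(0 := a)))\<^sup>2)) = (f (?end x))\<^sup>2 / (len + 1)" for x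
    proof -
      have "(\<Sum>a\<in>S. w 0 a * (of_bool (a = int N') * (f (x(0 := a)))\<^sup>2))
          = (\<Sum>a\<in>{int N'}. w 0 a * (f (x(0 := a)))\<^sup>2)"
        by (intro sum.mono_neutral_cong_right) (auto simp: sites_def)
      then show ?thesis by (simp add: w_0)
    qed
    then have "E = (\<Sum>x\<in>\<Omega>. \<pi> x * ((f (?end x))\<^sup>2 / (len + 1)))"
      using sum_prod_resample [where i = 0 and M = M and S = S and w = w and
          F = "\<lambda>x. of_bool (x 0 = int N') * (f x)\<^sup>2"] w_total'
      by (simp add: \<pi>_def E_def)
    also have "\<dots> = (\<Sum>x\<in>\<Omega>. \<pi> x * (f (?end x))\<^sup>2) / (len + 1)"
      by (simp add: sum_divide_distrib)
    finally show ?thesis by (simp add: field_simps add_pos_pos)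
  qed
  have T: "1 / (4 * ?m) * (level_form 0 h + 4 * E) \<le> T"
  proof -
    have "1 / (4 * ?m) * (level_form 0 h + 4 * E)
        = (\<Sum>x\<in>\<Omega>. \<pi> x * (1 / (4 * ?m) * (of_bool (x 0 < int N') * (f x + f (?up x))\<^sup>2)
          + 1 / (4 * ?m) * (4 * (of_bool (x 0 = int N') * (f x)\<^sup>2))))"
      unfolding L E_def sum_distrib_left sum.distrib [symmetric] distrib_left
      by (intro sum.cong) (simp_all add: mult.left_commute)
    also have "\<dots> \<le> T"
      unfolding T_def
    proof (rule sum_mono)
      fix x assume x: "x \<in> \<Omega>"
      have x0: "x 0 \<in> S" using x by auto
      \<comment> \<open>The indicator supplies the condition \<open>H x = 0\<close> of
        \<open>sum_P\<close>; the diagonal term is kept apart to bound \<open>E\<close>.\<close>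
      let ?H = "\<lambda>y. of_bool (y \<noteq> x) * (f x + f y)\<^sup>2"
      have term_nn: "0 \<le> met i (x i) a * ?H (x(i := a))" for i a
        using met_nonneg [of "x i" a i] by (cases "a = x i") auto
      have "(\<Sum>y\<in>\<Omega>. P x y * (f x + f y)\<^sup>2) = P x x * (f x + f x)\<^sup>2 + (\<Sum>y\<in>\<Omega> - {x}. P x y * (f x + f y)\<^sup>2)"
        using x by (simp add: sum.remove)
      also have "(\<Sum>y\<in>\<Omega> - {x}. P x y * (f x + f y)\<^sup>2) = (\<Sum>y\<in>\<Omega>. P x y * ?H y)"
        by (intro sum.mono_neutral_cong_left) auto
      also have "\<dots> = (\<Sum>i\<le>M. 1 / (2 * ?m) * (\<Sum>a\<in>S. met i (x i) a * ?H (x(i := a))))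
          + (\<Sum>j<M. 1 / (2 * real M) * (acc j x * ?H (swap_at j x)))"
        using sum_P [OF x, of ?H] by simp
      finally have eq: "(\<Sum>y\<in>\<Omega>. P x y * (f x + f y)\<^sup>2) = P x x * (f x + f x)\<^sup>2
          + ((\<Sum>i\<le>M. 1 / (2 * ?m) * (\<Sum>a\<in>S. met i (x i) a * ?H (x(i := a))))
          + (\<Sum>j<M. 1 / (2 * real M) * (acc j x * ?H (swap_at j x))))" .
      have "1 / (4 * ?m) * (of_bool (x 0 < int N') * (f x + f (?up x))\<^sup>2)
          \<le> 1 / (2 * ?m) * (\<Sum>a\<in>S. met 0 (x 0) a * ?H (x(0 := a)))"
      proof (cases "x 0 < int N'")
        case True
        have "?up x \<noteq> x" by (metis fun_upd_same less_irrefl zless_add1_eq)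
        moreover have "met 0 (x 0) (x 0 + 1) = 1/2"
          by (simp add: met_off walk_def w_0)
        ultimately have "1/2 * (f x + f (?up x))\<^sup>2 = met 0 (x 0) (x 0 + 1) * ?H (?up x)" by simp
        also have "\<dots> \<le> (\<Sum>a\<in>S. met 0 (x 0) a * ?H (x(0 := a)))"
          using True x0 term_nn [of 0]
          by (intro member_le_sum [where f = "\<lambda>a. met 0 (x 0) a * ?H (x(0 := a))"]) (auto simp: sites_def)
        finally have "1 / (2 * ?m) * (1/2 * (f x + f (?up x))\<^sup>2)
            \<le> 1 / (2 * ?m) * (\<Sum>a\<in>S. met 0 (x 0) a * ?H (x(0 := a)))"
          by (intro mult_left_mono) auto
        then show ?thesis using True by simp
      next
        case False
        then show ?thesis using term_nn [of 0] by (auto intro!: divide_nonneg_nonneg sum_nonneg)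
      qed
      also have "\<dots> \<le> (\<Sum>i\<le>M. 1 / (2 * ?m) * (\<Sum>a\<in>S. met i (x i) a * ?H (x(i := a))))"
      proof (rule member_le_sum [where f = "\<lambda>i. 1 / (2 * ?m) * (\<Sum>a\<in>S. met i (x i) a * ?H (x(i := a)))"])
        fix i
        have "0 \<le> (\<Sum>a\<in>S. met i (x i) a * ?H (x(i := a)))"
          by (rule sum_nonneg) (rule term_nn)
        then show "0 \<le> 1 / (2 * ?m) * (\<Sum>a\<in>S. met i (x i) a * ?H (x(i := a)))"
          by (intro mult_nonneg_nonneg) auto
      qed auto
      also have "\<dots> \<le> \<dots> + (\<Sum>j<M. 1 / (2 * real M) * (acc j x * ?H (swap_at j x)))"
        using acc_nonneg by (simp add: sum_nonneg)
      finally have "1 / (4 * ?m) * (of_bool (x 0 < int N') * (f x + f (?up x))\<^sup>2)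
          \<le> (\<Sum>y\<in>\<Omega>. P x y * (f x + f y)\<^sup>2) - P x x * (f x + f x)\<^sup>2"
        using eq by linarith
      moreover have "1 / (4 * ?m) * (4 * (of_bool (x 0 = int N') * (f x)\<^sup>2)) \<le> P x x * (f x + f x)\<^sup>2"
      proof -
        have "(if x 0 = int N' then 1 / (4 * ?m) else 0) * (f x + f x)\<^sup>2 \<le> P x x * (f x + f x)\<^sup>2"
          by (intro mult_right_mono P_diag_ge [OF x]) auto
        moreover have "(if x 0 = int N' then 1 / (4 * ?m) else 0) * (f x + f x)\<^sup>2
            = 1 / (4 * ?m) * (4 * (of_bool (x 0 = int N') * (f x)\<^sup>2))"
          by (simp add: power2_eq_square)
        ultimately show ?thesis by simp
      qed
      ultimately have "1 / (4 * ?m) * (of_bool (x 0 < int N') * (f x + f (?up x))\<^sup>2)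
          + 1 / (4 * ?m) * (4 * (of_bool (x 0 = int N') * (f x)\<^sup>2)) \<le> (\<Sum>y\<in>\<Omega>. P x y * (f x + f y)\<^sup>2)"
        by linarith
      then have "\<pi> x * (1 / (4 * ?m) * (of_bool (x 0 < int N') * (f x + f (?up x))\<^sup>2)
          + 1 / (4 * ?m) * (4 * (of_bool (x 0 = int N') * (f x)\<^sup>2)))
          \<le> \<pi> x * (\<Sum>y\<in>\<Omega>. P x y * (f x + f y)\<^sup>2)"
        using \<pi>_pos [OF x] by (intro mult_left_mono) auto
      then show "\<pi> x * (1 / (4 * ?m) * (of_bool (x 0 < int N') * (f x + f (?up x))\<^sup>2)
          + 1 / (4 * ?m) * (4 * (of_bool (x 0 = int N') * (f x)\<^sup>2)))
          \<le> (\<Sum>y\<in>\<Omega>. \<pi> x * P x y * (f x + f y)\<^sup>2)"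
        by (simp only: mult.assoc sum_distrib_left)
    qed
    finally show ?thesis .
  qed
  have E_nonneg: "0 \<le> E"
    unfolding E_def by (intro sum_nonneg mult_nonneg_nonneg) (auto intro: less_imp_le \<pi>_pos)
  let ?R = "len * (len + 1)"
  have "(\<Sum>x\<in>\<Omega>. \<pi> x * (f x)\<^sup>2) \<le> (\<Sum>x\<in>\<Omega>. 2 * (\<pi> x * (h x - h (?end x))\<^sup>2) + 2 * (\<pi> x * (f (?end x))\<^sup>2))"
  proof (rule sum_mono)
    fix x assume x: "x \<in> \<Omega>"
    have "a\<^sup>2 \<le> 2 * (a - b)\<^sup>2 + 2 * b\<^sup>2" for a b :: real
      using zero_le_power2 [of "a - 2 * b"] by (simp add: power2_eq_square algebra_simps)
    from this [of "h x" "h (?end x)"] have "(f x)\<^sup>2 \<le> 2 * (h x - h (?end x))\<^sup>2 + 2 * (f (?end x))\<^sup>2"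
      by (simp add: h2)
    then have "\<pi> x * (f x)\<^sup>2 \<le> \<pi> x * (2 * (h x - h (?end x))\<^sup>2 + 2 * (f (?end x))\<^sup>2)"
      using \<pi>_pos [OF x] by (intro mult_left_mono) auto
    then show "\<pi> x * (f x)\<^sup>2 \<le> 2 * (\<pi> x * (h x - h (?end x))\<^sup>2) + 2 * (\<pi> x * (f (?end x))\<^sup>2)"
      by (simp only: distrib_left mult.left_commute)
  qed
  also have "\<dots> = 2 * (\<Sum>x\<in>\<Omega>. \<pi> x * (h x - h (?end x))\<^sup>2) + 2 * ((len + 1) * E)"
    by (simp add: sum.distrib E flip: sum_distrib_left)
  also have "\<dots> \<le> 2 * (?R * level_form 0 h) + 2 * (?R * (4 * E))"
  proof (intro add_mono mult_left_mono base_displacement_le)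
    have "1 \<le> len" using N_pos by simp
    then have "(len + 1) * E \<le> len * ((len + 1) * E)"
      using E_nonneg mult_right_mono [of 1 len "(len + 1) * E"] by simp
    then show "(len + 1) * E \<le> ?R * (4 * E)"
      using E_nonneg by (simp add: mult.assoc)
  qed auto
  also have "\<dots> = 8 * ?m * ?R * (1 / (4 * ?m) * (level_form 0 h + 4 * E))"
    by (simp add: field_simps)
  also have "\<dots> \<le> 8 * ?m * ?R * T"
    by (intro mult_left_mono T) auto
  also have "\<dots> = 16 * ?m * ?R * (1/2 * T)" by simp
  finally show ?thesis unfolding T_def .
qed

section \<open>The bound on the mixing time\<close>

lemma \<pi>_ge:
  assumes x: "x \<in> \<Omega>"
  shows "exp (- ((real M + 1) * (len * (1 + ln C)))) \<le> \<pi> x"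
proof -
  have w: "exp (- (len * (1 + ln C))) \<le> w k a" if k: "k \<le> M" for k a
  proof -
    \<comment> \<open>Every weight is at least one, so an upper bound on the normalizing constant
      suffices.\<close>
    have "tot k \<le> (\<Sum>z\<in>S. C ^ (N + N'))"
      unfolding tot_def
    proof (rule sum_mono)
      fix z assume z: "z \<in> S"
      have "base k \<le> C powr 1"
        unfolding base_def using C k M_pos' by (intro powr_mono) auto
      then have "base k \<le> C" using C by simp
      then have "wt k z \<le> C ^ nat \<bar>z\<bar>"
        unfolding wt_eq using base_ge_1 [of k] by (intro power_mono) auto
      also have "\<dots> \<le> C ^ (N + N')"
        using C z by (intro power_increasing) (auto simp: sites_def)
      finally show "wt k z \<le> C ^ (N + N')" .
    qed
    also have "\<dots> = (1 + len) * C ^ (N + N')" by (simp add: card_S)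
    also have "\<dots> \<le> exp len * exp (ln C) ^ (N + N')"
      using C exp_ge_add_one_self [of len] by (intro mult_mono) auto
    also have "\<dots> = exp (len * (1 + ln C))"
      by (simp add: distrib_left exp_add flip: exp_of_nat_mult)
    finally have "1 / exp (len * (1 + ln C)) \<le> 1 / tot k"
      using tot_pos [of k] by (intro divide_left_mono) auto
    also have "\<dots> \<le> w k a"
      using wt_ge_1 [of k a] tot_pos [of k] by (simp add: w_eq divide_right_mono)
    finally show ?thesis by (simp only: exp_minus inverse_eq_divide)
  qed
  have "exp (- ((real M + 1) * (len * (1 + ln C)))) = (\<Prod>k\<le>M. exp (- (len * (1 + ln C))))"
    by (simp add: algebra_simps flip: exp_of_nat_mult exp_add)
  also have "\<dots> \<le> \<pi> x"
    unfolding \<pi>_def using w by (intro prod_mono) auto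
  finally show ?thesis .
qed

text \<open>\<open>K\<close> is the constant of \<open>poincare\<close> times the
  \<open>8 (M + 1)\<close> of \<open>forms_le_dirichlet\<close>; since
  \<open>n ^ 2 R = len ^ 3 (len + 1)\<close> is at most \<open>2 len ^ 4\<close>, the number is
  \<open>2000 * 8 * 2\<close>. The smaller constant of \<open>square_sum_le\<close> is
  absorbed.\<close>

lemma mixing_time_swapping_chain_le:
  assumes \<epsilon>: "0 < \<epsilon>"
    and t: "32000 * (real M + 1) ^ 4 * len ^ 4 * (ln (1 / \<epsilon>) + (real M + 1) * (len * (1 + ln C))) \<le> real t"
  shows "mixing_time (swap_states N N' M) P (swap_dist C N N' M) \<epsilon> \<le> enat t"
  unfolding swap_states_eq swap_dist_eq
proof (rule mixing_time_le [where K = "32000 * (real M + 1) ^ 4 * len ^ 4"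
      and L = "(real M + 1) * (len * (1 + ln C))"])
  let ?m = "real M + 1" and ?K = "32000 * (real M + 1) ^ 4 * len ^ 4"
  have len: "1 \<le> len" using N_pos by simp
  have m: "1 \<le> ?m" by simp
  have pow: "1 \<le> ?m ^ 4 * len ^ 4"
    using mult_mono [of 1 "?m ^ 4" 1 "len ^ 4"] one_le_power [OF m, of 4] one_le_power [OF len, of 4] by simp
  then show "1 < ?K" by simp
  show "finite \<Omega>" by simp
  show "\<Omega> \<noteq> {}" using corner_in by (auto simp: PiE_eq_empty_iff)
  show "(\<Sum>x\<in>\<Omega>. \<pi> x) = 1"
    unfolding \<pi>_def using w_total' by (intro sum_prod_PiE_eq_1) auto
  show "0 \<le> ?m * (len * (1 + ln C))" using C by simp
  fix f :: "(nat \<Rightarrow> int) \<Rightarrow> real"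
  define Q where "Q = (\<Sum>x\<in>\<Omega>. \<pi> x * (f x)\<^sup>2)"
  define X where "X = 1/2 * (\<Sum>x\<in>\<Omega>. \<Sum>y\<in>\<Omega>. \<pi> x * P x y * (f x + f y)\<^sup>2)"
  have "Q \<le> 16 * ?m * (len * (len + 1)) * X"
    unfolding Q_def X_def by (rule square_sum_le)
  moreover have "0 \<le> Q"
    unfolding Q_def by (intro sum_nonneg mult_nonneg_nonneg) (auto intro: less_imp_le \<pi>_pos)
  \<comment> \<open>Nonnegativity of \<open>X\<close> is read off from \<open>0 \<le> Q\<close> and
    the bound just obtained.\<close>
  ultimately have "0 \<le> 16 * ?m * (len * (len + 1)) * X" by linarith
  moreover have "0 < 16 * ?m * (len * (len + 1))" using len by simp
  ultimately have X: "0 \<le> X" by (simp only: zero_le_mult_iff) linarith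
  have "16 * ?m * (len * (len + 1)) \<le> 32000 * ?m ^ 4 * len ^ 4"
  proof -
    have "len * (len + 1) \<le> len * (len * 2)"
      using len by (intro mult_left_mono) auto
    also have "\<dots> = len ^ 2 * 2" by (simp add: power2_eq_square)
    also have "\<dots> \<le> len ^ 4 * 2"
      using len by (intro mult_right_mono power_increasing) auto
    finally have le: "len * (len + 1) \<le> len ^ 4 * 2" .
    have "?m * (len * (len + 1)) \<le> ?m ^ 4 * (len ^ 4 * 2)"
    proof (rule mult_mono [OF _ le])
      show "?m \<le> ?m ^ 4" using power_increasing [of 1 4 ?m] by simp
    qed auto
    then have *: "?m * (len * (len + 1)) \<le> ?m ^ 4 * len ^ 4 * 2" by (simp only: mult.assoc)
    have "16 * a \<le> 32000 * b" if "a \<le> b * 2" "1 \<le> b" for a b :: real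
      using that by linarith
    from this [OF * pow] show ?thesis by (simp only: mult.assoc)
  qed
  then have "16 * ?m * (len * (len + 1)) * X \<le> ?K * X"
    by (intro mult_right_mono X)
  with \<open>Q \<le> 16 * ?m * (len * (len + 1)) * X\<close>
  show "(\<Sum>x\<in>\<Omega>. \<pi> x * (f x)\<^sup>2)
      \<le> ?K * (1/2 * (\<Sum>x\<in>\<Omega>. \<Sum>y\<in>\<Omega>. \<pi> x * P x y * (f x + f y)\<^sup>2))"
    unfolding Q_def X_def by linarith
next
  let ?m = "real M + 1" and ?K = "32000 * (real M + 1) ^ 4 * len ^ 4"
  fix f :: "(nat \<Rightarrow> int) \<Rightarrow> real"
  assume mean: "(\<Sum>x\<in>\<Omega>. \<pi> x * f x) = 0"
  define Y where "Y = (\<Sum>i\<le>M. level_form i f) + (\<Sum>j<M. swap_form j f)"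
  define X where "X = 1/2 * (\<Sum>x\<in>\<Omega>. \<Sum>y\<in>\<Omega>. \<pi> x * P x y * (f x - f y)\<^sup>2)"
  have len: "1 \<le> len" using N_pos by simp
  have Y: "0 \<le> Y"
    unfolding Y_def by (intro add_nonneg_nonneg sum_nonneg) (auto intro: level_form_nonneg swap_form_nonneg)
  have YX: "1 / (8 * ?m) * Y \<le> X"
    unfolding X_def Y_def by (rule forms_le_dirichlet)
  obtain c where c: "(\<Sum>x\<in>\<Omega>. \<pi> x * (f x - c)\<^sup>2) \<le> 2000 * real (M + 1) ^ 3 * len\<^sup>2 * (len * (len + 1)) * Y"
    unfolding Y_def by (rule poincare)
  have tot: "(\<Sum>x\<in>\<Omega>. \<pi> x) = 1"
    unfolding \<pi>_def using w_total' by (intro sum_prod_PiE_eq_1) auto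
  have "(\<Sum>x\<in>\<Omega>. \<pi> x * (f x - c)\<^sup>2)
      = (\<Sum>x\<in>\<Omega>. \<pi> x * (f x)\<^sup>2 + c\<^sup>2 * \<pi> x - 2 * c * (\<pi> x * f x))"
    by (intro sum.cong) (auto simp: power2_eq_square algebra_simps)
  also have "\<dots> = (\<Sum>x\<in>\<Omega>. \<pi> x * (f x)\<^sup>2) + c\<^sup>2"
    by (simp add: sum.distrib sum_subtractf mean tot flip: sum_distrib_left)
  finally have "(\<Sum>x\<in>\<Omega>. \<pi> x * (f x)\<^sup>2)
      \<le> 2000 * real (M + 1) ^ 3 * len\<^sup>2 * (len * (len + 1)) * Y"
    using c zero_le_power2 [of c] by linarith
  also have "\<dots> = 2000 * ?m ^ 3 * (len\<^sup>2 * (len * (len + 1))) * Y"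
    by (simp add: add.commute)
  also have "\<dots> \<le> 2000 * ?m ^ 3 * (2 * len ^ 4) * Y"
  proof (intro mult_right_mono mult_left_mono Y)
    have "len\<^sup>2 * (len * (len + 1)) \<le> len\<^sup>2 * (len * (2 * len))"
      using len by (intro mult_left_mono) auto
    moreover have "u\<^sup>2 * (u * (2 * u)) = 2 * u ^ 4" for u :: real
      by (simp add: power2_eq_square power4_eq_xxxx)
    ultimately show "len\<^sup>2 * (len * (len + 1)) \<le> 2 * len ^ 4" by metis
  qed auto
  also have "\<dots> = ?K * (1 / (8 * ?m) * Y)"
  proof -
    have "2000 * m ^ 3 * (2 * u) * Y = 32000 * m ^ 4 * u * (1 / (8 * m) * Y)" if "m \<noteq> 0" for m u :: real
      using that by (simp add: power4_eq_xxxx power3_eq_cube)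
    from this [of ?m "len ^ 4"] show ?thesis by linarith
  qed
  also have "\<dots> \<le> ?K * X"
    by (intro mult_left_mono YX) auto
  finally show "(\<Sum>x\<in>\<Omega>. \<pi> x * (f x)\<^sup>2)
      \<le> ?K * (1/2 * (\<Sum>x\<in>\<Omega>. \<Sum>y\<in>\<Omega>. \<pi> x * P x y * (f x - f y)\<^sup>2))"
    unfolding X_def .
qed (use \<epsilon> t \<pi>_ge P_reversible P_stochastic in auto)

end

theorem theorem5p3:
  fixes C :: real and q :: "real poly"
  assumes "C > 1"
  shows "\<exists>p :: real poly poly. \<forall>(N :: nat) (N' :: nat) (M :: nat) (\<epsilon> :: real).
           N > 0 \<longrightarrow> N' > 0 \<longrightarrow> M > 0 \<longrightarrow> real M \<le> poly q (real (N + N')) \<longrightarrow>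
           0 < \<epsilon> \<longrightarrow> \<epsilon> < 1 \<longrightarrow>
           ereal_of_enat
             (mixing_time (swap_states N N' M) (swapping_chain C N N' M) (swap_dist C N N' M) \<epsilon>)
           \<le> ereal (poly2 p (real (N + N')) (ln (1 / \<epsilon>)))"
proof -
  \<comment> \<open>\<open>[:A, B:]\<close> is \<open>A + B v\<close>, linear in the outer variable
    \<open>v = ln (1 / \<epsilon>)\<close>, with coefficients that are polynomials in
    \<open>u = N + N'\<close>. The summand \<open>1\<close> in \<open>A\<close> pays for rounding up
    to a whole number of steps.\<close>
  define X where "X = ([:0, 1:] :: real poly)"
  define B where "B = [:32000:] * (q + 1) ^ 4 * X ^ 4"
  define A where "A = B * ((q + 1) * (X * [:1 + ln C:])) + 1"
  have poly2: "poly2 [:A, B:] u v = poly B u * (v + (poly q u + 1) * (u * (1 + ln C))) + 1" for u v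
    by (simp add: poly2_def A_def X_def algebra_simps)
  have B: "poly B u = 32000 * (poly q u + 1) ^ 4 * u ^ 4" for u
    by (simp add: B_def X_def)
  show ?thesis
  proof (intro exI [of _ "[:A, B:]"] allI impI)
    fix N N' M :: nat and \<epsilon> :: real
    assume *: "N > 0" "N' > 0" "M > 0" and M: "real M \<le> poly q (real (N + N'))" and \<epsilon>: "0 < \<epsilon>" "\<epsilon> < 1"
    interpret bimodal_swap C N N' M
      using assms * by unfold_locales
    define T where "T = 32000 * (real M + 1) ^ 4 * len ^ 4 * (ln (1 / \<epsilon>) + (real M + 1) * (len * (1 + ln C)))"
    define t where "t = nat \<lceil>T\<rceil>"
    have lnC: "0 \<le> ln C" and ln_eps: "0 \<le> ln (1 / \<epsilon>)"
      using assms \<epsilon> by (auto intro!: ln_ge_zero simp: field_simps)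
    have T: "0 \<le> T"
      unfolding T_def using lnC ln_eps by (intro mult_nonneg_nonneg add_nonneg_nonneg) auto
    have "mixing_time (swap_states N N' M) (swapping_chain C N N' M) (swap_dist C N N' M) \<epsilon> \<le> enat t"
      using \<epsilon>(1)
    proof (rule mixing_time_swapping_chain_le)
      show "32000 * (real M + 1) ^ 4 * len ^ 4 * (ln (1 / \<epsilon>) + (real M + 1) * (len * (1 + ln C))) \<le> real t"
        unfolding t_def T_def [symmetric] by linarith
    qed
    then have "ereal_of_enat (mixing_time (swap_states N N' M) (swapping_chain C N N' M) (swap_dist C N N' M) \<epsilon>)
        \<le> ereal_of_enat (enat t)"
      by (simp only: ereal_of_enat_le_iff)
    also have "\<dots> = ereal (real t)" by simp
    also have "\<dots> \<le> ereal (poly2 [:A, B:] len (ln (1 / \<epsilon>)))"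
    proof -
      \<comment> \<open>The bound is monotone in \<open>M\<close> because both logarithms are
        nonnegative, so \<open>M\<close> may be replaced by its polynomial bound.\<close>
      have "T \<le> poly B len * (ln (1 / \<epsilon>) + (poly q len + 1) * (len * (1 + ln C)))"
        unfolding T_def B using M lnC ln_eps
        by (intro mult_mono power_mono add_mono) auto
      then show ?thesis unfolding poly2 t_def using T by (simp del: of_nat_add) linarith
    qed
    finally show "ereal_of_enat (mixing_time (swap_states N N' M) (swapping_chain C N N' M) (swap_dist C N N' M) \<epsilon>)
        \<le> ereal (poly2 [:A, B:] (real (N + N')) (ln (1 / \<epsilon>)))" .
  qed
qed

end
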